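(* Let $(\mathcal{C},\mathbb{E},\mathfrak{s})$ be an extriangulated category with enough $\mathbb{E}$-projectives and enough $\mathbb{E}$-injectives, and let $J\subseteq \mathcal{C}$ be a subcategory with $\mathrm{free}(J)=J$ and $J\subseteq \mathcal{P}(\mathcal{C})\cap \mathcal{I}(\mathcal{C})$. Let $\mathcal{C}_J:=\mathcal{C}/[J]$ and let $\pi_J:\mathcal{C}\to\mathcal{C}_J$ be the canonical projection. If $n\geq 1$ and $\mathcal{X}$ with $\mathrm{free}(\mathcal{X})=\mathcal{X}$ is an $(n+2)$-rigid subcategory of $\mathcal{C}$ such that $\mathcal{X}^{\perp_{\leq n+1}}={}^{\perp_{\leq n+1}}\mathcal{X}$, then there exists an equivalence of extriangulated categories $$(G,\phi):\ \mathcal{X}^{\perp_{\leq n+1}}/[\mathrm{add}(\mathcal{X}\cup J)]\longrightarrow \pi_J(\mathcal{X}^{\perp_{\leq n+1}})/[\mathrm{add}(\pi_J(\mathcal{X}))].$$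
   Context: All subcategories are full. For a class $\mathcal{A}$ of objects of an additive category, $\mathrm{free}(\mathcal{A})$ is the class of all finite coproducts of objects of $\mathcal{A}$, $\mathrm{smd}(\mathcal{A})$ the class of all direct summands of objects of $\mathcal{A}$, and $\mathrm{add}(\mathcal{A}):=\mathrm{smd}(\mathrm{free}(\mathcal{A}))$. Extriangulated categories (Nakaoka–Palu). Let $\mathcal{C}$ be an additive category and $\mathbb{E}:\mathcal{C}^{op}\times\mathcal{C}\to \mathrm{Ab}$ an additive bifunctor (ET1). Elements $\delta\in\mathbb{E}(C,A)$ are called $\mathbb{E}$-extensions; for $a:A\to A'$ and $c:C'\to C$ write $a\cdot\delta:=\mathbb{E}(C,a)(\delta)$ and $\delta\cdot c:=\mathbb{E}(c^{op},A)(\delta)$. A morphism $(a,c):\delta\to\delta'$ from $\delta\in\mathbb{E}(C,A)$ to $\delta'\in\mathbb{E}(C',A')$ is a pair $a:A\to A'$, $c:C\to C'$ with $a\cdot\delta=\delta'\cdot c$. The element $\delta\oplus\delta'\in\mathbb{E}(C\oplus C',A\oplus A')$ corresponds to $(\delta,0,0,\delta')$ under biadditivity. Two sequences $A\to B\to C$ and $A\to B'\to C$ are equivalent if there is an isomorphism $B\to B'$ compatible with the maps from $A$ and to $C$; $[A\to B\to C]$ denotes the equivalence class. A realization $\mathfrak{s}$ assigns to each $\delta\in\mathbb{E}(C,A)$ a class $\mathfrak{s}(\delta)=[A\xrightarrow{x}B\xrightarrow{y}C]$ such that every morphism $(a,c):\delta\to\delta'$ extends to some $b$ making the diagram $(a,b,c)$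 between representing sequences commute (then $(a,b,c)$ is said to realize $(a,c)$). It is additive if $\mathfrak{s}(0)=[A\to A\oplus C\to C]$ (canonical inclusion and projection) and $\mathfrak{s}(\delta\oplus\delta')=\mathfrak{s}(\delta)\oplus\mathfrak{s}(\delta')$ (ET2). The triple $(\mathcal{C},\mathbb{E},\mathfrak{s})$ is extriangulated if (ET1), (ET2) and the following hold. (ET3) If $\mathfrak{s}(\delta)=[A\xrightarrow{x}B\xrightarrow{y}C]$, $\mathfrak{s}(\delta')=[A'\xrightarrow{x'}B'\xrightarrow{y'}C']$ and $bx=x'a$, then there is a morphism $(a,c):\delta\to\delta'$ realized by $(a,b,c)$; (ET3)$^{op}$ the dual: if $cy=y'b$, then there is $(a,c):\delta\to\delta'$ realized by $(a,b,c)$. (ET4) If $\delta\in\mathbb{E}(D,A)$, $\delta'\in\mathbb{E}(F,B)$ are realized by $A\xrightarrow{f}B\xrightarrow{f'}D$ and $B\xrightarrow{g}C\xrightarrow{g'}F$, then there are an object $E$, morphisms $h=gf:A\to C$, $h':C\to E$, $d:D\to E$, $e:E\to F$ with $h'g=df'$ and $eh'=g'$, and $\delta''\in\mathbb{E}(E,A)$ realized by $A\xrightarrow{h}C\xrightarrow{h'}E$, such that $\mathfrak{s}(f'\cdot\delta')=[D\xrightarrow{d}E\xrightarrow{e}F]$, $\delta''\cdot d=\delta$ and $f\cdot\delta''=\delta'\cdot e$; and (ET4)$^{op}$, the dual of (ET4). A sequence $A\to B\to C$ realizing some $\delta$ is a conflation, and together with $\delta$ it is an $\mathbb{E}$-triangle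 $A\to B\to C\overset{\delta}{\dashrightarrow}$. Projectives, injectives, higher extensions. $P$ is $\mathbb{E}$-projective if $\mathcal{C}(P,y)$ is surjective for every $\mathbb{E}$-triangle $A\xrightarrow{x}B\xrightarrow{y}C\dashrightarrow$ (equivalently $\mathbb{E}(P,-)=0$); $\mathbb{E}$-injectives are defined dually. $\mathcal{P}(\mathcal{C})$ and $\mathcal{I}(\mathcal{C})$ denote the classes of $\mathbb{E}$-projectives and $\mathbb{E}$-injectives. $\mathcal{C}$ has enough $\mathbb{E}$-projectives if each $C$ admits an $\mathbb{E}$-triangle $\Omega C\to P\to C\dashrightarrow$ with $P\in\mathcal{P}(\mathcal{C})$; dually, enough $\mathbb{E}$-injectives means each $C$ admits an $\mathbb{E}$-triangle $C\to I\to\Sigma C\dashrightarrow$ with $I\in\mathcal{I}(\mathcal{C})$. When both hold, iterating gives $\Omega^kC$, $\Sigma^kC$ and one sets $\mathbb{E}^{k+1}(X,Y):=\mathbb{E}(X,\Sigma^kY)\cong\mathbb{E}(\Omega^kX,Y)$ for $k\ge0$. Orthogonals and rigidity. $\mathcal{X}^{\perp_{\leq n+1}}:=\{N\in\mathcal{C}:\mathbb{E}^i(X,N)=0\ \forall X\in\mathcal{X},\ 1\le i\le n+1\}$ and ${}^{\perp_{\leq n+1}}\mathcal{X}:=\{N\in\mathcal{C}:\mathbb{E}^i(N,X)=0\ \forall X\in\mathcal{X},\ 1\le i\le n+1\}$. $\mathcal{X}$ is $(n+2)$-rigid if $\mathbb{E}^j(X,X')=0$ for all $X,X'\in\mathcal{X}$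 and $1\le j\le n+1$. Quotients. For a subcategory $\mathcal{Y}$ with $\mathrm{free}(\mathcal{Y})=\mathcal{Y}$, $[\mathcal{Y}]$ is the ideal of morphisms that factor through an object of $\mathcal{Y}$; the quotient by $[\mathcal{Y}]$ has the same objects and Hom groups $\mathrm{Hom}(A,B)/[\mathcal{Y}](A,B)$. If $(\mathcal{D},\mathbb{F},\mathfrak{t})$ is extriangulated, $\mathrm{free}(\mathcal{Y})=\mathcal{Y}$ and $\mathcal{Y}\subseteq\mathcal{P}(\mathcal{D})\cap\mathcal{I}(\mathcal{D})$, then $\mathcal{D}/[\mathcal{Y}]$, with canonical projection $q:\mathcal{D}\to\mathcal{D}/[\mathcal{Y}]$, is regarded as an extriangulated category (known result of Nakaoka–Palu) with bifunctor given by $\mathbb{F}(M,N)$ on objects and $(q(f)^{op},q(g))\mapsto\mathbb{F}(f^{op},g)$ on morphisms, and realization $\delta\mapsto[A\xrightarrow{q(x)}B\xrightarrow{q(y)}C]$ where $\mathfrak{t}(\delta)=[A\xrightarrow{x}B\xrightarrow{y}C]$. This gives the structure on $\mathcal{C}_J$. For $\mathcal{Y}\subseteq\mathcal{C}$, $\pi_J(\mathcal{Y}):=\{N\in\mathcal{C}_J: N\simeq\pi_J(Y)\text{ in }\mathcal{C}_J\text{ for some }Y\in\mathcal{Y}\}$ is the essential image, a full subcategory of $\mathcal{C}_J$. An extension-closed full subcategory of an extriangulated category is regarded as extriangulated by restricting the bifunctor and the realization. In this way $\mathcal{X}^{\perp_{\leq n+1}}\subseteq\mathcal{C}$ and $\pi_J(\mathcal{X}^{\perp_{\leq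 n+1}})\subseteq\mathcal{C}_J$ are extriangulated, and the two quotient categories in the claim carry the quotient extriangulated structures just described (with $\mathcal{Y}=\mathrm{add}(\mathcal{X}\cup J)$ and $\mathcal{Y}=\mathrm{add}(\pi_J(\mathcal{X}))$, respectively). Equivalences. An exact functor $(G,\phi):(\mathcal{D},\mathbb{F},\mathfrak{t})\to(\mathcal{D}',\mathbb{F}',\mathfrak{t}')$ between extriangulated categories is an additive functor $G:\mathcal{D}\to\mathcal{D}'$ with a natural transformation $\phi:\mathbb{F}\Rightarrow\mathbb{F}'\circ(G^{op}\times G)$ such that for each $\mathbb{F}$-triangle $A\xrightarrow{x}B\xrightarrow{y}C\overset{\delta}{\dashrightarrow}$, $G(A)\xrightarrow{G(x)}G(B)\xrightarrow{G(y)}G(C)\overset{\phi_{C,A}(\delta)}{\dashrightarrow}$ is an $\mathbb{F}'$-triangle. It is an equivalence of extriangulated categories if and only if $G$ is an equivalence of categories and $\phi$ is a natural isomorphism. *)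

theory Defs
  imports "HOL-Algebra.Coset"
begin

text \<open>
  Hom groups and extension groups are abelian groups in the sense of \<^locale>\<open>comm_group\<close>, whose
  operation is written multiplicatively: \<open>\<otimes>\<close> is the sum of two morphisms (or extensions) and
  \<open>\<one>\<close> is zero.

  Categories are presented by their object-indexed hom groups, and all operations take the objects
  involved as arguments, so hom sets of different pairs of objects need not be disjoint:

  \<^item> \<open>Comp \<C> A B C g f\<close> is the composite of \<open>f : A \<rightarrow> B\<close> and \<open>g : B \<rightarrow> C\<close>.
  \<^item> \<open>Ext \<C> C A\<close> is the group of extensions, contravariant in \<open>C\<close> and covariant in \<open>A\<close>.
  \<^item> \<open>Emap \<C> C' C A A' c a : Ext \<C> C A \<rightarrow> Ext \<C> C' A'\<close> is the map induced by \<open>c : C' \<rightarrow> C\<close> and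
    \<open>a : A \<rightarrow> A'\<close>.
  \<^item> \<open>Realz \<C> C A \<delta>\<close> is the realization of \<open>\<delta> \<in> Ext \<C> C A\<close>, an equivalence class of sequences
    \<open>A \<rightarrow> B \<rightarrow> C\<close>.  A sequence with fixed ends is the triple \<open>(B, x, y)\<close>
    with \<open>x : A \<rightarrow> B\<close> and \<open>y : B \<rightarrow> C\<close>.
\<close>

record ('o, 'm) addcat =
  Obj :: "'o set"
  Hom :: "'o \<Rightarrow> 'o \<Rightarrow> 'm monoid"
  Ident :: "'o \<Rightarrow> 'm"
  Comp :: "'o \<Rightarrow> 'o \<Rightarrow> 'o \<Rightarrow> 'm \<Rightarrow> 'm \<Rightarrow> 'm"

record ('o, 'm, 'e) extcat = "('o, 'm) addcat" +
  Ext :: "'o \<Rightarrow> 'o \<Rightarrow> 'e monoid"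
  Emap :: "'o \<Rightarrow> 'o \<Rightarrow> 'o \<Rightarrow> 'o \<Rightarrow> 'm \<Rightarrow> 'm \<Rightarrow> 'e \<Rightarrow> 'e"
  Realz :: "'o \<Rightarrow> 'o \<Rightarrow> 'e \<Rightarrow> ('o \<times> 'm \<times> 'm) set"

abbreviation mor :: "('o, 'm, 'z) addcat_scheme \<Rightarrow> 'o \<Rightarrow> 'o \<Rightarrow> 'm set" where
  "mor \<C> A B \<equiv> carrier (Hom \<C> A B)"

abbreviation exts :: "('o, 'm, 'e, 'z) extcat_scheme \<Rightarrow> 'o \<Rightarrow> 'o \<Rightarrow> 'e set" where
  "exts \<C> C A \<equiv> carrier (Ext \<C> C A)"


section \<open>Additive categories\<close>

definition is_iso :: "('o, 'm, 'z) addcat_scheme \<Rightarrow> 'o \<Rightarrow> 'o \<Rightarrow> 'm \<Rightarrow> bool" where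
  "is_iso \<C> A B f \<longleftrightarrow> f \<in> mor \<C> A B \<and>
     (\<exists>g \<in> mor \<C> B A. Comp \<C> A B A g f = Ident \<C> A \<and> Comp \<C> B A B f g = Ident \<C> B)"

definition isomorphic :: "('o, 'm, 'z) addcat_scheme \<Rightarrow> 'o \<Rightarrow> 'o \<Rightarrow> bool" where
  "isomorphic \<C> A B \<longleftrightarrow> (\<exists>f. is_iso \<C> A B f)"

definition is_zero_object :: "('o, 'm, 'z) addcat_scheme \<Rightarrow> 'o \<Rightarrow> bool" where
  "is_zero_object \<C> Z \<longleftrightarrow> Z \<in> Obj \<C> \<and>
     (\<forall>A \<in> Obj \<C>. (\<exists>!f. f \<in> mor \<C> A Z) \<and> (\<exists>!f. f \<in> mor \<C> Z A))"

definition is_biproduct ::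
  "('o, 'm, 'z) addcat_scheme \<Rightarrow> 'o \<Rightarrow> 'o \<Rightarrow> 'o \<Rightarrow> 'm \<Rightarrow> 'm \<Rightarrow> 'm \<Rightarrow> 'm \<Rightarrow> bool" where
  "is_biproduct \<C> A A' P i i' p p' \<longleftrightarrow>
     A \<in> Obj \<C> \<and> A' \<in> Obj \<C> \<and> P \<in> Obj \<C> \<and>
     i \<in> mor \<C> A P \<and> i' \<in> mor \<C> A' P \<and> p \<in> mor \<C> P A \<and> p' \<in> mor \<C> P A' \<and>
     Comp \<C> A P A p i = Ident \<C> A \<and>
     Comp \<C> A' P A' p' i' = Ident \<C> A' \<and>
     Comp \<C> A P A' p' i = \<one>\<^bsub>Hom \<C> A A'\<^esub> \<and>
     Comp \<C> A' P A p i' = \<one>\<^bsub>Hom \<C> A' A\<^esub> \<and>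
     Comp \<C> P A P i p \<otimes>\<^bsub>Hom \<C> P P\<^esub> Comp \<C> P A' P i' p' = Ident \<C> P"

text \<open>\<open>B\<close> is a coproduct of the finite family listed by \<open>As\<close> (a zero object if \<open>As = []\<close>).\<close>

definition is_coproduct :: "('o, 'm, 'z) addcat_scheme \<Rightarrow> 'o list \<Rightarrow> 'o \<Rightarrow> bool" where
  "is_coproduct \<C> As B \<longleftrightarrow> set As \<subseteq> Obj \<C> \<and> B \<in> Obj \<C> \<and>
     (\<exists>\<iota>. (\<forall>k < length As. \<iota> k \<in> mor \<C> (As ! k) B) \<and>
          (\<forall>T \<in> Obj \<C>. \<forall>f. (\<forall>k < length As. f k \<in> mor \<C> (As ! k) T) \<longrightarrow>
             (\<exists>!u. u \<in> mor \<C> B T \<and>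
                (\<forall>k < length As. Comp \<C> (As ! k) B T u (\<iota> k) = f k))))"

locale preadditive_category =
  fixes \<C> :: "('o, 'm, 'z) addcat_scheme"
  assumes hom_group: "\<lbrakk>A \<in> Obj \<C>; B \<in> Obj \<C>\<rbrakk> \<Longrightarrow> comm_group (Hom \<C> A B)"
    and ident_mor: "A \<in> Obj \<C> \<Longrightarrow> Ident \<C> A \<in> mor \<C> A A"
    and comp_mor: "\<lbrakk>A \<in> Obj \<C>; B \<in> Obj \<C>; C \<in> Obj \<C>; f \<in> mor \<C> A B; g \<in> mor \<C> B C\<rbrakk>
      \<Longrightarrow> Comp \<C> A B C g f \<in> mor \<C> A C"
    and comp_assoc: "\<lbrakk>A \<in> Obj \<C>; B \<in> Obj \<C>; C \<in> Obj \<C>; D \<in> Obj \<C>;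
        f \<in> mor \<C> A B; g \<in> mor \<C> B C; h \<in> mor \<C> C D\<rbrakk>
      \<Longrightarrow> Comp \<C> A B D (Comp \<C> B C D h g) f = Comp \<C> A C D h (Comp \<C> A B C g f)"
    and comp_ident_left: "\<lbrakk>A \<in> Obj \<C>; B \<in> Obj \<C>; f \<in> mor \<C> A B\<rbrakk>
      \<Longrightarrow> Comp \<C> A B B (Ident \<C> B) f = f"
    and comp_ident_right: "\<lbrakk>A \<in> Obj \<C>; B \<in> Obj \<C>; f \<in> mor \<C> A B\<rbrakk>
      \<Longrightarrow> Comp \<C> A A B f (Ident \<C> A) = f"
    and comp_add_left: "\<lbrakk>A \<in> Obj \<C>; B \<in> Obj \<C>; C \<in> Obj \<C>;
        f \<in> mor \<C> A B; g \<in> mor \<C> B C; g' \<in> mor \<C> B C\<rbrakk>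
      \<Longrightarrow> Comp \<C> A B C (g \<otimes>\<^bsub>Hom \<C> B C\<^esub> g') f =
          Comp \<C> A B C g f \<otimes>\<^bsub>Hom \<C> A C\<^esub> Comp \<C> A B C g' f"
    and comp_add_right: "\<lbrakk>A \<in> Obj \<C>; B \<in> Obj \<C>; C \<in> Obj \<C>;
        f \<in> mor \<C> A B; f' \<in> mor \<C> A B; g \<in> mor \<C> B C\<rbrakk>
      \<Longrightarrow> Comp \<C> A B C g (f \<otimes>\<^bsub>Hom \<C> A B\<^esub> f') =
          Comp \<C> A B C g f \<otimes>\<^bsub>Hom \<C> A C\<^esub> Comp \<C> A B C g f'"

locale additive_category = preadditive_category +
  assumes zero_object: "\<exists>Z. is_zero_object \<C> Z"
    and biproducts: "\<lbrakk>A \<in> Obj \<C>; A' \<in> Obj \<C>\<rbrakk>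
      \<Longrightarrow> \<exists>P i i' p p'. is_biproduct \<C> A A' P i i' p p'"

definition free_of :: "('o, 'm, 'z) addcat_scheme \<Rightarrow> 'o set \<Rightarrow> 'o set" where
  "free_of \<C> \<A> = {B. \<exists>As. set As \<subseteq> \<A> \<and> is_coproduct \<C> As B}"

definition smd_of :: "('o, 'm, 'z) addcat_scheme \<Rightarrow> 'o set \<Rightarrow> 'o set" where
  "smd_of \<C> \<A> = {A. \<exists>B \<in> \<A>. \<exists>A' i i' p p'. is_biproduct \<C> A A' B i i' p p'}"

definition add_of :: "('o, 'm, 'z) addcat_scheme \<Rightarrow> 'o set \<Rightarrow> 'o set" where
  "add_of \<C> \<A> = smd_of \<C> (free_of \<C> \<A>)"


section \<open>Sequences and extensions\<close>

definition sequences :: "('o, 'm, 'z) addcat_scheme \<Rightarrow> 'o \<Rightarrow> 'o \<Rightarrow> ('o \<times> 'm \<times> 'm) set" where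
  "sequences \<C> A C = {(B, x, y). B \<in> Obj \<C> \<and> x \<in> mor \<C> A B \<and> y \<in> mor \<C> B C}"

definition seq_equiv ::
  "('o, 'm, 'z) addcat_scheme \<Rightarrow> 'o \<Rightarrow> 'o \<Rightarrow> (('o \<times> 'm \<times> 'm) \<times> ('o \<times> 'm \<times> 'm)) set" where
  "seq_equiv \<C> A C = {((B, x, y), (B', x', y')).
     (B, x, y) \<in> sequences \<C> A C \<and> (B', x', y') \<in> sequences \<C> A C \<and>
     (\<exists>b. is_iso \<C> B B' b \<and> Comp \<C> A B B' b x = x' \<and> Comp \<C> B B' C y' b = y)}"

text \<open>\<open>push\<close> is \<open>a \<cdot> \<delta>\<close> for \<open>a : A \<rightarrow> A'\<close>, and \<open>pull\<close> is \<open>\<delta> \<cdot> c\<close> for \<open>c : C' \<rightarrow> C\<close>.\<close>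

definition push :: "('o, 'm, 'e, 'z) extcat_scheme \<Rightarrow> 'o \<Rightarrow> 'o \<Rightarrow> 'o \<Rightarrow> 'm \<Rightarrow> 'e \<Rightarrow> 'e" where
  "push \<C> C A A' a \<delta> = Emap \<C> C C A A' (Ident \<C> C) a \<delta>"

definition pull :: "('o, 'm, 'e, 'z) extcat_scheme \<Rightarrow> 'o \<Rightarrow> 'o \<Rightarrow> 'o \<Rightarrow> 'm \<Rightarrow> 'e \<Rightarrow> 'e" where
  "pull \<C> C' C A c \<delta> = Emap \<C> C' C A A c (Ident \<C> A) \<delta>"

definition ext_morphism ::
  "('o, 'm, 'e, 'z) extcat_scheme \<Rightarrow> 'o \<Rightarrow> 'o \<Rightarrow> 'e \<Rightarrow> 'o \<Rightarrow> 'o \<Rightarrow> 'e \<Rightarrow> 'm \<Rightarrow> 'm \<Rightarrow> bool" where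
  "ext_morphism \<C> C A \<delta> C' A' \<delta>' a c \<longleftrightarrow>
     a \<in> mor \<C> A A' \<and> c \<in> mor \<C> C C' \<and> push \<C> C A A' a \<delta> = pull \<C> C C' A' c \<delta>'"

text \<open>The triangle \<open>A \<rightarrow> B \<rightarrow> C\<close> with maps \<open>x\<close>, \<open>y\<close> and extension \<open>\<delta>\<close>.\<close>

definition triangle ::
  "('o, 'm, 'e, 'z) extcat_scheme \<Rightarrow> 'o \<Rightarrow> 'o \<Rightarrow> 'o \<Rightarrow> 'm \<Rightarrow> 'm \<Rightarrow> 'e \<Rightarrow> bool" where
  "triangle \<C> A B C x y \<delta> \<longleftrightarrow> A \<in> Obj \<C> \<and> C \<in> Obj \<C> \<and> \<delta> \<in> exts \<C> C A \<and>
     (B, x, y) \<in> Realz \<C> C A \<delta>"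

text \<open>The map \<open>f \<oplus> f' : P \<rightarrow> Q\<close> for \<open>f : A \<rightarrow> B\<close>, \<open>f' : A' \<rightarrow> B'\<close>, where \<open>p\<close>, \<open>p'\<close> are the projections
  of \<open>P = A \<oplus> A'\<close> and \<open>j\<close>, \<open>j'\<close> the inclusions of \<open>Q = B \<oplus> B'\<close>.\<close>

definition dsum_mor ::
  "('o, 'm, 'z) addcat_scheme \<Rightarrow> 'o \<Rightarrow> 'o \<Rightarrow> 'o \<Rightarrow> 'm \<Rightarrow> 'm \<Rightarrow> 'o \<Rightarrow> 'o \<Rightarrow> 'o \<Rightarrow> 'm \<Rightarrow> 'm
     \<Rightarrow> 'm \<Rightarrow> 'm \<Rightarrow> 'm" where
  "dsum_mor \<C> A A' P p p' B B' Q j j' f f' =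
     Comp \<C> P B Q j (Comp \<C> P A B f p) \<otimes>\<^bsub>Hom \<C> P Q\<^esub> Comp \<C> P B' Q j' (Comp \<C> P A' B' f' p')"

text \<open>\<open>\<theta> \<in> Ext \<C> R P\<close> is \<open>\<delta> \<oplus> \<delta>'\<close>, where \<open>p\<close>, \<open>p'\<close> are the projections of \<open>P = A \<oplus> A'\<close> and \<open>k\<close>, \<open>k'\<close>
  the inclusions of \<open>R = C \<oplus> C'\<close>: its components in the four groups
  are \<open>\<delta>\<close>, zero, zero and \<open>\<delta>'\<close>.\<close>

definition is_dsum_ext ::
  "('o, 'm, 'e, 'z) extcat_scheme \<Rightarrow> 'o \<Rightarrow> 'o \<Rightarrow> 'o \<Rightarrow> 'm \<Rightarrow> 'm \<Rightarrow> 'o \<Rightarrow> 'o \<Rightarrow> 'o \<Rightarrow> 'm \<Rightarrow> 'm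
     \<Rightarrow> 'e \<Rightarrow> 'e \<Rightarrow> 'e \<Rightarrow> bool" where
  "is_dsum_ext \<C> A A' P p p' C C' R k k' \<delta> \<delta>' \<theta> \<longleftrightarrow> \<theta> \<in> exts \<C> R P \<and>
     Emap \<C> C R P A k p \<theta> = \<delta> \<and>
     Emap \<C> C R P A' k p' \<theta> = \<one>\<^bsub>Ext \<C> C A'\<^esub> \<and>
     Emap \<C> C' R P A k' p \<theta> = \<one>\<^bsub>Ext \<C> C' A\<^esub> \<and>
     Emap \<C> C' R P A' k' p' \<theta> = \<delta>'"


section \<open>Extriangulated categories\<close>

locale extriangulated_category = additive_category \<C>
  for \<C> :: "('o, 'm, 'e, 'z) extcat_scheme" +
  assumes ext_group: "\<lbrakk>C \<in> Obj \<C>; A \<in> Obj \<C>\<rbrakk> \<Longrightarrow> comm_group (Ext \<C> C A)"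
    and emap_hom: "\<lbrakk>C' \<in> Obj \<C>; C \<in> Obj \<C>; A \<in> Obj \<C>; A' \<in> Obj \<C>; c \<in> mor \<C> C' C; a \<in> mor \<C> A A'\<rbrakk>
      \<Longrightarrow> Emap \<C> C' C A A' c a \<in> hom (Ext \<C> C A) (Ext \<C> C' A')"
    and emap_ident: "\<lbrakk>C \<in> Obj \<C>; A \<in> Obj \<C>; \<delta> \<in> exts \<C> C A\<rbrakk>
      \<Longrightarrow> Emap \<C> C C A A (Ident \<C> C) (Ident \<C> A) \<delta> = \<delta>"
    and emap_comp: "\<lbrakk>C'' \<in> Obj \<C>; C' \<in> Obj \<C>; C \<in> Obj \<C>; A \<in> Obj \<C>; A' \<in> Obj \<C>; A'' \<in> Obj \<C>;
        c' \<in> mor \<C> C'' C'; c \<in> mor \<C> C' C; a \<in> mor \<C> A A'; a' \<in> mor \<C> A' A''; \<delta> \<in> exts \<C> C A\<rbrakk>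
      \<Longrightarrow> Emap \<C> C'' C A A'' (Comp \<C> C'' C' C c c') (Comp \<C> A A' A'' a' a) \<delta> =
          Emap \<C> C'' C' A' A'' c' a' (Emap \<C> C' C A A' c a \<delta>)"
    and emap_add_left: "\<lbrakk>C' \<in> Obj \<C>; C \<in> Obj \<C>; A \<in> Obj \<C>; A' \<in> Obj \<C>;
        c \<in> mor \<C> C' C; d \<in> mor \<C> C' C; a \<in> mor \<C> A A'; \<delta> \<in> exts \<C> C A\<rbrakk>
      \<Longrightarrow> Emap \<C> C' C A A' (c \<otimes>\<^bsub>Hom \<C> C' C\<^esub> d) a \<delta> =
          Emap \<C> C' C A A' c a \<delta> \<otimes>\<^bsub>Ext \<C> C' A'\<^esub> Emap \<C> C' C A A' d a \<delta>"
    and emap_add_right: "\<lbrakk>C' \<in> Obj \<C>; C \<in> Obj \<C>; A \<in> Obj \<C>; A' \<in> Obj \<C>;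
        c \<in> mor \<C> C' C; a \<in> mor \<C> A A'; b \<in> mor \<C> A A'; \<delta> \<in> exts \<C> C A\<rbrakk>
      \<Longrightarrow> Emap \<C> C' C A A' c (a \<otimes>\<^bsub>Hom \<C> A A'\<^esub> b) \<delta> =
          Emap \<C> C' C A A' c a \<delta> \<otimes>\<^bsub>Ext \<C> C' A'\<^esub> Emap \<C> C' C A A' c b \<delta>"
    \<comment> \<open>\<open>Realz\<close> is a realization\<close>
    and realz_class: "\<lbrakk>C \<in> Obj \<C>; A \<in> Obj \<C>; \<delta> \<in> exts \<C> C A\<rbrakk>
      \<Longrightarrow> Realz \<C> C A \<delta> \<in> sequences \<C> A C // seq_equiv \<C> A C"
    and realz_morphism: "\<lbrakk>triangle \<C> A B C x y \<delta>; triangle \<C> A' B' C' x' y' \<delta>';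
        ext_morphism \<C> C A \<delta> C' A' \<delta>' a c\<rbrakk>
      \<Longrightarrow> \<exists>b \<in> mor \<C> B B'. Comp \<C> A B B' b x = Comp \<C> A A' B' x' a \<and>
            Comp \<C> B B' C' y' b = Comp \<C> B C C' c y"
    \<comment> \<open>\<open>Realz\<close> is additive\<close>
    and realz_zero: "is_biproduct \<C> A C P i i' p p'
      \<Longrightarrow> triangle \<C> A P C i p' \<one>\<^bsub>Ext \<C> C A\<^esub>"
    and realz_dsum: "\<lbrakk>triangle \<C> A B C x y \<delta>; triangle \<C> A' B' C' x' y' \<delta>';
        is_biproduct \<C> A A' P i i' p p'; is_biproduct \<C> B B' Q j j' q q';
        is_biproduct \<C> C C' R k k' r r';
        is_dsum_ext \<C> A A' P p p' C C' R k k' \<delta> \<delta>' \<theta>\<rbrakk>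
      \<Longrightarrow> triangle \<C> P Q R
            (dsum_mor \<C> A A' P p p' B B' Q j j' x x')
            (dsum_mor \<C> B B' Q q q' C C' R k k' y y') \<theta>"
    and ET3: "\<lbrakk>triangle \<C> A B C x y \<delta>; triangle \<C> A' B' C' x' y' \<delta>';
        a \<in> mor \<C> A A'; b \<in> mor \<C> B B'; Comp \<C> A B B' b x = Comp \<C> A A' B' x' a\<rbrakk>
      \<Longrightarrow> \<exists>c. ext_morphism \<C> C A \<delta> C' A' \<delta>' a c \<and> Comp \<C> B B' C' y' b = Comp \<C> B C C' c y"
    and ET3_op: "\<lbrakk>triangle \<C> A B C x y \<delta>; triangle \<C> A' B' C' x' y' \<delta>';
        c \<in> mor \<C> C C'; b \<in> mor \<C> B B'; Comp \<C> B C C' c y = Comp \<C> B B' C' y' b\<rbrakk>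
      \<Longrightarrow> \<exists>a. ext_morphism \<C> C A \<delta> C' A' \<delta>' a c \<and> Comp \<C> A B B' b x = Comp \<C> A A' B' x' a"
    and ET4: "\<lbrakk>triangle \<C> A B D f f' \<delta>; triangle \<C> B C F g g' \<delta>'\<rbrakk>
      \<Longrightarrow> \<exists>E h' d e \<delta>''. E \<in> Obj \<C> \<and> h' \<in> mor \<C> C E \<and> d \<in> mor \<C> D E \<and> e \<in> mor \<C> E F \<and>
            Comp \<C> B C E h' g = Comp \<C> B D E d f' \<and>
            Comp \<C> C E F e h' = g' \<and>
            triangle \<C> A C E (Comp \<C> A B C g f) h' \<delta>'' \<and>
            triangle \<C> D E F d e (push \<C> F B D f' \<delta>') \<and>
            pull \<C> D E A d \<delta>'' = \<delta> \<and>
            push \<C> E A B f \<delta>'' = pull \<C> E F B e \<delta>'"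
    and ET4_op: "\<lbrakk>triangle \<C> D B A f' f \<delta>; triangle \<C> F C B g' g \<delta>'\<rbrakk>
      \<Longrightarrow> \<exists>E h' d e \<delta>''. E \<in> Obj \<C> \<and> h' \<in> mor \<C> E C \<and> d \<in> mor \<C> E D \<and> e \<in> mor \<C> F E \<and>
            Comp \<C> E C B g h' = Comp \<C> E D B f' d \<and>
            Comp \<C> F E C h' e = g' \<and>
            triangle \<C> E C A h' (Comp \<C> C B A f g) \<delta>'' \<and>
            triangle \<C> F E D e d (pull \<C> D B F f' \<delta>') \<and>
            push \<C> A E D d \<delta>'' = \<delta> \<and>
            pull \<C> B A E f \<delta>'' = push \<C> B F E e \<delta>'"


section \<open>Projectives, injectives, higher extensions, rigidity\<close>

definition projectives :: "('o, 'm, 'e, 'z) extcat_scheme \<Rightarrow> 'o set" where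
  "projectives \<C> = {P \<in> Obj \<C>. \<forall>A B C x y \<delta>. triangle \<C> A B C x y \<delta> \<longrightarrow>
     (\<forall>f \<in> mor \<C> P C. \<exists>g \<in> mor \<C> P B. Comp \<C> P B C y g = f)}"

definition injectives :: "('o, 'm, 'e, 'z) extcat_scheme \<Rightarrow> 'o set" where
  "injectives \<C> = {I \<in> Obj \<C>. \<forall>A B C x y \<delta>. triangle \<C> A B C x y \<delta> \<longrightarrow>
     (\<forall>f \<in> mor \<C> A I. \<exists>g \<in> mor \<C> B I. Comp \<C> A B I g x = f)}"

definition enough_projectives :: "('o, 'm, 'e, 'z) extcat_scheme \<Rightarrow> bool" where
  "enough_projectives \<C> \<longleftrightarrow>
     (\<forall>C \<in> Obj \<C>. \<exists>K P x y \<delta>. P \<in> projectives \<C> \<and> triangle \<C> K P C x y \<delta>)"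

definition enough_injectives :: "('o, 'm, 'e, 'z) extcat_scheme \<Rightarrow> bool" where
  "enough_injectives \<C> \<longleftrightarrow>
     (\<forall>C \<in> Obj \<C>. \<exists>I S x y \<delta>. I \<in> injectives \<C> \<and> triangle \<C> C I S x y \<delta>)"

text \<open>A fixed choice of \<open>\<Sigma>C\<close>; up to isomorphism of groups, the higher extensions do not depend on it.\<close>

definition cosyzygy :: "('o, 'm, 'e, 'z) extcat_scheme \<Rightarrow> 'o \<Rightarrow> 'o" where
  "cosyzygy \<C> C = (SOME S. \<exists>I x y \<delta>. I \<in> injectives \<C> \<and> triangle \<C> C I S x y \<delta>)"

text \<open>The group of \<open>i\<close>-extensions, \<open>i \<ge> 1\<close>.\<close>

definition higher_ext :: "('o, 'm, 'e, 'z) extcat_scheme \<Rightarrow> nat \<Rightarrow> 'o \<Rightarrow> 'o \<Rightarrow> 'e monoid" where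
  "higher_ext \<C> i X Y = Ext \<C> X ((cosyzygy \<C> ^^ (i - 1)) Y)"

definition higher_ext_vanishes :: "('o, 'm, 'e, 'z) extcat_scheme \<Rightarrow> nat \<Rightarrow> 'o \<Rightarrow> 'o \<Rightarrow> bool" where
  "higher_ext_vanishes \<C> i X Y \<longleftrightarrow>
     carrier (higher_ext \<C> i X Y) = {\<one>\<^bsub>higher_ext \<C> i X Y\<^esub>}"

definition right_perp :: "('o, 'm, 'e, 'z) extcat_scheme \<Rightarrow> nat \<Rightarrow> 'o set \<Rightarrow> 'o set" where
  "right_perp \<C> m \<X> =
     {N \<in> Obj \<C>. \<forall>X \<in> \<X>. \<forall>i. 1 \<le> i \<and> i \<le> m \<longrightarrow> higher_ext_vanishes \<C> i X N}"

definition left_perp :: "('o, 'm, 'e, 'z) extcat_scheme \<Rightarrow> nat \<Rightarrow> 'o set \<Rightarrow> 'o set" where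
  "left_perp \<C> m \<X> =
     {N \<in> Obj \<C>. \<forall>X \<in> \<X>. \<forall>i. 1 \<le> i \<and> i \<le> m \<longrightarrow> higher_ext_vanishes \<C> i N X}"

definition rigid :: "('o, 'm, 'e, 'z) extcat_scheme \<Rightarrow> nat \<Rightarrow> 'o set \<Rightarrow> bool" where
  "rigid \<C> m \<X> \<longleftrightarrow>
     (\<forall>X \<in> \<X>. \<forall>X' \<in> \<X>. \<forall>j. 1 \<le> j \<and> j < m \<longrightarrow> higher_ext_vanishes \<C> j X X')"


section \<open>Full subcategories and quotients\<close>

definition full_subcat ::
  "('o, 'm, 'e) extcat \<Rightarrow> 'o set \<Rightarrow> ('o, 'm, 'e) extcat" where
  "full_subcat \<C> \<S> =
     \<C>\<lparr>Obj := \<S>, Realz := (\<lambda>C A \<delta>. {(B, x, y) \<in> Realz \<C> C A \<delta>. B \<in> \<S>})\<rparr>"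

definition ideal_of :: "('o, 'm, 'z) addcat_scheme \<Rightarrow> 'o set \<Rightarrow> 'o \<Rightarrow> 'o \<Rightarrow> 'm set" where
  "ideal_of \<C> \<Y> A B = {Comp \<C> A Y B v u | Y u v. Y \<in> \<Y> \<and> u \<in> mor \<C> A Y \<and> v \<in> mor \<C> Y B}"

text \<open>The projection \<open>q\<close> to the quotient category; it is the identity on objects.\<close>

definition quot_mor :: "('o, 'm, 'z) addcat_scheme \<Rightarrow> 'o set \<Rightarrow> 'o \<Rightarrow> 'o \<Rightarrow> 'm \<Rightarrow> 'm set" where
  "quot_mor \<C> \<Y> A B f = ideal_of \<C> \<Y> A B #>\<^bsub>Hom \<C> A B\<^esub> f"

definition repr :: "'m set \<Rightarrow> 'm" where
  "repr S = (SOME f. f \<in> S)"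

definition quot_cat :: "('o, 'm, 'z) addcat_scheme \<Rightarrow> 'o set \<Rightarrow> ('o, 'm set) addcat" where
  "quot_cat \<C> \<Y> =
     \<lparr>Obj = Obj \<C>,
      Hom = (\<lambda>A B. Hom \<C> A B Mod ideal_of \<C> \<Y> A B),
      Ident = (\<lambda>A. quot_mor \<C> \<Y> A A (Ident \<C> A)),
      Comp = (\<lambda>A B C T S. quot_mor \<C> \<Y> A C (Comp \<C> A B C (repr T) (repr S)))\<rparr>"

definition quot_extcat :: "('o, 'm, 'e) extcat \<Rightarrow> 'o set \<Rightarrow> ('o, 'm set, 'e) extcat" where
  "quot_extcat \<C> \<Y> = addcat.extend (quot_cat \<C> \<Y>)
     \<lparr>Ext = Ext \<C>,
      Emap = (\<lambda>C' C A A' T S. Emap \<C> C' C A A' (repr T) (repr S)),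
      Realz = (\<lambda>C A \<delta>. seq_equiv (quot_cat \<C> \<Y>) A C ``
        {(B, quot_mor \<C> \<Y> A B x, quot_mor \<C> \<Y> B C y) | B x y. (B, x, y) \<in> Realz \<C> C A \<delta>})\<rparr>"

text \<open>The essential image of \<open>\<Y>\<close> in the quotient by \<open>[J]\<close>.\<close>

definition ess_image :: "('o, 'm, 'z) addcat_scheme \<Rightarrow> 'o set \<Rightarrow> 'o set \<Rightarrow> 'o set" where
  "ess_image \<C> J \<Y> = {N \<in> Obj (quot_cat \<C> J). \<exists>Y \<in> \<Y>. isomorphic (quot_cat \<C> J) N Y}"


section \<open>Equivalences of extriangulated categories\<close>

definition is_functor ::
  "('o, 'm, 'y) addcat_scheme \<Rightarrow> ('p, 'n, 'z) addcat_scheme \<Rightarrow>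
     ('o \<Rightarrow> 'p) \<Rightarrow> ('o \<Rightarrow> 'o \<Rightarrow> 'm \<Rightarrow> 'n) \<Rightarrow> bool" where
  "is_functor \<D> \<D>' Go Gm \<longleftrightarrow>
     (\<forall>A \<in> Obj \<D>. Go A \<in> Obj \<D>') \<and>
     (\<forall>A \<in> Obj \<D>. \<forall>B \<in> Obj \<D>. \<forall>f \<in> mor \<D> A B. Gm A B f \<in> mor \<D>' (Go A) (Go B)) \<and>
     (\<forall>A \<in> Obj \<D>. Gm A A (Ident \<D> A) = Ident \<D>' (Go A)) \<and>
     (\<forall>A \<in> Obj \<D>. \<forall>B \<in> Obj \<D>. \<forall>C \<in> Obj \<D>. \<forall>f \<in> mor \<D> A B. \<forall>g \<in> mor \<D> B C.
        Gm A C (Comp \<D> A B C g f) = Comp \<D>' (Go A) (Go B) (Go C) (Gm B C g) (Gm A B f))"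

definition is_additive_functor ::
  "('o, 'm, 'y) addcat_scheme \<Rightarrow> ('p, 'n, 'z) addcat_scheme \<Rightarrow>
     ('o \<Rightarrow> 'p) \<Rightarrow> ('o \<Rightarrow> 'o \<Rightarrow> 'm \<Rightarrow> 'n) \<Rightarrow> bool" where
  "is_additive_functor \<D> \<D>' Go Gm \<longleftrightarrow> is_functor \<D> \<D>' Go Gm \<and>
     (\<forall>A \<in> Obj \<D>. \<forall>B \<in> Obj \<D>. Gm A B \<in> hom (Hom \<D> A B) (Hom \<D>' (Go A) (Go B)))"

definition is_natural_iso ::
  "('o, 'm, 'y) addcat_scheme \<Rightarrow> ('p, 'n, 'z) addcat_scheme \<Rightarrow>
     ('o \<Rightarrow> 'p) \<Rightarrow> ('o \<Rightarrow> 'o \<Rightarrow> 'm \<Rightarrow> 'n) \<Rightarrow> ('o \<Rightarrow> 'p) \<Rightarrow> ('o \<Rightarrow> 'o \<Rightarrow> 'm \<Rightarrow> 'n) \<Rightarrow> ('o \<Rightarrow> 'n) \<Rightarrow> bool" where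
  "is_natural_iso \<D> \<D>' Fo Fm Go Gm \<eta> \<longleftrightarrow>
     (\<forall>A \<in> Obj \<D>. is_iso \<D>' (Fo A) (Go A) (\<eta> A)) \<and>
     (\<forall>A \<in> Obj \<D>. \<forall>B \<in> Obj \<D>. \<forall>f \<in> mor \<D> A B.
        Comp \<D>' (Fo A) (Fo B) (Go B) (\<eta> B) (Fm A B f) =
        Comp \<D>' (Fo A) (Go A) (Go B) (Gm A B f) (\<eta> A))"

definition is_category_equivalence ::
  "('o, 'm, 'y) addcat_scheme \<Rightarrow> ('p, 'n, 'z) addcat_scheme \<Rightarrow>
     ('o \<Rightarrow> 'p) \<Rightarrow> ('o \<Rightarrow> 'o \<Rightarrow> 'm \<Rightarrow> 'n) \<Rightarrow> bool" where
  "is_category_equivalence \<D> \<D>' Go Gm \<longleftrightarrow> is_functor \<D> \<D>' Go Gm \<and>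
     (\<exists>Fo Fm \<eta> \<epsilon>. is_functor \<D>' \<D> Fo Fm \<and>
        is_natural_iso \<D> \<D> (\<lambda>A. A) (\<lambda>A B f. f)
          (\<lambda>A. Fo (Go A)) (\<lambda>A B f. Fm (Go A) (Go B) (Gm A B f)) \<eta> \<and>
        is_natural_iso \<D>' \<D>' (\<lambda>M. Go (Fo M)) (\<lambda>M N g. Gm (Fo M) (Fo N) (Fm M N g))
          (\<lambda>M. M) (\<lambda>M N g. g) \<epsilon>)"

definition is_exact_functor ::
  "('o, 'm, 'e, 'y) extcat_scheme \<Rightarrow> ('p, 'n, 'f, 'z) extcat_scheme \<Rightarrow>
     ('o \<Rightarrow> 'p) \<Rightarrow> ('o \<Rightarrow> 'o \<Rightarrow> 'm \<Rightarrow> 'n) \<Rightarrow> ('o \<Rightarrow> 'o \<Rightarrow> 'e \<Rightarrow> 'f) \<Rightarrow> bool" where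
  "is_exact_functor \<D> \<D>' Go Gm \<phi> \<longleftrightarrow>
     extriangulated_category \<D> \<and> extriangulated_category \<D>' \<and>
     is_additive_functor \<D> \<D>' Go Gm \<and>
     (\<forall>C \<in> Obj \<D>. \<forall>A \<in> Obj \<D>. \<phi> C A \<in> hom (Ext \<D> C A) (Ext \<D>' (Go C) (Go A))) \<and>
     (\<forall>C' \<in> Obj \<D>. \<forall>C \<in> Obj \<D>. \<forall>A \<in> Obj \<D>. \<forall>A' \<in> Obj \<D>.
        \<forall>c \<in> mor \<D> C' C. \<forall>a \<in> mor \<D> A A'. \<forall>\<delta> \<in> exts \<D> C A.
          \<phi> C' A' (Emap \<D> C' C A A' c a \<delta>) =
          Emap \<D>' (Go C') (Go C) (Go A) (Go A') (Gm C' C c) (Gm A A' a) (\<phi> C A \<delta>)) \<and>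
     (\<forall>A B C x y \<delta>. triangle \<D> A B C x y \<delta> \<longrightarrow>
        triangle \<D>' (Go A) (Go B) (Go C) (Gm A B x) (Gm B C y) (\<phi> C A \<delta>))"

definition is_extriangulated_equivalence ::
  "('o, 'm, 'e, 'y) extcat_scheme \<Rightarrow> ('p, 'n, 'f, 'z) extcat_scheme \<Rightarrow>
     ('o \<Rightarrow> 'p) \<Rightarrow> ('o \<Rightarrow> 'o \<Rightarrow> 'm \<Rightarrow> 'n) \<Rightarrow> ('o \<Rightarrow> 'o \<Rightarrow> 'e \<Rightarrow> 'f) \<Rightarrow> bool" where
  "is_extriangulated_equivalence \<D> \<D>' Go Gm \<phi> \<longleftrightarrow>
     is_exact_functor \<D> \<D>' Go Gm \<phi> \<and> is_category_equivalence \<D> \<D>' Go Gm \<and>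
     (\<forall>C \<in> Obj \<D>. \<forall>A \<in> Obj \<D>. \<phi> C A \<in> iso (Ext \<D> C A) (Ext \<D>' (Go C) (Go A)))"

end

theory Submission
  imports Defs
begin

text \<open>
  Write \<open>\<N>\<close> for \<open>\<X>\<^sup>\<bottom>\<close>, the class of objects orthogonal to \<open>\<X>\<close>, and \<open>\<C>\<^sub>J\<close> for \<open>\<C>/[J]\<close>.

  Maps through an object of \<open>J\<close> act as zero on extension groups, because \<open>J\<close> consists of projective
  injectives.  So \<open>\<C>\<^sub>J\<close> has the objects and the extension groups of \<open>\<C>\<close>.  As \<open>\<N>\<close> is
  also the left orthogonal of \<open>\<X>\<close>, it is given by the vanishing of certain groups \<open>\<E>(N, Z)\<close>, and
  therefore the essential image of \<open>\<N>\<close> in \<open>\<C>\<^sub>J\<close> is \<open>\<N>\<close> itself (\<open>ess_image_N\<close>).  Hence the two quotients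
  have the same objects and the same extension groups, and the equivalence is the identity on both.
  On morphisms it is the map
  \<open>Hom(A, B)/[add(\<X> \<union> J)] \<rightarrow> (Hom(A, B)/[J])/[add(\<pi>\<^sub>J \<X>)]\<close>,
  which is bijective by the third isomorphism theorem as soon as \<open>f \<in> [add(\<X> \<union> J)]\<close> is equivalent to
  \<open>\<pi>\<^sub>J f \<in> [add(\<pi>\<^sub>J \<X>)]\<close>.  That equivalence (\<open>ideal_of_add_of_quotient\<close>) rests on one observation:
  \<open>[add \<A>]\<close> is the smallest ideal of morphisms that contains the identities of the objects in \<open>\<A>\<close>
  (\<open>ideal_of_add_of_least\<close>), so that inclusions of such ideals need only be checked on those
  identities.  The same observation shows that a vanishing condition on extension groups passes from
  \<open>\<A>\<close> to \<open>add \<A>\<close>.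

  The larger part of the work is that all categories involved are extriangulated.  For extension-closed
  subcategories (\<open>extriangulated_full_subcat\<close>) the axioms restrict; that \<open>\<N>\<close> is extension-closed is
  the exactness statement \<open>ext_vanishes_middle\<close>.  For quotients by projective-injective objects
  (\<open>extriangulated_quotient\<close>) there are two difficulties.  A square may commute only up to a map
  through \<open>\<Y>\<close>; such a map extends along inflations and lifts along deflations and is
  absorbed into the middle map.  And a triangle of the quotient is only isomorphic to one that comes
  from \<open>\<C>\<close>, by an isomorphism that need not lift to \<open>\<C>\<close>; so two triangles with a common
  object need not be represented by triangles with a common object.  This is repaired by moving
  triangles along isomorphisms of their ends inside the quotient (\<open>triangle_transport\<close>), which needs only the
  axioms on single triangles and their morphisms.
\<close>


section \<open>Preadditive categories\<close>

context preadditive_category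
begin

declare ident_mor [simp] comp_mor [simp] comp_ident_left [simp] comp_ident_right [simp]

lemma hom_is_group: "\<lbrakk>A \<in> Obj \<C>; B \<in> Obj \<C>\<rbrakk> \<Longrightarrow> group (Hom \<C> A B)"
  using hom_group comm_group_def by blast

lemma zero_mor [simp]: "\<lbrakk>A \<in> Obj \<C>; B \<in> Obj \<C>\<rbrakk> \<Longrightarrow> \<one>\<^bsub>Hom \<C> A B\<^esub> \<in> mor \<C> A B"
  by (simp add: hom_is_group group.is_monoid monoid.one_closed)

lemma sum_mor [simp]: "\<lbrakk>A \<in> Obj \<C>; B \<in> Obj \<C>; f \<in> mor \<C> A B; g \<in> mor \<C> A B\<rbrakk>
    \<Longrightarrow> f \<otimes>\<^bsub>Hom \<C> A B\<^esub> g \<in> mor \<C> A B"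
  by (simp add: hom_is_group group.is_monoid monoid.m_closed)

lemma minus_mor [simp]: "\<lbrakk>A \<in> Obj \<C>; B \<in> Obj \<C>; f \<in> mor \<C> A B\<rbrakk>
    \<Longrightarrow> inv\<^bsub>Hom \<C> A B\<^esub> f \<in> mor \<C> A B"
  by (simp add: hom_is_group group.inv_closed)

lemma comp_zero_left [simp]:
  assumes "A \<in> Obj \<C>" "B \<in> Obj \<C>" "C \<in> Obj \<C>" "f \<in> mor \<C> A B"
  shows "Comp \<C> A B C \<one>\<^bsub>Hom \<C> B C\<^esub> f = \<one>\<^bsub>Hom \<C> A C\<^esub>"
proof -
  interpret AC: group "Hom \<C> A C" using assms by (simp add: hom_is_group)
  interpret BC: group "Hom \<C> B C" using assms by (simp add: hom_is_group)
  show ?thesis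
    using comp_add_left[OF assms, of "\<one>\<^bsub>Hom \<C> B C\<^esub>" "\<one>\<^bsub>Hom \<C> B C\<^esub>"] assms
    by (simp add: AC.l_cancel_one')
qed

lemma comp_zero_right [simp]:
  assumes "A \<in> Obj \<C>" "B \<in> Obj \<C>" "C \<in> Obj \<C>" "g \<in> mor \<C> B C"
  shows "Comp \<C> A B C g \<one>\<^bsub>Hom \<C> A B\<^esub> = \<one>\<^bsub>Hom \<C> A C\<^esub>"
proof -
  interpret AC: group "Hom \<C> A C" using assms by (simp add: hom_is_group)
  interpret AB: group "Hom \<C> A B" using assms by (simp add: hom_is_group)
  show ?thesis
    using comp_add_right[OF assms(1-3) _ _ assms(4), of "\<one>\<^bsub>Hom \<C> A B\<^esub>" "\<one>\<^bsub>Hom \<C> A B\<^esub>"] assms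
    by (simp add: AC.l_cancel_one')
qed

lemma comp_minus_left:
  assumes "A \<in> Obj \<C>" "B \<in> Obj \<C>" "C \<in> Obj \<C>" "f \<in> mor \<C> A B" "g \<in> mor \<C> B C"
  shows "Comp \<C> A B C (inv\<^bsub>Hom \<C> B C\<^esub> g) f = inv\<^bsub>Hom \<C> A C\<^esub> Comp \<C> A B C g f"
proof -
  interpret AC: group "Hom \<C> A C" using assms by (simp add: hom_is_group)
  interpret BC: group "Hom \<C> B C" using assms by (simp add: hom_is_group)
  show ?thesis
    using comp_add_left[OF assms(1-4), of "inv\<^bsub>Hom \<C> B C\<^esub> g" g] assms
    by (simp add: AC.inv_equality)
qed

lemma comp_minus_right:
  assumes "A \<in> Obj \<C>" "B \<in> Obj \<C>" "C \<in> Obj \<C>" "f \<in> mor \<C> A B" "g \<in> mor \<C> B C"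
  shows "Comp \<C> A B C g (inv\<^bsub>Hom \<C> A B\<^esub> f) = inv\<^bsub>Hom \<C> A C\<^esub> Comp \<C> A B C g f"
proof -
  interpret AC: group "Hom \<C> A C" using assms by (simp add: hom_is_group)
  interpret AB: group "Hom \<C> A B" using assms by (simp add: hom_is_group)
  show ?thesis
    using comp_add_right[OF assms(1-3) _ assms(4,5), of "inv\<^bsub>Hom \<C> A B\<^esub> f"] assms
    by (simp add: AC.inv_equality)
qed

lemma add_zero_mor [simp]:
  assumes "A \<in> Obj \<C>" "B \<in> Obj \<C>" "f \<in> mor \<C> A B"
  shows "f \<otimes>\<^bsub>Hom \<C> A B\<^esub> \<one>\<^bsub>Hom \<C> A B\<^esub> = f" "\<one>\<^bsub>Hom \<C> A B\<^esub> \<otimes>\<^bsub>Hom \<C> A B\<^esub> f = f"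
  using assms hom_is_group[of A B] by (simp_all add: group.is_monoid monoid.l_one monoid.r_one)

lemma comp_cancel_left:
  assumes "A \<in> Obj \<C>" "B \<in> Obj \<C>" "C \<in> Obj \<C>" "f \<in> mor \<C> A B"
    and "b \<in> mor \<C> B C" "b' \<in> mor \<C> C B" "Comp \<C> B C B b' b = Ident \<C> B"
  shows "Comp \<C> A C B b' (Comp \<C> A B C b f) = f"
  using assms comp_assoc[of A B C B f b b'] by simp

lemma comp_cancel_right:
  assumes "A \<in> Obj \<C>" "B \<in> Obj \<C>" "C \<in> Obj \<C>" "f \<in> mor \<C> B C"
    and "a \<in> mor \<C> A B" "a' \<in> mor \<C> B A" "Comp \<C> B A B a a' = Ident \<C> B"
  shows "Comp \<C> B A C (Comp \<C> A B C f a) a' = f"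
  using assms comp_assoc[of B A B C a' a f] by simp

lemma is_iso_ident: "A \<in> Obj \<C> \<Longrightarrow> is_iso \<C> A A (Ident \<C> A)"
  unfolding is_iso_def by (auto intro!: bexI[of _ "Ident \<C> A"])

lemma is_iso_comp:
  assumes "A \<in> Obj \<C>" "B \<in> Obj \<C>" "C \<in> Obj \<C>" "is_iso \<C> A B f" "is_iso \<C> B C g"
  shows "is_iso \<C> A C (Comp \<C> A B C g f)"
proof -
  obtain f' g' where [simp]: "f \<in> mor \<C> A B" "f' \<in> mor \<C> B A" "g \<in> mor \<C> B C" "g' \<in> mor \<C> C B"
    and inv: "Comp \<C> A B A f' f = Ident \<C> A" "Comp \<C> B A B f f' = Ident \<C> B"
      "Comp \<C> B C B g' g = Ident \<C> B" "Comp \<C> C B C g g' = Ident \<C> C"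
    using assms(4,5) unfolding is_iso_def by blast
  have "Comp \<C> A C A (Comp \<C> C B A f' g') (Comp \<C> A B C g f) = Comp \<C> A B A f' f"
    using assms(1-3) inv(3) comp_cancel_left[of A B C f g g'] by (simp add: comp_assoc)
  moreover have "Comp \<C> C A C (Comp \<C> A B C g f) (Comp \<C> C B A f' g') = Comp \<C> C B C g g'"
    using assms(1-3) inv(2) comp_cancel_left[of C B A g' f' f] by (simp add: comp_assoc)
  moreover have "Comp \<C> A B C g f \<in> mor \<C> A C" "Comp \<C> C B A f' g' \<in> mor \<C> C A"
    using assms(1-3) by auto
  ultimately show ?thesis
    unfolding is_iso_def using inv by (metis)
qed

lemma is_isoI:
  assumes "A \<in> Obj \<C>" "B \<in> Obj \<C>" "f \<in> mor \<C> A B" "l \<in> mor \<C> B A" "r \<in> mor \<C> B A"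
    and "Comp \<C> A B A l f = Ident \<C> A" "Comp \<C> B A B f r = Ident \<C> B"
  shows "is_iso \<C> A B f"
proof -
  have "l = r" using assms comp_assoc[of B A B A r f l] by simp
  then show ?thesis using assms unfolding is_iso_def by blast
qed

lemma is_iso_mor [dest]: "is_iso \<C> A B f \<Longrightarrow> f \<in> mor \<C> A B"
  unfolding is_iso_def by blast

lemma is_iso_inverse:
  assumes "is_iso \<C> A B f"
  obtains g where "g \<in> mor \<C> B A" "Comp \<C> A B A g f = Ident \<C> A" "Comp \<C> B A B f g = Ident \<C> B"
    "is_iso \<C> B A g"
  using assms unfolding is_iso_def by blast

lemma equiv_seq_equiv:
  assumes AC: "A \<in> Obj \<C>" "C \<in> Obj \<C>"
  shows "equiv (sequences \<C> A C) (seq_equiv \<C> A C)"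
proof (rule equivI)
  show "seq_equiv \<C> A C \<subseteq> sequences \<C> A C \<times> sequences \<C> A C"
    unfolding seq_equiv_def by auto
  show "refl_on (sequences \<C> A C) (seq_equiv \<C> A C)"
  proof (rule refl_onI)
    fix s assume "s \<in> sequences \<C> A C"
    then show "(s, s) \<in> seq_equiv \<C> A C"
      using AC is_iso_ident unfolding seq_equiv_def sequences_def
      by (auto intro!: exI[of _ "Ident \<C> (fst s)"])
  qed
  show "sym (seq_equiv \<C> A C)"
  proof (rule symI)
    fix s s' assume "(s, s') \<in> seq_equiv \<C> A C"
    then obtain B x y B' x' y' b where s: "s = (B, x, y)" "s' = (B', x', y')"
      and B: "B \<in> Obj \<C>" "B' \<in> Obj \<C>" "x \<in> mor \<C> A B" "x' \<in> mor \<C> A B'"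
        "y \<in> mor \<C> B C" "y' \<in> mor \<C> B' C"
      and b: "is_iso \<C> B B' b" "Comp \<C> A B B' b x = x'" "Comp \<C> B B' C y' b = y"
      unfolding seq_equiv_def sequences_def by auto
    obtain b' where b': "b' \<in> mor \<C> B' B" "Comp \<C> B B' B b' b = Ident \<C> B"
      "Comp \<C> B' B B' b b' = Ident \<C> B'" "is_iso \<C> B' B b'"
      using b(1) by (rule is_iso_inverse)
    have "Comp \<C> A B' B b' x' = x"
      using AC B b b' comp_cancel_left[of A B B' x b b'] is_iso_mor by auto
    moreover have "Comp \<C> B' B C y b' = y'"
      using AC B b b' comp_cancel_right[of B B' C y' b b'] is_iso_mor by auto
    ultimately show "(s', s) \<in> seq_equiv \<C> A C"
      using B b'(4) unfolding s seq_equiv_def sequences_def by auto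
  qed
  show "trans (seq_equiv \<C> A C)"
  proof (rule transI)
    fix s s' s'' assume "(s, s') \<in> seq_equiv \<C> A C" "(s', s'') \<in> seq_equiv \<C> A C"
    then obtain B x y B' x' y' b B'' x'' y'' b' where
      s: "s = (B, x, y)" "s' = (B', x', y')" "s'' = (B'', x'', y'')"
      and B: "B \<in> Obj \<C>" "B' \<in> Obj \<C>" "B'' \<in> Obj \<C>" "x \<in> mor \<C> A B" "x' \<in> mor \<C> A B'"
        "x'' \<in> mor \<C> A B''" "y \<in> mor \<C> B C" "y' \<in> mor \<C> B' C" "y'' \<in> mor \<C> B'' C"
      and b: "is_iso \<C> B B' b" "Comp \<C> A B B' b x = x'" "Comp \<C> B B' C y' b = y"
        "is_iso \<C> B' B'' b'" "Comp \<C> A B' B'' b' x' = x''" "Comp \<C> B' B'' C y'' b' = y'"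
      unfolding seq_equiv_def sequences_def by auto
    have [simp]: "b \<in> mor \<C> B B'" "b' \<in> mor \<C> B' B''" using b by auto
    have "is_iso \<C> B B'' (Comp \<C> B B' B'' b' b)"
      using is_iso_comp B b by blast
    moreover have "Comp \<C> A B B'' (Comp \<C> B B' B'' b' b) x = x''"
      using AC B b comp_assoc[of A B B' B'' x b b'] by simp
    moreover have "Comp \<C> B B'' C y'' (Comp \<C> B B' B'' b' b) = y"
      using AC B b comp_assoc[of B B' B'' C b b' y''] by simp
    ultimately show "(s, s'') \<in> seq_equiv \<C> A C"
      using B unfolding s seq_equiv_def sequences_def by auto
  qed
qed

lemma zero_object_Ident: "is_zero_object \<C> Z \<Longrightarrow> Ident \<C> Z = \<one>\<^bsub>Hom \<C> Z Z\<^esub>"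
  unfolding is_zero_object_def by (metis ident_mor zero_mor)

lemma biproduct_with_zero:
  assumes "is_zero_object \<C> Z" "B \<in> Obj \<C>"
  shows "is_biproduct \<C> B Z B (Ident \<C> B) \<one>\<^bsub>Hom \<C> Z B\<^esub> (Ident \<C> B) \<one>\<^bsub>Hom \<C> B Z\<^esub>"
    and "is_biproduct \<C> Z B B \<one>\<^bsub>Hom \<C> Z B\<^esub> (Ident \<C> B) \<one>\<^bsub>Hom \<C> B Z\<^esub> (Ident \<C> B)"
proof -
  have Z: "Z \<in> Obj \<C>" using assms unfolding is_zero_object_def by blast
  then show "is_biproduct \<C> B Z B (Ident \<C> B) \<one>\<^bsub>Hom \<C> Z B\<^esub> (Ident \<C> B) \<one>\<^bsub>Hom \<C> B Z\<^esub>"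
    "is_biproduct \<C> Z B B \<one>\<^bsub>Hom \<C> Z B\<^esub> (Ident \<C> B) \<one>\<^bsub>Hom \<C> B Z\<^esub> (Ident \<C> B)"
    using assms zero_object_Ident[OF assms(1)] unfolding is_biproduct_def by auto
qed

lemma biproduct_typed:
  assumes "is_biproduct \<C> A A' P i i' p p'"
  shows "A \<in> Obj \<C>" "A' \<in> Obj \<C>" "P \<in> Obj \<C>"
    "i \<in> mor \<C> A P" "i' \<in> mor \<C> A' P" "p \<in> mor \<C> P A" "p' \<in> mor \<C> P A'"
  using assms unfolding is_biproduct_def by auto

lemma biproduct_out_of:
  assumes bp: "is_biproduct \<C> A A' P i i' p p'" and T: "T \<in> Obj \<C>" "f \<in> mor \<C> P T"
  shows "Comp \<C> P A T (Comp \<C> A P T f i) p \<otimes>\<^bsub>Hom \<C> P T\<^esub>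
      Comp \<C> P A' T (Comp \<C> A' P T f i') p' = f"
proof -
  have "Comp \<C> P A T (Comp \<C> A P T f i) p \<otimes>\<^bsub>Hom \<C> P T\<^esub>
      Comp \<C> P A' T (Comp \<C> A' P T f i') p' =
    Comp \<C> P P T f (Comp \<C> P A P i p \<otimes>\<^bsub>Hom \<C> P P\<^esub> Comp \<C> P A' P i' p')"
    using biproduct_typed[OF bp] T by (simp add: comp_add_right comp_assoc)
  also have "\<dots> = f" using bp T unfolding is_biproduct_def by simp
  finally show ?thesis .
qed

end


section \<open>Coproducts and ideals of morphisms\<close>

definition is_ideal :: "('o, 'm, 'z) addcat_scheme \<Rightarrow> ('o \<Rightarrow> 'o \<Rightarrow> 'm set) \<Rightarrow> bool" where
  "is_ideal \<C> I \<longleftrightarrow>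
     (\<forall>A \<in> Obj \<C>. \<forall>B \<in> Obj \<C>. I A B \<subseteq> mor \<C> A B \<and> \<one>\<^bsub>Hom \<C> A B\<^esub> \<in> I A B \<and>
        (\<forall>f \<in> I A B. \<forall>g \<in> I A B. f \<otimes>\<^bsub>Hom \<C> A B\<^esub> g \<in> I A B)) \<and>
     (\<forall>A \<in> Obj \<C>. \<forall>B \<in> Obj \<C>. \<forall>C \<in> Obj \<C>.
        (\<forall>f \<in> I A B. \<forall>g \<in> mor \<C> B C. Comp \<C> A B C g f \<in> I A C) \<and>
        (\<forall>f \<in> mor \<C> A B. \<forall>g \<in> I B C. Comp \<C> A B C g f \<in> I A C))"

context preadditive_category
begin

text \<open>Closure under negatives holds because \<open>- f\<close> is the composite of \<open>f\<close> with \<open>- 1\<close>.\<close>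

lemma ideal_subgroup:
  assumes I: "is_ideal \<C> I" and AB: "A \<in> Obj \<C>" "B \<in> Obj \<C>"
  shows "subgroup (I A B) (Hom \<C> A B)"
proof -
  interpret group "Hom \<C> A B" using AB by (rule hom_is_group)
  show ?thesis
  proof (rule subgroupI)
    fix f assume f: "f \<in> I A B"
    then have [simp]: "f \<in> mor \<C> A B" using I AB unfolding is_ideal_def by blast
    have "Comp \<C> A B B (inv\<^bsub>Hom \<C> B B\<^esub> Ident \<C> B) f \<in> I A B"
      using f I AB unfolding is_ideal_def by simp
    then show "inv\<^bsub>Hom \<C> A B\<^esub> f \<in> I A B" using AB by (simp add: comp_minus_left)
  next
    show "I A B \<noteq> {}" using I AB unfolding is_ideal_def by blast
  qed (use I AB in \<open>auto simp: is_ideal_def\<close>)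
qed

lemma coproduct_append:
  assumes As: "is_coproduct \<C> As B" and Bs: "is_coproduct \<C> Bs B'"
    and bp: "is_biproduct \<C> B B' P i i' p p'"
  shows "is_coproduct \<C> (As @ Bs) P"
proof -
  note b = bp[unfolded is_biproduct_def]
  obtain \<iota> where As_obj: "set As \<subseteq> Obj \<C>" and \<iota>: "\<And>k. k < length As \<Longrightarrow> \<iota> k \<in> mor \<C> (As ! k) B"
    and u: "\<And>T f. T \<in> Obj \<C> \<Longrightarrow> (\<forall>k < length As. f k \<in> mor \<C> (As ! k) T) \<Longrightarrow>
      (\<exists>!u. u \<in> mor \<C> B T \<and> (\<forall>k < length As. Comp \<C> (As ! k) B T u (\<iota> k) = f k))"
    using As unfolding is_coproduct_def by metis
  obtain \<kappa> where Bs_obj: "set Bs \<subseteq> Obj \<C>" and \<kappa>: "\<And>k. k < length Bs \<Longrightarrow> \<kappa> k \<in> mor \<C> (Bs ! k) B'"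
    and w: "\<And>T f. T \<in> Obj \<C> \<Longrightarrow> (\<forall>k < length Bs. f k \<in> mor \<C> (Bs ! k) T) \<Longrightarrow>
      (\<exists>!u. u \<in> mor \<C> B' T \<and> (\<forall>k < length Bs. Comp \<C> (Bs ! k) B' T u (\<kappa> k) = f k))"
    using Bs unfolding is_coproduct_def by metis
  have objA: "As ! k \<in> Obj \<C>" if "k < length As" for k using that As_obj by auto
  have objB: "Bs ! k \<in> Obj \<C>" if "k < length Bs" for k using that Bs_obj by auto
  define \<mu> where "\<mu> k = (if k < length As then Comp \<C> (As ! k) B P i (\<iota> k)
    else Comp \<C> (Bs ! (k - length As)) B' P i' (\<kappa> (k - length As)))" for k
  have \<mu>: "\<mu> k \<in> mor \<C> ((As @ Bs) ! k) P" if "k < length (As @ Bs)" for k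
    using that b objA objB \<iota> \<kappa> by (auto simp: \<mu>_def nth_append)
  have "\<exists>!v. v \<in> mor \<C> P T \<and> (\<forall>k < length (As @ Bs). Comp \<C> ((As @ Bs) ! k) P T v (\<mu> k) = f k)"
    if T: "T \<in> Obj \<C>" and f: "\<forall>k < length (As @ Bs). f k \<in> mor \<C> ((As @ Bs) ! k) T" for T f
  proof -
    have fA: "\<forall>k < length As. f k \<in> mor \<C> (As ! k) T"
      using f by (metis length_append nth_append trans_less_add1)
    have fB: "\<forall>k < length Bs. f (length As + k) \<in> mor \<C> (Bs ! k) T"
    proof (intro allI impI)
      fix k assume "k < length Bs"
      then show "f (length As + k) \<in> mor \<C> (Bs ! k) T"
        using f[rule_format, of "length As + k"] by (simp add: nth_append)
    qed
    from u[OF T fA] obtain v1 where v1: "v1 \<in> mor \<C> B T"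
        "\<And>k. k < length As \<Longrightarrow> Comp \<C> (As ! k) B T v1 (\<iota> k) = f k"
      and v1u: "\<And>v. v \<in> mor \<C> B T \<Longrightarrow> (\<forall>k < length As. Comp \<C> (As ! k) B T v (\<iota> k) = f k) \<Longrightarrow> v = v1"
      by metis
    from w[OF T fB] obtain v2 where v2: "v2 \<in> mor \<C> B' T"
        "\<And>k. k < length Bs \<Longrightarrow> Comp \<C> (Bs ! k) B' T v2 (\<kappa> k) = f (length As + k)"
      and v2u: "\<And>v. v \<in> mor \<C> B' T \<Longrightarrow>
        (\<forall>k < length Bs. Comp \<C> (Bs ! k) B' T v (\<kappa> k) = f (length As + k)) \<Longrightarrow> v = v2"
      by metis
    \<comment> \<open>This reduces the universal property of \<open>P\<close> to those of \<open>B\<close> and \<open>B'\<close>.\<close>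
    have comps: "(\<forall>k < length (As @ Bs). Comp \<C> ((As @ Bs) ! k) P T v (\<mu> k) = f k) \<longleftrightarrow>
        Comp \<C> B P T v i = v1 \<and> Comp \<C> B' P T v i' = v2" if v: "v \<in> mor \<C> P T" for v
    proof -
      have "(\<forall>k < length (As @ Bs). Comp \<C> ((As @ Bs) ! k) P T v (\<mu> k) = f k) \<longleftrightarrow>
        (\<forall>k < length As. Comp \<C> (As ! k) P T v (\<mu> k) = f k) \<and>
        (\<forall>k < length Bs. Comp \<C> (Bs ! k) P T v (\<mu> (length As + k)) = f (length As + k))"
      proof (intro iffI conjI allI impI)
        fix k assume h: "\<forall>k < length (As @ Bs). Comp \<C> ((As @ Bs) ! k) P T v (\<mu> k) = f k"
        show "Comp \<C> (As ! k) P T v (\<mu> k) = f k" if "k < length As"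
          using h[rule_format, of k] that by (simp add: nth_append)
        show "Comp \<C> (Bs ! k) P T v (\<mu> (length As + k)) = f (length As + k)" if "k < length Bs"
          using h[rule_format, of "length As + k"] that by (simp add: nth_append)
      next
        fix k
        assume h: "(\<forall>k < length As. Comp \<C> (As ! k) P T v (\<mu> k) = f k) \<and>
          (\<forall>k < length Bs. Comp \<C> (Bs ! k) P T v (\<mu> (length As + k)) = f (length As + k))"
          and k: "k < length (As @ Bs)"
        show "Comp \<C> ((As @ Bs) ! k) P T v (\<mu> k) = f k"
        proof (cases "k < length As")
          case True
          then show ?thesis using h by (simp add: nth_append)
        next
          case False
          then show ?thesis using h[THEN conjunct2, rule_format, of "k - length As"] k
            by (simp add: nth_append)
        qed
      qed
      also have "\<dots> \<longleftrightarrow> (\<forall>k < length As. Comp \<C> (As ! k) B T (Comp \<C> B P T v i) (\<iota> k) = f k) \<and>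
        (\<forall>k < length Bs. Comp \<C> (Bs ! k) B' T (Comp \<C> B' P T v i') (\<kappa> k) = f (length As + k))"
        using b T v objA objB \<iota> \<kappa> by (auto simp: \<mu>_def comp_assoc)
      also have "\<dots> \<longleftrightarrow> Comp \<C> B P T v i = v1 \<and> Comp \<C> B' P T v i' = v2"
        using b T v v1 v2 v1u[of "Comp \<C> B P T v i"] v2u[of "Comp \<C> B' P T v i'"] by auto
      finally show ?thesis .
    qed
    define v where "v = Comp \<C> P B T v1 p \<otimes>\<^bsub>Hom \<C> P T\<^esub> Comp \<C> P B' T v2 p'"
    have "v \<in> mor \<C> P T" "Comp \<C> B P T v i = v1" "Comp \<C> B' P T v i' = v2"
      using b T v1 v2 by (simp_all add: v_def comp_add_left comp_assoc)
    moreover have "v' = v" if "v' \<in> mor \<C> P T" "Comp \<C> B P T v' i = v1" "Comp \<C> B' P T v' i' = v2" for v'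
      using biproduct_out_of[OF bp T that(1)] that v_def by simp
    ultimately show ?thesis using comps by metis
  qed
  then show ?thesis
    unfolding is_coproduct_def using As_obj Bs_obj b \<mu> by (intro conjI exI[of _ \<mu>]) auto
qed

lemma coproduct_singleton:
  assumes "A \<in> Obj \<C>"
  shows "is_coproduct \<C> [A] A"
proof -
  have "\<exists>!u. u \<in> mor \<C> A T \<and> Comp \<C> A A T u (Ident \<C> A) = f" if "T \<in> Obj \<C>" "f \<in> mor \<C> A T" for T f
    using that assms by (metis comp_ident_right)
  then show ?thesis
    using assms unfolding is_coproduct_def
    by (intro conjI exI[of _ "\<lambda>_. Ident \<C> A"]) auto
qed

text \<open>The identity of a finite coproduct is the sum of the idempotents that belong to the summands.
  So an ideal that contains the identities of the summands contains the identity of the coproduct.\<close>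

lemma ideal_coproduct:
  assumes I: "is_ideal \<C> I" and B: "is_coproduct \<C> As B"
    and As: "\<And>A. A \<in> set As \<Longrightarrow> Ident \<C> A \<in> I A A"
  shows "Ident \<C> B \<in> I B B"
proof -
  obtain \<iota> where obj: "set As \<subseteq> Obj \<C>" "B \<in> Obj \<C>"
    and \<iota>: "\<And>k. k < length As \<Longrightarrow> \<iota> k \<in> mor \<C> (As ! k) B"
    and u: "\<And>T f. T \<in> Obj \<C> \<Longrightarrow> (\<forall>k < length As. f k \<in> mor \<C> (As ! k) T) \<Longrightarrow>
      (\<exists>!u. u \<in> mor \<C> B T \<and> (\<forall>k < length As. Comp \<C> (As ! k) B T u (\<iota> k) = f k))"
    using B unfolding is_coproduct_def by metis
  have objA: "As ! k \<in> Obj \<C>" if "k < length As" for k using that obj by auto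
  \<comment> \<open>The partial sum \<open>e\<close> of the idempotents of the first \<open>m\<close> summands.\<close>
  have "\<exists>e \<in> I B B. \<forall>k < length As. Comp \<C> (As ! k) B B e (\<iota> k) =
      (if k < m then \<iota> k else \<one>\<^bsub>Hom \<C> (As ! k) B\<^esub>)" if "m \<le> length As" for m
    using that
  proof (induction m)
    case 0
    have "\<one>\<^bsub>Hom \<C> B B\<^esub> \<in> I B B" using I obj unfolding is_ideal_def by blast
    then show ?case using objA obj \<iota> by (intro bexI[of _ "\<one>\<^bsub>Hom \<C> B B\<^esub>"]) auto
  next
    case (Suc m)
    then obtain e where e: "e \<in> I B B" "\<And>k. k < length As \<Longrightarrow> Comp \<C> (As ! k) B B e (\<iota> k) =
      (if k < m then \<iota> k else \<one>\<^bsub>Hom \<C> (As ! k) B\<^esub>)" by fastforce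
    have m: "m < length As" using Suc by simp
    define \<delta> where "\<delta> k = (if k = m then Ident \<C> (As ! m) else \<one>\<^bsub>Hom \<C> (As ! k) (As ! m)\<^esub>)" for k
    have "\<forall>k < length As. \<delta> k \<in> mor \<C> (As ! k) (As ! m)"
      using objA m by (simp add: \<delta>_def)
    from ex1_implies_ex[OF u[OF objA[OF m] this]] obtain \<pi> where \<pi>: "\<pi> \<in> mor \<C> B (As ! m)"
      "\<And>k. k < length As \<Longrightarrow> Comp \<C> (As ! k) B (As ! m) \<pi> (\<iota> k) = \<delta> k" by blast
    define e' where "e' = e \<otimes>\<^bsub>Hom \<C> B B\<^esub> Comp \<C> B (As ! m) B (\<iota> m) \<pi>"
    have "Comp \<C> B (As ! m) (As ! m) (Ident \<C> (As ! m)) \<pi> \<in> I B (As ! m)"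
      using As[of "As ! m"] I obj objA m \<pi> unfolding is_ideal_def by (meson nth_mem)
    then have "Comp \<C> B (As ! m) B (\<iota> m) \<pi> \<in> I B B"
      using I obj objA m \<pi> \<iota> unfolding is_ideal_def by simp
    then have "e' \<in> I B B" using e I obj unfolding e'_def is_ideal_def by blast
    moreover have "e \<in> mor \<C> B B" using e I obj unfolding is_ideal_def by blast
    moreover have "Comp \<C> (As ! k) B B e' (\<iota> k) =
        (if k < Suc m then \<iota> k else \<one>\<^bsub>Hom \<C> (As ! k) B\<^esub>)" if k: "k < length As" for k
    proof -
      have "Comp \<C> (As ! k) B B e' (\<iota> k) = Comp \<C> (As ! k) B B e (\<iota> k) \<otimes>\<^bsub>Hom \<C> (As ! k) B\<^esub>
          Comp \<C> (As ! k) (As ! m) B (\<iota> m) (\<delta> k)"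
        using \<open>e \<in> mor \<C> B B\<close> \<pi> \<iota> objA obj m k by (simp add: e'_def comp_add_left comp_assoc)
      then show ?thesis
        using e(2)[OF k] \<iota> objA obj m k by (simp add: \<delta>_def less_Suc_eq)
    qed
    ultimately show ?case by blast
  qed
  from this[of "length As"] obtain e where e: "e \<in> I B B"
    "\<And>k. k < length As \<Longrightarrow> Comp \<C> (As ! k) B B e (\<iota> k) = \<iota> k" by auto
  moreover have "e \<in> mor \<C> B B" using e I obj unfolding is_ideal_def by blast
  ultimately have "e = Ident \<C> B" using u[of B \<iota>] obj objA \<iota>
    by (metis comp_ident_left ident_mor)
  with e show ?thesis by simp
qed

lemma ideal_factor:
  assumes I: "is_ideal \<C> I" and "A \<in> Obj \<C>" "B \<in> Obj \<C>" "W \<in> Obj \<C>" "Ident \<C> W \<in> I W W"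
    "u \<in> mor \<C> A W" "v \<in> mor \<C> W B"
  shows "Comp \<C> A W B v u \<in> I A B"
proof -
  have "Comp \<C> A W W (Ident \<C> W) u \<in> I A W" using assms unfolding is_ideal_def by blast
  then show ?thesis using assms unfolding is_ideal_def by simp
qed

lemma ideal_add_of:
  assumes I: "is_ideal \<C> I" and A: "\<And>A. A \<in> \<A> \<Longrightarrow> Ident \<C> A \<in> I A A"
    and W: "W \<in> add_of \<C> \<A>"
  shows "W \<in> Obj \<C>" "Ident \<C> W \<in> I W W"
proof -
  obtain As B W' i i' p p' where As: "set As \<subseteq> \<A>" "is_coproduct \<C> As B"
    and bp: "is_biproduct \<C> W W' B i i' p p'"
    using W unfolding add_of_def smd_of_def free_of_def by blast
  note b = bp[unfolded is_biproduct_def]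
  show "W \<in> Obj \<C>" using b by blast
  have "Ident \<C> B \<in> I B B" using ideal_coproduct[OF I As(2)] A As(1) by blast
  then have "Comp \<C> W B W p i \<in> I W W" using b by (intro ideal_factor[OF I]) auto
  then show "Ident \<C> W \<in> I W W" using b by simp
qed

end

lemma ideal_ofI: "\<lbrakk>Y \<in> \<Y>; u \<in> mor \<C> A Y; v \<in> mor \<C> Y B\<rbrakk> \<Longrightarrow> Comp \<C> A Y B v u \<in> ideal_of \<C> \<Y> A B"
  unfolding ideal_of_def by blast

context additive_category
begin

lemma is_ideal_ideal_of:
  assumes sub: "\<A> \<subseteq> Obj \<C>" and ne: "\<A> \<noteq> {}"
    and sum: "\<And>A A'. A \<in> \<A> \<Longrightarrow> A' \<in> \<A> \<Longrightarrow> \<exists>P \<in> \<A>. \<exists>i i' p p'. is_biproduct \<C> A A' P i i' p p'"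
  shows "is_ideal \<C> (ideal_of \<C> \<A>)"
  unfolding is_ideal_def
proof (intro conjI ballI)
  fix A B assume AB: "A \<in> Obj \<C>" "B \<in> Obj \<C>"
  show "ideal_of \<C> \<A> A B \<subseteq> mor \<C> A B" using AB sub unfolding ideal_of_def by auto
  obtain Y where Y: "Y \<in> \<A>" "Y \<in> Obj \<C>" using sub ne by blast
  have "\<one>\<^bsub>Hom \<C> A B\<^esub> = Comp \<C> A Y B \<one>\<^bsub>Hom \<C> Y B\<^esub> \<one>\<^bsub>Hom \<C> A Y\<^esub>" using AB Y by simp
  then show "\<one>\<^bsub>Hom \<C> A B\<^esub> \<in> ideal_of \<C> \<A> A B" 
    using ideal_ofI[OF Y(1), of "\<one>\<^bsub>Hom \<C> A Y\<^esub>" \<C> A "\<one>\<^bsub>Hom \<C> Y B\<^esub>" B] AB Y by simp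
  fix f g assume "f \<in> ideal_of \<C> \<A> A B" "g \<in> ideal_of \<C> \<A> A B"
  then obtain Y u v Y' u' v' where f: "Y \<in> \<A>" "u \<in> mor \<C> A Y" "v \<in> mor \<C> Y B" "f = Comp \<C> A Y B v u"
    and g: "Y' \<in> \<A>" "u' \<in> mor \<C> A Y'" "v' \<in> mor \<C> Y' B" "g = Comp \<C> A Y' B v' u'"
    unfolding ideal_of_def by blast
  obtain P i i' p p' where P: "P \<in> \<A>" and bp: "is_biproduct \<C> Y Y' P i i' p p'"
    using sum f g by blast
  note b = bp[unfolded is_biproduct_def]
  define U where "U = Comp \<C> A Y P i u \<otimes>\<^bsub>Hom \<C> A P\<^esub> Comp \<C> A Y' P i' u'"
  define V where "V = Comp \<C> P Y B v p \<otimes>\<^bsub>Hom \<C> P B\<^esub> Comp \<C> P Y' B v' p'"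
  have U: "U \<in> mor \<C> A P" and V: "V \<in> mor \<C> P B" using AB b f g by (simp_all add: U_def V_def)
  have "Comp \<C> A P Y p U = u" "Comp \<C> A P Y' p' U = u'"
    using AB b f g by (simp_all add: U_def comp_add_right comp_assoc[symmetric])
  then have "Comp \<C> A P B V U = f \<otimes>\<^bsub>Hom \<C> A B\<^esub> g"
    using AB b f g U by (simp add: V_def comp_add_left comp_assoc)
  then show "f \<otimes>\<^bsub>Hom \<C> A B\<^esub> g \<in> ideal_of \<C> \<A> A B"
    using ideal_ofI[OF P U V] by simp
next
  fix A B C f g assume ABC: "A \<in> Obj \<C>" "B \<in> Obj \<C>" "C \<in> Obj \<C>"
  show "Comp \<C> A B C g f \<in> ideal_of \<C> \<A> A C" if fg: "f \<in> ideal_of \<C> \<A> A B" "g \<in> mor \<C> B C"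
  proof -
    obtain Y u v where f: "Y \<in> \<A>" "u \<in> mor \<C> A Y" "v \<in> mor \<C> Y B" "f = Comp \<C> A Y B v u"
      using fg unfolding ideal_of_def by blast
    then have "Y \<in> Obj \<C>" using sub by blast
    then have "Comp \<C> A B C g f = Comp \<C> A Y C (Comp \<C> Y B C g v) u" "Comp \<C> Y B C g v \<in> mor \<C> Y C"
      using ABC f fg by (simp_all add: comp_assoc)
    then show ?thesis using ideal_ofI[OF f(1,2)] by simp
  qed
  show "Comp \<C> A B C g f \<in> ideal_of \<C> \<A> A C" if fg: "f \<in> mor \<C> A B" "g \<in> ideal_of \<C> \<A> B C"
  proof -
    obtain Y u v where g: "Y \<in> \<A>" "u \<in> mor \<C> B Y" "v \<in> mor \<C> Y C" "g = Comp \<C> B Y C v u"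
      using fg unfolding ideal_of_def by blast
    then have "Y \<in> Obj \<C>" using sub by blast
    then have "Comp \<C> A B C g f = Comp \<C> A Y C v (Comp \<C> A B Y u f)" "Comp \<C> A B Y u f \<in> mor \<C> A Y"
      using ABC g fg by (simp_all add: comp_assoc)
    then show ?thesis using ideal_ofI[OF g(1) _ g(3)] by simp
  qed
qed

lemma is_ideal_free_of:
  shows "is_ideal \<C> (ideal_of \<C> (free_of \<C> \<A>))"
proof (rule is_ideal_ideal_of)
  show "free_of \<C> \<A> \<subseteq> Obj \<C>" unfolding free_of_def is_coproduct_def by blast
  obtain Z where Z: "is_zero_object \<C> Z" using zero_object by blast
  then have "is_coproduct \<C> [] Z" unfolding is_coproduct_def is_zero_object_def by auto
  then have "Z \<in> free_of \<C> \<A>" unfolding free_of_def by force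
  then show "free_of \<C> \<A> \<noteq> {}" by blast
  fix B B' assume "B \<in> free_of \<C> \<A>" "B' \<in> free_of \<C> \<A>"
  then obtain As Bs where As: "set As \<subseteq> \<A>" "is_coproduct \<C> As B" "set Bs \<subseteq> \<A>" "is_coproduct \<C> Bs B'"
    unfolding free_of_def by blast
  then have "B \<in> Obj \<C>" "B' \<in> Obj \<C>" unfolding is_coproduct_def by auto
  then obtain P i i' p p' where bp: "is_biproduct \<C> B B' P i i' p p'" using biproducts by blast
  then have "is_coproduct \<C> (As @ Bs) P" using coproduct_append As by blast
  then have "P \<in> free_of \<C> \<A>" unfolding free_of_def using As by (auto intro!: exI[of _ "As @ Bs"])
  with bp show "\<exists>P \<in> free_of \<C> \<A>. \<exists>i i' p p'. is_biproduct \<C> B B' P i i' p p'" by blast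
qed

lemma free_of_subset_add_of: "free_of \<C> \<A> \<subseteq> add_of \<C> \<A>"
proof
  fix B assume B: "B \<in> free_of \<C> \<A>"
  obtain Z where Z: "is_zero_object \<C> Z" using zero_object by blast
  have "B \<in> Obj \<C>" using B unfolding free_of_def is_coproduct_def by blast
  from biproduct_with_zero(1)[OF Z this] B show "B \<in> add_of \<C> \<A>"
    unfolding add_of_def smd_of_def by blast
qed

lemma subset_add_of:
  assumes "\<A> \<subseteq> Obj \<C>"
  shows "\<A> \<subseteq> add_of \<C> \<A>"
proof
  fix A assume A: "A \<in> \<A>"
  then have "is_coproduct \<C> [A] A" using assms coproduct_singleton by blast
  then have "A \<in> free_of \<C> \<A>" unfolding free_of_def using A by (auto intro!: exI[of _ "[A]"])
  then show "A \<in> add_of \<C> \<A>" using free_of_subset_add_of by blast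
qed

lemma add_of_subset_Obj: "add_of \<C> \<A> \<subseteq> Obj \<C>"
  unfolding add_of_def smd_of_def is_biproduct_def by blast

text \<open>A map through a direct summand of a coproduct also goes through that coproduct.  Passing to
  summands therefore does not enlarge the ideal, and closure under sums need only be checked
  for coproducts.\<close>

lemma ideal_of_add_of:
  assumes AB: "A \<in> Obj \<C>" "B \<in> Obj \<C>"
  shows "ideal_of \<C> (add_of \<C> \<A>) A B = ideal_of \<C> (free_of \<C> \<A>) A B"
proof
  show "ideal_of \<C> (free_of \<C> \<A>) A B \<subseteq> ideal_of \<C> (add_of \<C> \<A>) A B"
    using free_of_subset_add_of unfolding ideal_of_def by blast
  show "ideal_of \<C> (add_of \<C> \<A>) A B \<subseteq> ideal_of \<C> (free_of \<C> \<A>) A B"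
  proof
    fix f assume "f \<in> ideal_of \<C> (add_of \<C> \<A>) A B"
    then obtain W u v D W' i i' p p' where f: "f = Comp \<C> A W B v u" "u \<in> mor \<C> A W" "v \<in> mor \<C> W B"
      and D: "D \<in> free_of \<C> \<A>" and bp: "is_biproduct \<C> W W' D i i' p p'"
      unfolding ideal_of_def add_of_def smd_of_def by blast
    note b = bp[unfolded is_biproduct_def]
    have "f = Comp \<C> A D B (Comp \<C> D W B v p) (Comp \<C> A W D i u)"
      using b f AB comp_cancel_left[of A W D u i p] by (simp add: comp_assoc)
    then show "f \<in> ideal_of \<C> (free_of \<C> \<A>) A B"
      using ideal_ofI[OF D, of "Comp \<C> A W D i u" \<C> A "Comp \<C> D W B v p" B] b f AB by simp
  qed
qed

lemma is_ideal_add_of: "is_ideal \<C> (ideal_of \<C> (add_of \<C> \<A>))"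
  using is_ideal_free_of[of \<A>] ideal_of_add_of[of _ _ \<A>] unfolding is_ideal_def by simp

lemma Ident_in_ideal_of: "W \<in> \<A> \<Longrightarrow> W \<in> Obj \<C> \<Longrightarrow> Ident \<C> W \<in> ideal_of \<C> \<A> W W"
  using ideal_ofI[of W \<A> "Ident \<C> W" \<C> W "Ident \<C> W" W] by simp

text \<open>An object of \<open>add \<A>\<close> is a retract of a coproduct, so its identity lies in every ideal that
  contains the identities of the objects in \<open>\<A>\<close>.  Hence \<open>[add \<A>]\<close> is the smallest such ideal.\<close>

lemma ideal_of_add_of_least:
  assumes "is_ideal \<C> I" "\<And>A. A \<in> \<A> \<Longrightarrow> Ident \<C> A \<in> I A A" "A \<in> Obj \<C>" "B \<in> Obj \<C>"
  shows "ideal_of \<C> (add_of \<C> \<A>) A B \<subseteq> I A B"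
proof
  fix f assume "f \<in> ideal_of \<C> (add_of \<C> \<A>) A B"
  then obtain W u v where W: "W \<in> add_of \<C> \<A>" "u \<in> mor \<C> A W" "v \<in> mor \<C> W B"
    and f: "f = Comp \<C> A W B v u"
    unfolding ideal_of_def by blast
  show "f \<in> I A B"
    unfolding f by (rule ideal_factor[OF assms(1,3,4) ideal_add_of[OF assms(1,2) W(1)] W(2,3)])
qed

end


section \<open>Triangles and isomorphisms of their ends\<close>

locale ext_bifunctor = additive_category \<C>
  for \<C> :: "('o, 'm, 'e, 'z) extcat_scheme" +
  assumes ext_group: "\<lbrakk>C \<in> Obj \<C>; A \<in> Obj \<C>\<rbrakk> \<Longrightarrow> comm_group (Ext \<C> C A)"
    and emap_hom: "\<lbrakk>C' \<in> Obj \<C>; C \<in> Obj \<C>; A \<in> Obj \<C>; A' \<in> Obj \<C>; c \<in> mor \<C> C' C; a \<in> mor \<C> A A'\<rbrakk>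
      \<Longrightarrow> Emap \<C> C' C A A' c a \<in> hom (Ext \<C> C A) (Ext \<C> C' A')"
    and emap_ident: "\<lbrakk>C \<in> Obj \<C>; A \<in> Obj \<C>; \<delta> \<in> exts \<C> C A\<rbrakk>
      \<Longrightarrow> Emap \<C> C C A A (Ident \<C> C) (Ident \<C> A) \<delta> = \<delta>"
    and emap_comp: "\<lbrakk>C'' \<in> Obj \<C>; C' \<in> Obj \<C>; C \<in> Obj \<C>; A \<in> Obj \<C>; A' \<in> Obj \<C>; A'' \<in> Obj \<C>;
        c' \<in> mor \<C> C'' C'; c \<in> mor \<C> C' C; a \<in> mor \<C> A A'; a' \<in> mor \<C> A' A''; \<delta> \<in> exts \<C> C A\<rbrakk>
      \<Longrightarrow> Emap \<C> C'' C A A'' (Comp \<C> C'' C' C c c') (Comp \<C> A A' A'' a' a) \<delta> =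
          Emap \<C> C'' C' A' A'' c' a' (Emap \<C> C' C A A' c a \<delta>)"
    and emap_add_left: "\<lbrakk>C' \<in> Obj \<C>; C \<in> Obj \<C>; A \<in> Obj \<C>; A' \<in> Obj \<C>;
        c \<in> mor \<C> C' C; d \<in> mor \<C> C' C; a \<in> mor \<C> A A'; \<delta> \<in> exts \<C> C A\<rbrakk>
      \<Longrightarrow> Emap \<C> C' C A A' (c \<otimes>\<^bsub>Hom \<C> C' C\<^esub> d) a \<delta> =
          Emap \<C> C' C A A' c a \<delta> \<otimes>\<^bsub>Ext \<C> C' A'\<^esub> Emap \<C> C' C A A' d a \<delta>"
    and emap_add_right: "\<lbrakk>C' \<in> Obj \<C>; C \<in> Obj \<C>; A \<in> Obj \<C>; A' \<in> Obj \<C>;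
        c \<in> mor \<C> C' C; a \<in> mor \<C> A A'; b \<in> mor \<C> A A'; \<delta> \<in> exts \<C> C A\<rbrakk>
      \<Longrightarrow> Emap \<C> C' C A A' c (a \<otimes>\<^bsub>Hom \<C> A A'\<^esub> b) \<delta> =
          Emap \<C> C' C A A' c a \<delta> \<otimes>\<^bsub>Ext \<C> C' A'\<^esub> Emap \<C> C' C A A' c b \<delta>"

text \<open>The axioms that do not compose triangles or add them.  They suffice to move a triangle along
  isomorphisms of its ends.  In a quotient category this is used to verify the remaining
  axioms, because there isomorphic objects need not be isomorphic before passing to the quotient.\<close>

locale weakly_extriangulated = ext_bifunctor \<C>
  for \<C> :: "('o, 'm, 'e, 'z) extcat_scheme" +
  assumes realz_class: "\<lbrakk>C \<in> Obj \<C>; A \<in> Obj \<C>; \<delta> \<in> exts \<C> C A\<rbrakk>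
      \<Longrightarrow> Realz \<C> C A \<delta> \<in> sequences \<C> A C // seq_equiv \<C> A C"
    and realz_morphism: "\<lbrakk>triangle \<C> A B C x y \<delta>; triangle \<C> A' B' C' x' y' \<delta>';
        ext_morphism \<C> C A \<delta> C' A' \<delta>' a c\<rbrakk>
      \<Longrightarrow> \<exists>b \<in> mor \<C> B B'. Comp \<C> A B B' b x = Comp \<C> A A' B' x' a \<and>
            Comp \<C> B B' C' y' b = Comp \<C> B C C' c y"
    and realz_zero: "is_biproduct \<C> A C P i i' p p'
      \<Longrightarrow> triangle \<C> A P C i p' \<one>\<^bsub>Ext \<C> C A\<^esub>"
    and ET3: "\<lbrakk>triangle \<C> A B C x y \<delta>; triangle \<C> A' B' C' x' y' \<delta>';
        a \<in> mor \<C> A A'; b \<in> mor \<C> B B'; Comp \<C> A B B' b x = Comp \<C> A A' B' x' a\<rbrakk>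
      \<Longrightarrow> \<exists>c. ext_morphism \<C> C A \<delta> C' A' \<delta>' a c \<and> Comp \<C> B B' C' y' b = Comp \<C> B C C' c y"
    and ET3_op: "\<lbrakk>triangle \<C> A B C x y \<delta>; triangle \<C> A' B' C' x' y' \<delta>';
        c \<in> mor \<C> C C'; b \<in> mor \<C> B B'; Comp \<C> B C C' c y = Comp \<C> B B' C' y' b\<rbrakk>
      \<Longrightarrow> \<exists>a. ext_morphism \<C> C A \<delta> C' A' \<delta>' a c \<and> Comp \<C> A B B' b x = Comp \<C> A A' B' x' a"

sublocale extriangulated_category \<subseteq> weakly_extriangulated
  by (intro weakly_extriangulated.intro weakly_extriangulated_axioms.intro
      ext_bifunctor.intro ext_bifunctor_axioms.intro additive_category_axioms)
    (fact ext_group emap_hom emap_ident emap_comp emap_add_left emap_add_right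
      realz_class realz_morphism realz_zero ET3 ET3_op)+

context ext_bifunctor
begin

declare emap_ident [simp]

lemma ext_is_group: "\<lbrakk>C \<in> Obj \<C>; A \<in> Obj \<C>\<rbrakk> \<Longrightarrow> group (Ext \<C> C A)"
  using ext_group comm_group_def by blast

lemma zero_ext [simp]: "\<lbrakk>C \<in> Obj \<C>; A \<in> Obj \<C>\<rbrakk> \<Longrightarrow> \<one>\<^bsub>Ext \<C> C A\<^esub> \<in> exts \<C> C A"
  by (simp add: ext_is_group group.is_monoid monoid.one_closed)

lemma emap_closed [simp]:
  "\<lbrakk>C' \<in> Obj \<C>; C \<in> Obj \<C>; A \<in> Obj \<C>; A' \<in> Obj \<C>; c \<in> mor \<C> C' C; a \<in> mor \<C> A A'; \<delta> \<in> exts \<C> C A\<rbrakk>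
    \<Longrightarrow> Emap \<C> C' C A A' c a \<delta> \<in> exts \<C> C' A'"
  using emap_hom[of C' C A A' c a] by (auto simp: hom_def)

lemma emap_zero [simp]:
  "\<lbrakk>C' \<in> Obj \<C>; C \<in> Obj \<C>; A \<in> Obj \<C>; A' \<in> Obj \<C>; c \<in> mor \<C> C' C; a \<in> mor \<C> A A'\<rbrakk>
    \<Longrightarrow> Emap \<C> C' C A A' c a \<one>\<^bsub>Ext \<C> C A\<^esub> = \<one>\<^bsub>Ext \<C> C' A'\<^esub>"
  using emap_hom hom_one[of "Emap \<C> C' C A A' c a"] ext_is_group by blast

lemma emap_zero_left [simp]:
  assumes "C' \<in> Obj \<C>" "C \<in> Obj \<C>" "A \<in> Obj \<C>" "A' \<in> Obj \<C>" "a \<in> mor \<C> A A'" "\<delta> \<in> exts \<C> C A"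
  shows "Emap \<C> C' C A A' \<one>\<^bsub>Hom \<C> C' C\<^esub> a \<delta> = \<one>\<^bsub>Ext \<C> C' A'\<^esub>"
proof -
  interpret E: group "Ext \<C> C' A'" using assms by (simp add: ext_is_group)
  show ?thesis
    using emap_add_left[of C' C A A' "\<one>\<^bsub>Hom \<C> C' C\<^esub>" "\<one>\<^bsub>Hom \<C> C' C\<^esub>" a \<delta>] assms
    by (simp add: E.l_cancel_one')
qed

lemma emap_zero_right [simp]:
  assumes "C' \<in> Obj \<C>" "C \<in> Obj \<C>" "A \<in> Obj \<C>" "A' \<in> Obj \<C>" "c \<in> mor \<C> C' C" "\<delta> \<in> exts \<C> C A"
  shows "Emap \<C> C' C A A' c \<one>\<^bsub>Hom \<C> A A'\<^esub> \<delta> = \<one>\<^bsub>Ext \<C> C' A'\<^esub>"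
proof -
  interpret E: group "Ext \<C> C' A'" using assms by (simp add: ext_is_group)
  show ?thesis
    using emap_add_right[of C' C A A' c "\<one>\<^bsub>Hom \<C> A A'\<^esub>" "\<one>\<^bsub>Hom \<C> A A'\<^esub>" \<delta>] assms
    by (simp add: E.l_cancel_one')
qed

lemma add_zero_ext [simp]:
  assumes "C \<in> Obj \<C>" "A \<in> Obj \<C>" "\<delta> \<in> exts \<C> C A"
  shows "\<delta> \<otimes>\<^bsub>Ext \<C> C A\<^esub> \<one>\<^bsub>Ext \<C> C A\<^esub> = \<delta>" "\<one>\<^bsub>Ext \<C> C A\<^esub> \<otimes>\<^bsub>Ext \<C> C A\<^esub> \<delta> = \<delta>"
  using assms ext_is_group[of C A] by (simp_all add: group.is_monoid monoid.l_one monoid.r_one)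

end

context weakly_extriangulated
begin

lemma triangle_typed:
  assumes "triangle \<C> A B C x y \<delta>"
  shows "A \<in> Obj \<C>" "B \<in> Obj \<C>" "C \<in> Obj \<C>" "x \<in> mor \<C> A B" "y \<in> mor \<C> B C" "\<delta> \<in> exts \<C> C A"
proof -
  show AC: "A \<in> Obj \<C>" "C \<in> Obj \<C>" and \<delta>: "\<delta> \<in> exts \<C> C A"
    using assms unfolding triangle_def by auto
  have "Realz \<C> C A \<delta> \<subseteq> sequences \<C> A C"
    using in_quotient_imp_subset[OF equiv_seq_equiv realz_class] AC \<delta> by blast
  then show "B \<in> Obj \<C>" "x \<in> mor \<C> A B" "y \<in> mor \<C> B C"
    using assms unfolding triangle_def sequences_def by auto
qed

lemma triangle_exists:
  assumes "C \<in> Obj \<C>" "A \<in> Obj \<C>" "\<delta> \<in> exts \<C> C A"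
  obtains B x y where "triangle \<C> A B C x y \<delta>"
proof -
  have "Realz \<C> C A \<delta> \<noteq> {}"
    using in_quotient_imp_non_empty[OF equiv_seq_equiv realz_class] assms by blast
  then obtain B x y where "(B, x, y) \<in> Realz \<C> C A \<delta>" by (metis prod_cases3 ex_in_conv)
  then show ?thesis using that assms unfolding triangle_def by blast
qed

lemma triangle_middle_iso:
  assumes t: "triangle \<C> A B C x y \<delta>" and b: "is_iso \<C> B B' b" and B': "B' \<in> Obj \<C>"
    and x': "Comp \<C> A B B' b x = x'" and y': "y' \<in> mor \<C> B' C" "Comp \<C> B B' C y' b = y"
  shows "triangle \<C> A B' C x' y' \<delta>"
proof -
  note T = triangle_typed[OF t]
  have "x' \<in> mor \<C> A B'" using T b B' x' by auto
  then have "((B, x, y), (B', x', y')) \<in> seq_equiv \<C> A C"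
    unfolding seq_equiv_def sequences_def using T b B' x' y' by auto
  then show ?thesis
    using in_quotient_imp_closed[OF equiv_seq_equiv realz_class] T t unfolding triangle_def by blast
qed

lemma triangle_from_zero:
  assumes Z: "is_zero_object \<C> Z" and B: "B \<in> Obj \<C>"
  shows "triangle \<C> Z B B \<one>\<^bsub>Hom \<C> Z B\<^esub> (Ident \<C> B) \<one>\<^bsub>Ext \<C> B Z\<^esub>"
    and "triangle \<C> B B Z (Ident \<C> B) \<one>\<^bsub>Hom \<C> B Z\<^esub> \<one>\<^bsub>Ext \<C> Z B\<^esub>"
  using realz_zero biproduct_with_zero[OF Z B] by blast+

text \<open>The next lemmas are the parts of the two long exact sequences of a triangle that are needed below.
  Each compares the given triangle with one that realizes zero: one with a zero object at an end,
  where (ET3) or its dual yields the missing third map, or a direct sum, where a morphism of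
  extensions is realized.\<close>

lemma pull_along_deflation:
  assumes t: "triangle \<C> A B C x y \<delta>"
  shows "Emap \<C> B C A A y (Ident \<C> A) \<delta> = \<one>\<^bsub>Ext \<C> B A\<^esub>"
proof -
  note T [simp] = triangle_typed[OF t]
  obtain Z where Z: "is_zero_object \<C> Z" using zero_object by blast
  then have [simp]: "Z \<in> Obj \<C>" unfolding is_zero_object_def by blast
  obtain c where c: "ext_morphism \<C> B Z \<one>\<^bsub>Ext \<C> B Z\<^esub> C A \<delta> \<one>\<^bsub>Hom \<C> Z A\<^esub> c"
    "Comp \<C> B B C y (Ident \<C> B) = Comp \<C> B B C c (Ident \<C> B)"
    using ET3[OF triangle_from_zero(1)[OF Z T(2)] t, of "\<one>\<^bsub>Hom \<C> Z A\<^esub>" "Ident \<C> B"] by auto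
  then have "c = y" unfolding ext_morphism_def by simp
  with c show ?thesis unfolding ext_morphism_def push_def pull_def by simp
qed

lemma push_along_inflation:
  assumes t: "triangle \<C> A B C x y \<delta>"
  shows "Emap \<C> C C A B (Ident \<C> C) x \<delta> = \<one>\<^bsub>Ext \<C> C B\<^esub>"
proof -
  note T [simp] = triangle_typed[OF t]
  obtain Z where Z: "is_zero_object \<C> Z" using zero_object by blast
  then have [simp]: "Z \<in> Obj \<C>" unfolding is_zero_object_def by blast
  obtain a where a: "ext_morphism \<C> C A \<delta> Z B \<one>\<^bsub>Ext \<C> Z B\<^esub> a \<one>\<^bsub>Hom \<C> C Z\<^esub>"
    "Comp \<C> A B B (Ident \<C> B) x = Comp \<C> A B B (Ident \<C> B) a"
    using ET3_op[OF t triangle_from_zero(2)[OF Z T(2)], of "\<one>\<^bsub>Hom \<C> C Z\<^esub>" "Ident \<C> B"] by auto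
  then have "a = x" unfolding ext_morphism_def by simp
  with a show ?thesis unfolding ext_morphism_def push_def pull_def by simp
qed

lemma lift_along_deflation:
  assumes t: "triangle \<C> A B C x y \<delta>" and f: "P \<in> Obj \<C>" "f \<in> mor \<C> P C"
    and 0: "Emap \<C> P C A A f (Ident \<C> A) \<delta> = \<one>\<^bsub>Ext \<C> P A\<^esub>"
  shows "\<exists>g \<in> mor \<C> P B. Comp \<C> P B C y g = f"
proof -
  note T [simp] = triangle_typed[OF t]
  obtain S i i' p p' where S: "is_biproduct \<C> A P S i i' p p'" using biproducts[OF T(1) f(1)] by blast
  have "ext_morphism \<C> P A \<one>\<^bsub>Ext \<C> P A\<^esub> C A \<delta> (Ident \<C> A) f"
    using f 0 unfolding ext_morphism_def push_def pull_def by simp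
  then obtain b where "b \<in> mor \<C> S B" "Comp \<C> S B C y b = Comp \<C> S P C f p'"
    using realz_morphism[OF realz_zero[OF S] t] by blast
  moreover then have "Comp \<C> P B C y (Comp \<C> P S B b i') = f"
    using S f unfolding is_biproduct_def by (simp add: comp_assoc[symmetric]) (simp add: comp_assoc)
  ultimately show ?thesis
    using f biproduct_typed[OF S] by (intro bexI[of _ "Comp \<C> P S B b i'"]) auto
qed

lemma extend_along_inflation:
  assumes t: "triangle \<C> A B C x y \<delta>" and f: "I \<in> Obj \<C>" "f \<in> mor \<C> A I"
    and 0: "Emap \<C> C C A I (Ident \<C> C) f \<delta> = \<one>\<^bsub>Ext \<C> C I\<^esub>"
  shows "\<exists>g \<in> mor \<C> B I. Comp \<C> A B I g x = f"
proof -
  note T [simp] = triangle_typed[OF t]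
  obtain S i i' p p' where S: "is_biproduct \<C> I C S i i' p p'" using biproducts[OF f(1) T(3)] by blast
  have "ext_morphism \<C> C A \<delta> C I \<one>\<^bsub>Ext \<C> C I\<^esub> f (Ident \<C> C)"
    using f 0 unfolding ext_morphism_def push_def pull_def by simp
  then obtain b where "b \<in> mor \<C> B S" "Comp \<C> A B S b x = Comp \<C> A I S i f"
    using realz_morphism[OF t realz_zero[OF S]] by blast
  moreover then have "Comp \<C> A B I (Comp \<C> B S I p b) x = f"
    using S f unfolding is_biproduct_def by (simp add: comp_assoc) (simp add: comp_assoc[symmetric])
  ultimately show ?thesis
    using f biproduct_typed[OF S] by (intro bexI[of _ "Comp \<C> B S I p b"]) auto
qed

lemma factor_through_deflation:
  assumes t: "triangle \<C> A B C x y \<delta>" and h: "X \<in> Obj \<C>" "h \<in> mor \<C> B X"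
    and 0: "Comp \<C> A B X h x = \<one>\<^bsub>Hom \<C> A X\<^esub>"
  shows "\<exists>g \<in> mor \<C> C X. Comp \<C> B C X g y = h"
proof -
  note T [simp] = triangle_typed[OF t]
  obtain Z where Z: "is_zero_object \<C> Z" using zero_object by blast
  then have [simp]: "Z \<in> Obj \<C>" unfolding is_zero_object_def by blast
  obtain c where "ext_morphism \<C> C A \<delta> X Z \<one>\<^bsub>Ext \<C> X Z\<^esub> \<one>\<^bsub>Hom \<C> A Z\<^esub> c"
    "Comp \<C> B X X (Ident \<C> X) h = Comp \<C> B C X c y"
    using ET3[OF t triangle_from_zero(1)[OF Z h(1)], of "\<one>\<^bsub>Hom \<C> A Z\<^esub>" h] h 0 by auto
  then show ?thesis using h unfolding ext_morphism_def by (intro bexI[of _ c]) auto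
qed

text \<open>Write the endomorphism as \<open>e = 1 + h\<close>.  Then \<open>h x = 0\<close>, so \<open>h = g y\<close> for some \<open>g\<close>, and
  \<open>y h = 0\<close> gives \<open>h h = g y h = 0\<close>.  Hence \<open>1 - h\<close> is an inverse.\<close>

lemma endo_fixing_ends_is_iso:
  assumes t: "triangle \<C> A B C x y \<delta>" and e: "e \<in> mor \<C> B B"
    and ex: "Comp \<C> A B B e x = x" and ye: "Comp \<C> B B C y e = y"
  shows "is_iso \<C> B B e"
proof -
  note T [simp] = triangle_typed[OF t]
  interpret BB: comm_group "Hom \<C> B B" by (simp add: hom_group)
  interpret AB: comm_group "Hom \<C> A B" by (simp add: hom_group)
  interpret BC: comm_group "Hom \<C> B C" by (simp add: hom_group)
  define h where "h = e \<otimes>\<^bsub>Hom \<C> B B\<^esub> inv\<^bsub>Hom \<C> B B\<^esub> Ident \<C> B"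
  define e' where "e' = Ident \<C> B \<otimes>\<^bsub>Hom \<C> B B\<^esub> inv\<^bsub>Hom \<C> B B\<^esub> h"
  have h [simp]: "h \<in> mor \<C> B B" and e' [simp]: "e' \<in> mor \<C> B B" using e by (simp_all add: h_def e'_def)
  have e_h: "e = Ident \<C> B \<otimes>\<^bsub>Hom \<C> B B\<^esub> h"
    using e by (simp add: h_def BB.m_lcomm[of _ e])
  have "Comp \<C> A B B h x = \<one>\<^bsub>Hom \<C> A B\<^esub>"
    using e ex by (simp add: h_def comp_add_left comp_minus_left)
  then obtain g where g: "g \<in> mor \<C> C B" "Comp \<C> B C B g y = h"
    using factor_through_deflation[OF t, of B h] by auto
  have "Comp \<C> B B C y h = \<one>\<^bsub>Hom \<C> B C\<^esub>"
    using e ye by (simp add: h_def comp_add_right comp_minus_right)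
  then have "Comp \<C> B B B (Comp \<C> B C B g y) h = \<one>\<^bsub>Hom \<C> B B\<^esub>"
    using g(1) by (simp add: comp_assoc)
  then have hh: "Comp \<C> B B B h h = \<one>\<^bsub>Hom \<C> B B\<^esub>" using g(2) by simp
  have "Comp \<C> B B B e e' = Ident \<C> B" "Comp \<C> B B B e' e = Ident \<C> B"
    unfolding e_h e'_def using hh
    by (simp_all add: comp_add_left comp_add_right comp_minus_left comp_minus_right BB.m_assoc)
  then show ?thesis unfolding is_iso_def using e e' by blast
qed

text \<open>Realize the isomorphism of extensions and its inverse.  The two composites of the middle maps
  fix the ends, hence are invertible, so the middle maps are.\<close>

lemma triangle_transport:
  assumes t: "triangle \<C> A B C x y \<delta>"
    and a: "A' \<in> Obj \<C>" "a \<in> mor \<C> A A'" "a' \<in> mor \<C> A' A"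
      "Comp \<C> A A' A a' a = Ident \<C> A" "Comp \<C> A' A A' a a' = Ident \<C> A'"
    and c: "C' \<in> Obj \<C>" "c \<in> mor \<C> C' C" "c' \<in> mor \<C> C C'"
      "Comp \<C> C' C C' c' c = Ident \<C> C'" "Comp \<C> C C' C c c' = Ident \<C> C"
  shows "triangle \<C> A' B C' (Comp \<C> A' A B x a') (Comp \<C> B C C' c' y) (Emap \<C> C' C A A' c a \<delta>)"
proof -
  note T [simp] = triangle_typed[OF t]
  note [simp] = a(1-3) c(1-3)
  define \<delta>' where "\<delta>' = Emap \<C> C' C A A' c a \<delta>"
  have [simp]: "\<delta>' \<in> exts \<C> C' A'" by (simp add: \<delta>'_def)
  obtain B' x' y' where t': "triangle \<C> A' B' C' x' y' \<delta>'"
    using triangle_exists[of C' A' \<delta>'] by auto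
  note T' [simp] = triangle_typed[OF t']
  have "ext_morphism \<C> C A \<delta> C' A' \<delta>' a c'"
    unfolding ext_morphism_def push_def pull_def using c(5) by (simp add: \<delta>'_def emap_comp[symmetric])
  then obtain b where b: "b \<in> mor \<C> B B'" "Comp \<C> A B B' b x = Comp \<C> A A' B' x' a"
      "Comp \<C> B B' C' y' b = Comp \<C> B C C' c' y"
    using realz_morphism[OF t t'] by blast
  have "ext_morphism \<C> C' A' \<delta>' C A \<delta> a' c"
    unfolding ext_morphism_def push_def pull_def using a(4) by (simp add: \<delta>'_def emap_comp[symmetric])
  then obtain b' where b': "b' \<in> mor \<C> B' B" "Comp \<C> A' B' B b' x' = Comp \<C> A' A B x a'"
      "Comp \<C> B' B C y b' = Comp \<C> B' C' C c y'"
    using realz_morphism[OF t' t] by blast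
  note [simp] = b(1) b'(1)
  have "Comp \<C> A B B (Comp \<C> B B' B b' b) x = x"
  proof -
    have "Comp \<C> A B B (Comp \<C> B B' B b' b) x = Comp \<C> A A' B (Comp \<C> A' B' B b' x') a"
      using b(2) by (simp add: comp_assoc)
    then show ?thesis using b'(2) a(4) by (simp add: comp_assoc)
  qed
  moreover have "Comp \<C> B B C y (Comp \<C> B B' B b' b) = y"
  proof -
    have "Comp \<C> B B C y (Comp \<C> B B' B b' b) = Comp \<C> B B' C (Comp \<C> B' C' C c y') b"
      using b'(3) by (simp add: comp_assoc[symmetric])
    also have "\<dots> = Comp \<C> B C' C c (Comp \<C> B C C' c' y)" using b(3) by (simp add: comp_assoc)
    also have "\<dots> = y" using c(5) by (simp add: comp_cancel_left)
    finally show ?thesis .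
  qed
  ultimately have "is_iso \<C> B B (Comp \<C> B B' B b' b)" using endo_fixing_ends_is_iso[OF t] by simp
  then obtain l where l: "l \<in> mor \<C> B B" "Comp \<C> B B B l (Comp \<C> B B' B b' b) = Ident \<C> B"
    by (metis is_iso_inverse)
  have "Comp \<C> A' B' B' (Comp \<C> B' B B' b b') x' = x'"
  proof -
    have "Comp \<C> A' B' B' (Comp \<C> B' B B' b b') x' = Comp \<C> A' A B' (Comp \<C> A B B' b x) a'"
      using b'(2) by (simp add: comp_assoc)
    then show ?thesis using b(2) a(5) by (simp add: comp_assoc)
  qed
  moreover have "Comp \<C> B' B' C' y' (Comp \<C> B' B B' b b') = y'"
  proof -
    have "Comp \<C> B' B' C' y' (Comp \<C> B' B B' b b') = Comp \<C> B' B C' (Comp \<C> B C C' c' y) b'"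
      using b(3) by (simp add: comp_assoc[symmetric])
    also have "\<dots> = Comp \<C> B' C C' c' (Comp \<C> B' C' C c y')" using b'(3) by (simp add: comp_assoc)
    also have "\<dots> = y'" using c(4) by (simp add: comp_cancel_left)
    finally show ?thesis .
  qed
  ultimately have "is_iso \<C> B' B' (Comp \<C> B' B B' b b')" using endo_fixing_ends_is_iso[OF t'] by simp
  then obtain r where r: "r \<in> mor \<C> B' B'" "Comp \<C> B' B' B' (Comp \<C> B' B B' b b') r = Ident \<C> B'"
    by (metis is_iso_inverse)
  have "is_iso \<C> B B' b"
    by (rule is_isoI[of B B' b "Comp \<C> B' B B l b'" "Comp \<C> B' B' B b' r"])
      (use l r in \<open>simp_all add: comp_assoc\<close>)
  then obtain \<beta> where \<beta>: "\<beta> \<in> mor \<C> B' B" "Comp \<C> B B' B \<beta> b = Ident \<C> B"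
      "Comp \<C> B' B B' b \<beta> = Ident \<C> B'" "is_iso \<C> B' B \<beta>" by (rule is_iso_inverse)
  have x: "x' = Comp \<C> A' B B' b (Comp \<C> A' A B x a')"
  proof -
    have "Comp \<C> A' B B' b (Comp \<C> A' A B x a') = Comp \<C> A' A B' (Comp \<C> A A' B' x' a) a'"
      using b(2) by (simp add: comp_assoc[symmetric])
    then show ?thesis using a(5) by (simp add: comp_assoc)
  qed
  have "triangle \<C> A' B C' (Comp \<C> A' A B x a') (Comp \<C> B B' C' y' b) \<delta>'"
  proof (rule triangle_middle_iso[OF t' \<beta>(4)])
    show "Comp \<C> A' B' B \<beta> x' = Comp \<C> A' A B x a'"
      unfolding x using \<beta> by (simp add: comp_cancel_left)
    show "Comp \<C> B' B C' (Comp \<C> B B' C' y' b) \<beta> = y'"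
      using \<beta> by (simp add: comp_cancel_right)
  qed auto
  then show ?thesis using b(3) by (simp add: \<delta>'_def)
qed

end


section \<open>Extension-closed subcategories\<close>

lemma full_subcat_simps [simp]:
  "Obj (full_subcat \<C> \<S>) = \<S>" "Hom (full_subcat \<C> \<S>) = Hom \<C>"
  "Ident (full_subcat \<C> \<S>) = Ident \<C>" "Comp (full_subcat \<C> \<S>) = Comp \<C>"
  "Ext (full_subcat \<C> \<S>) = Ext \<C>" "Emap (full_subcat \<C> \<S>) = Emap \<C>"
  by (simp_all add: full_subcat_def)

lemma ideal_of_full_subcat [simp]: "ideal_of (full_subcat \<C> \<S>) \<Y> = ideal_of \<C> \<Y>"
  by (simp add: ideal_of_def fun_eq_iff)

lemma is_ideal_full_subcat: "is_ideal \<C> I \<Longrightarrow> \<S> \<subseteq> Obj \<C> \<Longrightarrow> is_ideal (full_subcat \<C> \<S>) I"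
  unfolding is_ideal_def full_subcat_simps by (simp add: subset_iff)

lemma triangle_full_subcat:
  assumes "\<S> \<subseteq> Obj \<C>"
  shows "triangle (full_subcat \<C> \<S>) A B C x y \<delta> \<longleftrightarrow>
    triangle \<C> A B C x y \<delta> \<and> A \<in> \<S> \<and> B \<in> \<S> \<and> C \<in> \<S>"
  using assms unfolding triangle_def by (auto simp: full_subcat_def)

lemma ext_morphism_full_subcat [simp]:
  "ext_morphism (full_subcat \<C> \<S>) = ext_morphism \<C>"
  by (simp add: fun_eq_iff ext_morphism_def push_def pull_def)

locale extension_closed = extriangulated_category \<C>
  for \<C> :: "('o, 'm, 'e) extcat" +
  fixes \<S> :: "'o set"
  assumes sub: "\<S> \<subseteq> Obj \<C>"
    and zero: "\<exists>Z \<in> \<S>. is_zero_object \<C> Z"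
    and ext_closed: "\<lbrakk>triangle \<C> A B C x y \<delta>; A \<in> \<S>; C \<in> \<S>\<rbrakk> \<Longrightarrow> B \<in> \<S>"
begin

lemma subD: "A \<in> \<S> \<Longrightarrow> A \<in> Obj \<C>"
  using sub by blast

lemma is_biproduct_sub:
  "is_biproduct (full_subcat \<C> \<S>) A A' P i i' p p' \<longleftrightarrow>
    is_biproduct \<C> A A' P i i' p p' \<and> A \<in> \<S> \<and> A' \<in> \<S> \<and> P \<in> \<S>"
  using sub unfolding is_biproduct_def by auto

lemma realz_class_sub:
  assumes C: "C \<in> \<S>" and A: "A \<in> \<S>" and \<delta>: "\<delta> \<in> exts \<C> C A"
  shows "Realz (full_subcat \<C> \<S>) C A \<delta> \<in>
    sequences (full_subcat \<C> \<S>) A C // seq_equiv (full_subcat \<C> \<S>) A C"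
proof -
  have AC: "A \<in> Obj \<C>" "C \<in> Obj \<C>" using A C subD by auto
  obtain B x y where t: "triangle \<C> A B C x y \<delta>" using triangle_exists AC \<delta> by blast
  have B: "B \<in> \<S>" using ext_closed[OF t A C] .
  have mem: "(B', x', y') \<in> Realz \<C> C A \<delta> \<longleftrightarrow> ((B, x, y), (B', x', y')) \<in> seq_equiv \<C> A C" for B' x' y'
  proof
    assume "(B', x', y') \<in> Realz \<C> C A \<delta>"
    then show "((B, x, y), (B', x', y')) \<in> seq_equiv \<C> A C"
      using quotient_eq_iff[OF equiv_seq_equiv realz_class realz_class] AC \<delta> t
      unfolding triangle_def by blast
  next
    assume "((B, x, y), (B', x', y')) \<in> seq_equiv \<C> A C"
    then show "(B', x', y') \<in> Realz \<C> C A \<delta>"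
      using in_quotient_imp_closed[OF equiv_seq_equiv realz_class] AC \<delta> t
      unfolding triangle_def by blast
  qed
  have "((B, x, y), (B', x', y')) \<in> seq_equiv (full_subcat \<C> \<S>) A C \<longleftrightarrow>
      ((B, x, y), (B', x', y')) \<in> seq_equiv \<C> A C \<and> B' \<in> \<S>" for B' x' y'
    using B sub unfolding seq_equiv_def sequences_def is_iso_def by auto
  then have "Realz (full_subcat \<C> \<S>) C A \<delta> = seq_equiv (full_subcat \<C> \<S>) A C `` {(B, x, y)}"
    using mem by (auto simp: full_subcat_def Image_singleton)
  moreover have "(B, x, y) \<in> sequences (full_subcat \<C> \<S>) A C"
    using B triangle_typed[OF t] unfolding sequences_def by simp
  ultimately show ?thesis by (metis quotientI)
qed

theorem extriangulated_full_subcat: "extriangulated_category (full_subcat \<C> \<S>)"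
proof (intro extriangulated_category.intro additive_category.intro)
  show "preadditive_category (full_subcat \<C> \<S>)"
    by (rule preadditive_category.intro)
      (simp_all add: subD hom_group comp_assoc comp_add_left comp_add_right)
  show "additive_category_axioms (full_subcat \<C> \<S>)"
  proof
    show "\<exists>Z. is_zero_object (full_subcat \<C> \<S>) Z"
    proof -
      obtain Z where "Z \<in> \<S>" "is_zero_object \<C> Z" using zero by blast
      then have "is_zero_object (full_subcat \<C> \<S>) Z"
        using subD unfolding is_zero_object_def by simp
      then show ?thesis by blast
    qed
    fix A A' assume "A \<in> Obj (full_subcat \<C> \<S>)" "A' \<in> Obj (full_subcat \<C> \<S>)"
    then have A: "A \<in> \<S>" "A' \<in> \<S>" by simp_all
    then obtain P i i' p p' where bp: "is_biproduct \<C> A A' P i i' p p'"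
      using biproducts subD by blast
    then show "\<exists>P i i' p p'. is_biproduct (full_subcat \<C> \<S>) A A' P i i' p p'"
      using ext_closed[OF realz_zero[OF bp] A] A is_biproduct_sub by blast
  qed
  show "extriangulated_category_axioms (full_subcat \<C> \<S>)"
  proof (rule extriangulated_category_axioms.intro, goal_cases)
    case 7 then show ?case using realz_class_sub by simp
  next
    case (8 A B C x y \<delta> A' B' C' x' y' \<delta>' a c)
    then show ?case using realz_morphism[of A B C x y \<delta> A' B' C' x' y' \<delta>' a c] unfolding triangle_full_subcat[OF sub] by simp
  next
    case (9 A C P i i' p p')
    then show ?case using realz_zero[of A C P i i' p p'] unfolding triangle_full_subcat[OF sub] is_biproduct_sub by simp
  next
    case (10 A B C x y \<delta> A' B' C' x' y' \<delta>' P i i' p p' Q j j' q q' R k k' r r' \<theta>)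
    then show ?case
      using realz_dsum[of A B C x y \<delta> A' B' C' x' y' \<delta>' P i i' p p' Q j j' q q' R k k' r r' \<theta>]
      unfolding triangle_full_subcat[OF sub] is_biproduct_sub is_dsum_ext_def dsum_mor_def by simp
  next
    case (11 A B C x y \<delta> A' B' C' x' y' \<delta>' a b)
    then show ?case using ET3[of A B C x y \<delta> A' B' C' x' y' \<delta>' a b]
      unfolding triangle_full_subcat[OF sub] by simp
  next
    case (12 A B C x y \<delta> A' B' C' x' y' \<delta>' c b)
    then show ?case using ET3_op[of A B C x y \<delta> A' B' C' x' y' \<delta>' c b]
      unfolding triangle_full_subcat[OF sub] by simp
  next
    case (13 A B D f f' \<delta> C F g g' \<delta>')
    then have t: "triangle \<C> A B D f f' \<delta>" "triangle \<C> B C F g g' \<delta>'"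
      and S: "A \<in> \<S>" "B \<in> \<S>" "C \<in> \<S>" "D \<in> \<S>" "F \<in> \<S>"
      unfolding triangle_full_subcat[OF sub] by auto
    from ET4[OF t] obtain E h' d e \<delta>'' where E: "h' \<in> mor \<C> C E" "d \<in> mor \<C> D E" "e \<in> mor \<C> E F"
      "Comp \<C> B C E h' g = Comp \<C> B D E d f'" "Comp \<C> C E F e h' = g'"
      "triangle \<C> A C E (Comp \<C> A B C g f) h' \<delta>''"
      "triangle \<C> D E F d e (push \<C> F B D f' \<delta>')"
      "pull \<C> D E A d \<delta>'' = \<delta>" "push \<C> E A B f \<delta>'' = pull \<C> E F B e \<delta>'" by blast
    have "E \<in> \<S>" using ext_closed[OF E(7) S(4,5)] .
    then show ?case using E S unfolding triangle_full_subcat[OF sub] push_def pull_def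
      by (intro exI[of _ E] exI[of _ h'] exI[of _ d] exI[of _ e] exI[of _ \<delta>'']) simp
  next
    case (14 D B A f' f \<delta> F C g' g \<delta>')
    then have t: "triangle \<C> D B A f' f \<delta>" "triangle \<C> F C B g' g \<delta>'"
      and S: "A \<in> \<S>" "B \<in> \<S>" "C \<in> \<S>" "D \<in> \<S>" "F \<in> \<S>"
      unfolding triangle_full_subcat[OF sub] by auto
    from ET4_op[OF t] obtain E h' d e \<delta>'' where E: "h' \<in> mor \<C> E C" "d \<in> mor \<C> E D" "e \<in> mor \<C> F E"
      "Comp \<C> E C B g h' = Comp \<C> E D B f' d" "Comp \<C> F E C h' e = g'"
      "triangle \<C> E C A h' (Comp \<C> C B A f g) \<delta>''"
      "triangle \<C> F E D e d (pull \<C> D B F f' \<delta>')"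
      "push \<C> A E D d \<delta>'' = \<delta>" "pull \<C> B A E f \<delta>'' = push \<C> B F E e \<delta>'" by blast
    have "E \<in> \<S>" using ext_closed[OF E(7) S(5,4)] .
    then show ?case using E S unfolding triangle_full_subcat[OF sub] push_def pull_def
      by (intro exI[of _ E] exI[of _ h'] exI[of _ d] exI[of _ e] exI[of _ \<delta>'']) simp
  qed (simp_all add: subD ext_group emap_hom emap_comp emap_add_left emap_add_right)
qed

end


section \<open>Sums of maps along biproducts\<close>

context preadditive_category
begin

lemma dsum_mor_typed [simp]:
  assumes "is_biproduct \<C> A A' P i i' p p'" "is_biproduct \<C> B B' Q j j' q q'"
    and "f \<in> mor \<C> A B" "f' \<in> mor \<C> A' B'"
  shows "dsum_mor \<C> A A' P p p' B B' Q j j' f f' \<in> mor \<C> P Q"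
  unfolding dsum_mor_def using assms biproduct_typed[OF assms(1)] biproduct_typed[OF assms(2)] by simp

lemma biproduct_cancel:
  assumes bp: "is_biproduct \<C> A A' P i i' p p'" and T: "T \<in> Obj \<C>"
  shows "f \<in> mor \<C> T A \<Longrightarrow> Comp \<C> T P A p (Comp \<C> T A P i f) = f"
    and "f \<in> mor \<C> T A \<Longrightarrow> Comp \<C> T P A' p' (Comp \<C> T A P i f) = \<one>\<^bsub>Hom \<C> T A'\<^esub>"
    and "f' \<in> mor \<C> T A' \<Longrightarrow> Comp \<C> T P A' p' (Comp \<C> T A' P i' f') = f'"
    and "f' \<in> mor \<C> T A' \<Longrightarrow> Comp \<C> T P A p (Comp \<C> T A' P i' f') = \<one>\<^bsub>Hom \<C> T A\<^esub>"
  using bp T unfolding is_biproduct_def by (auto simp: comp_assoc[symmetric])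

lemma dsum_mor_comp:
  assumes P: "is_biproduct \<C> A A' P i i' p p'" and Q: "is_biproduct \<C> B B' Q j j' q q'"
    and R: "is_biproduct \<C> D D' R k k' r r'"
    and f: "f \<in> mor \<C> A B" "f' \<in> mor \<C> A' B'" and g: "g \<in> mor \<C> B D" "g' \<in> mor \<C> B' D'"
  shows "Comp \<C> P Q R (dsum_mor \<C> B B' Q q q' D D' R k k' g g') (dsum_mor \<C> A A' P p p' B B' Q j j' f f') =
    dsum_mor \<C> A A' P p p' D D' R k k' (Comp \<C> A B D g f) (Comp \<C> A' B' D' g' f')"
proof -
  note [simp] = biproduct_typed[OF P] biproduct_typed[OF Q] biproduct_typed[OF R] f g
  define F where "F = dsum_mor \<C> A A' P p p' B B' Q j j' f f'"
  have F [simp]: "F \<in> mor \<C> P Q" using P Q unfolding F_def by simp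
  have "Comp \<C> P Q B q F = Comp \<C> P A B f p" "Comp \<C> P Q B' q' F = Comp \<C> P A' B' f' p'"
    unfolding F_def dsum_mor_def by (simp_all add: comp_add_right biproduct_cancel[OF Q])
  then show ?thesis
    unfolding F_def[symmetric] by (simp add: dsum_mor_def comp_add_left comp_assoc)
qed

lemma dsum_mor_incl_proj:
  assumes P: "is_biproduct \<C> A A' P i i' p p'" and Q: "is_biproduct \<C> B B' Q j j' q q'"
    and f: "f \<in> mor \<C> A B" "f' \<in> mor \<C> A' B'"
  shows "Comp \<C> A P Q (dsum_mor \<C> A A' P p p' B B' Q j j' f f') i = Comp \<C> A B Q j f"
    and "Comp \<C> A' P Q (dsum_mor \<C> A A' P p p' B B' Q j j' f f') i' = Comp \<C> A' B' Q j' f'"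
    and "Comp \<C> P Q B q (dsum_mor \<C> A A' P p p' B B' Q j j' f f') = Comp \<C> P A B f p"
    and "Comp \<C> P Q B' q' (dsum_mor \<C> A A' P p p' B B' Q j j' f f') = Comp \<C> P A' B' f' p'"
proof -
  note [simp] = biproduct_typed[OF P] biproduct_typed[OF Q] f
  have [simp]: "Comp \<C> A P A p i = Ident \<C> A" "Comp \<C> A' P A' p' i' = Ident \<C> A'"
    "Comp \<C> A P A' p' i = \<one>\<^bsub>Hom \<C> A A'\<^esub>" "Comp \<C> A' P A p i' = \<one>\<^bsub>Hom \<C> A' A\<^esub>"
    using P unfolding is_biproduct_def by auto
  show "Comp \<C> A P Q (dsum_mor \<C> A A' P p p' B B' Q j j' f f') i = Comp \<C> A B Q j f"
    "Comp \<C> A' P Q (dsum_mor \<C> A A' P p p' B B' Q j j' f f') i' = Comp \<C> A' B' Q j' f'"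
    unfolding dsum_mor_def by (simp_all add: comp_add_left comp_assoc)
  show "Comp \<C> P Q B q (dsum_mor \<C> A A' P p p' B B' Q j j' f f') = Comp \<C> P A B f p"
    "Comp \<C> P Q B' q' (dsum_mor \<C> A A' P p p' B B' Q j j' f f') = Comp \<C> P A' B' f' p'"
    unfolding dsum_mor_def by (simp_all add: comp_add_right biproduct_cancel[OF Q])
qed

lemma dsum_mor_ident:
  assumes P: "is_biproduct \<C> A A' P i i' p p'"
  shows "dsum_mor \<C> A A' P p p' A A' P i i' (Ident \<C> A) (Ident \<C> A') = Ident \<C> P"
  using P unfolding is_biproduct_def dsum_mor_def by simp

lemma dsum_mor_iso:
  assumes P: "is_biproduct \<C> A A' P i i' p p'" and Q: "is_biproduct \<C> B B' Q j j' q q'"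
    and f: "f \<in> mor \<C> A B" "f' \<in> mor \<C> A' B'" and g: "g \<in> mor \<C> B A" "g' \<in> mor \<C> B' A'"
    and "Comp \<C> A B A g f = Ident \<C> A" "Comp \<C> A' B' A' g' f' = Ident \<C> A'"
  shows "Comp \<C> P Q P (dsum_mor \<C> B B' Q q q' A A' P i i' g g')
    (dsum_mor \<C> A A' P p p' B B' Q j j' f f') = Ident \<C> P"
  using dsum_mor_comp[OF P Q P f g] dsum_mor_ident[OF P] assms(7,8) by simp

end


section \<open>Quotients by projective-injective objects\<close>

text \<open>The quotient depends on \<open>\<Y>\<close> only through the ideal \<open>[\<Y>]\<close>, so closure under finite coproducts is
  stated as closure of that ideal under sums.  Projectivity and injectivity are stated as the vanishing of
  extension groups, which can be checked on generators.\<close>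

locale proj_inj_quotient = extriangulated_category \<C>
  for \<C> :: "('o, 'm, 'e) extcat" +
  fixes \<Y> :: "'o set"
  assumes Y_sub: "\<Y> \<subseteq> Obj \<C>"
    and Y_ideal: "is_ideal \<C> (ideal_of \<C> \<Y>)"
    and Y_proj: "\<lbrakk>Y \<in> \<Y>; A \<in> Obj \<C>\<rbrakk> \<Longrightarrow> exts \<C> Y A = {\<one>\<^bsub>Ext \<C> Y A\<^esub>}"
    and Y_inj: "\<lbrakk>Y \<in> \<Y>; C \<in> Obj \<C>\<rbrakk> \<Longrightarrow> exts \<C> C Y = {\<one>\<^bsub>Ext \<C> C Y\<^esub>}"
begin

abbreviation Q :: "('o, 'm set, 'e) extcat" where
  "Q \<equiv> quot_extcat \<C> \<Y>"

abbreviation \<pi> :: "'o \<Rightarrow> 'o \<Rightarrow> 'm \<Rightarrow> 'm set" where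
  "\<pi> \<equiv> quot_mor \<C> \<Y>"

abbreviation I :: "'o \<Rightarrow> 'o \<Rightarrow> 'm set" where
  "I \<equiv> ideal_of \<C> \<Y>"

lemma YD: "Y \<in> \<Y> \<Longrightarrow> Y \<in> Obj \<C>"
  using Y_sub by blast

lemma Q_simps:
  "Obj Q = Obj \<C>"
  "Hom Q A B = Hom \<C> A B Mod I A B"
  "Ident Q A = \<pi> A A (Ident \<C> A)"
  "Comp Q A B C T S = \<pi> A C (Comp \<C> A B C (repr T) (repr S))"
  "Ext Q = Ext \<C>"
  "Emap Q C' C A A' T S = Emap \<C> C' C A A' (repr T) (repr S)"
  "Realz Q C A \<delta> = seq_equiv (quot_cat \<C> \<Y>) A C ``
        {(B, \<pi> A B x, \<pi> B C y) | B x y. (B, x, y) \<in> Realz \<C> C A \<delta>}"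
  by (simp_all add: quot_extcat_def quot_cat_def addcat.extend_def)

lemma Obj_Q [simp]: "Obj Q = Obj \<C>" and Ext_Q [simp]: "Ext Q = Ext \<C>"
  by (simp_all add: Q_simps)

lemma seq_equiv_quot_cat: "seq_equiv (quot_cat \<C> \<Y>) A C = seq_equiv Q A C"
  by (simp add: seq_equiv_def sequences_def is_iso_def Q_simps) (simp add: quot_cat_def)

lemma I_normal: "A \<in> Obj \<C> \<Longrightarrow> B \<in> Obj \<C> \<Longrightarrow> normal (I A B) (Hom \<C> A B)"
  using ideal_subgroup[OF Y_ideal] hom_group comm_group.subgroup_imp_normal by blast

lemma I_mor: "f \<in> I A B \<Longrightarrow> A \<in> Obj \<C> \<Longrightarrow> B \<in> Obj \<C> \<Longrightarrow> f \<in> mor \<C> A B"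
  using Y_ideal unfolding is_ideal_def by blast

lemma mor_Q: "mor Q A B = \<pi> A B ` mor \<C> A B"
  by (auto simp: Q_simps FactGroup_def RCOSETS_def quot_mor_def)

lemma \<pi>_mor [simp]: "f \<in> mor \<C> A B \<Longrightarrow> \<pi> A B f \<in> mor Q A B"
  by (simp add: mor_Q)

lemma lift_mor:
  assumes "T \<in> mor Q A B"
  obtains f where "f \<in> mor \<C> A B" "T = \<pi> A B f"
  using assms unfolding mor_Q by blast

lemma \<pi>_sum:
  assumes "A \<in> Obj \<C>" "B \<in> Obj \<C>" "f \<in> mor \<C> A B" "g \<in> mor \<C> A B"
  shows "\<pi> A B f \<otimes>\<^bsub>Hom Q A B\<^esub> \<pi> A B g = \<pi> A B (f \<otimes>\<^bsub>Hom \<C> A B\<^esub> g)"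
  using assms normal.rcos_sum[OF I_normal] by (simp add: Q_simps FactGroup_def quot_mor_def)

lemma \<pi>_eq_iff:
  assumes "A \<in> Obj \<C>" "B \<in> Obj \<C>" "f \<in> mor \<C> A B" "g \<in> mor \<C> A B"
  shows "\<pi> A B f = \<pi> A B g \<longleftrightarrow> (\<exists>k \<in> I A B. f = g \<otimes>\<^bsub>Hom \<C> A B\<^esub> k)"
proof -
  interpret H: comm_group "Hom \<C> A B" using assms by (simp add: hom_group)
  note S = ideal_subgroup[OF Y_ideal assms(1,2)]
  have "\<pi> A B f = \<pi> A B g \<longleftrightarrow> f \<in> I A B #>\<^bsub>Hom \<C> A B\<^esub> g"
    using assms H.repr_independence[OF _ _ S, of f g] H.repr_independenceD[OF S, of f g] H.rcos_self[OF _ S, of f]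
    unfolding quot_mor_def by metis
  also have "\<dots> \<longleftrightarrow> (\<exists>k \<in> I A B. f = g \<otimes>\<^bsub>Hom \<C> A B\<^esub> k)"
    using assms I_mor by (auto simp: r_coset_def H.m_comm)
  finally show ?thesis .
qed

lemma \<pi>_zero: "A \<in> Obj \<C> \<Longrightarrow> B \<in> Obj \<C> \<Longrightarrow> \<pi> A B \<one>\<^bsub>Hom \<C> A B\<^esub> = \<one>\<^bsub>Hom Q A B\<^esub>"
  using group.coset_join2[OF hom_is_group _ ideal_subgroup[OF Y_ideal]] Y_ideal
  by (simp add: Q_simps FactGroup_def quot_mor_def is_ideal_def)

lemma \<pi>_eqD:
  assumes "A \<in> Obj \<C>" "B \<in> Obj \<C>" "f \<in> mor \<C> A B" "g \<in> mor \<C> A B" "\<pi> A B f = \<pi> A B g"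
  obtains Y u v where "Y \<in> \<Y>" "Y \<in> Obj \<C>" "u \<in> mor \<C> A Y" "v \<in> mor \<C> Y B"
    "f = g \<otimes>\<^bsub>Hom \<C> A B\<^esub> Comp \<C> A Y B v u"
proof -
  obtain k where "k \<in> I A B" "f = g \<otimes>\<^bsub>Hom \<C> A B\<^esub> k" using assms \<pi>_eq_iff by blast
  then show ?thesis using that YD unfolding ideal_of_def by blast
qed

lemma repr_\<pi>:
  assumes "A \<in> Obj \<C>" "B \<in> Obj \<C>" "f \<in> mor \<C> A B"
  shows "repr (\<pi> A B f) \<in> mor \<C> A B" "\<pi> A B (repr (\<pi> A B f)) = \<pi> A B f"
proof -
  note H = hom_is_group[OF assms(1,2)] and S = ideal_subgroup[OF Y_ideal assms(1,2)]
  have "f \<in> \<pi> A B f" unfolding quot_mor_def by (rule group.rcos_self[OF H assms(3) S])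
  then have r: "repr (\<pi> A B f) \<in> \<pi> A B f" unfolding repr_def by (rule someI)
  show "repr (\<pi> A B f) \<in> mor \<C> A B"
    using r assms I_mor unfolding quot_mor_def r_coset_def by auto
  show "\<pi> A B (repr (\<pi> A B f)) = \<pi> A B f"
    using group.repr_independence[OF H _ assms(3) S] r unfolding quot_mor_def by metis
qed

lemma comp_cong:
  assumes obj: "A \<in> Obj \<C>" "B \<in> Obj \<C>" "C \<in> Obj \<C>"
    and f: "f \<in> mor \<C> A B" "f' \<in> mor \<C> A B" "\<pi> A B f = \<pi> A B f'"
    and g: "g \<in> mor \<C> B C" "g' \<in> mor \<C> B C" "\<pi> B C g = \<pi> B C g'"
  shows "\<pi> A C (Comp \<C> A B C g f) = \<pi> A C (Comp \<C> A B C g' f')"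
proof -
  interpret AC: comm_group "Hom \<C> A C" using obj by (simp add: hom_group)
  obtain k where k: "k \<in> I A B" "f = f' \<otimes>\<^bsub>Hom \<C> A B\<^esub> k" using f obj \<pi>_eq_iff by blast
  obtain l where l: "l \<in> I B C" "g = g' \<otimes>\<^bsub>Hom \<C> B C\<^esub> l" using g obj \<pi>_eq_iff by blast
  have [simp]: "k \<in> mor \<C> A B" "l \<in> mor \<C> B C" using k l obj I_mor by auto
  have "Comp \<C> A B C g f = Comp \<C> A B C g' f' \<otimes>\<^bsub>Hom \<C> A C\<^esub>
      (Comp \<C> A B C g' k \<otimes>\<^bsub>Hom \<C> A C\<^esub> Comp \<C> A B C l f)"
    using obj f(1,2) g(1,2) unfolding l(2)
    by (simp add: comp_add_left) (simp add: k(2) comp_add_right AC.m_assoc)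
  moreover have "Comp \<C> A B C g' k \<otimes>\<^bsub>Hom \<C> A C\<^esub> Comp \<C> A B C l f \<in> I A C"
    using Y_ideal k(1) l(1) f(1) g(2) obj unfolding is_ideal_def by blast
  ultimately show ?thesis
    using \<pi>_eq_iff[of A C "Comp \<C> A B C g f" "Comp \<C> A B C g' f'"] obj f g by auto
qed

lemma \<pi>_comp:
  assumes "A \<in> Obj \<C>" "B \<in> Obj \<C>" "C \<in> Obj \<C>" "f \<in> mor \<C> A B" "g \<in> mor \<C> B C"
  shows "Comp Q A B C (\<pi> B C g) (\<pi> A B f) = \<pi> A C (Comp \<C> A B C g f)"
  unfolding Q_simps by (rule comp_cong) (use assms repr_\<pi> in auto)

lemma \<pi>_ident: "\<pi> A A (Ident \<C> A) = Ident Q A"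
  by (simp add: Q_simps)

text \<open>Extensions do not see maps through \<open>\<Y>\<close>, because the extension groups at objects of \<open>\<Y>\<close>
  vanish on either side.\<close>

lemma emap_cong:
  assumes obj: "C' \<in> Obj \<C>" "C \<in> Obj \<C>" "A \<in> Obj \<C>" "A' \<in> Obj \<C>"
    and c: "c \<in> mor \<C> C' C" "c' \<in> mor \<C> C' C" "\<pi> C' C c = \<pi> C' C c'"
    and a: "a \<in> mor \<C> A A'" "a' \<in> mor \<C> A A'" "\<pi> A A' a = \<pi> A A' a'"
    and \<delta>: "\<delta> \<in> exts \<C> C A"
  shows "Emap \<C> C' C A A' c a \<delta> = Emap \<C> C' C A A' c' a' \<delta>"
proof -
  obtain Y u v where Y: "Y \<in> \<Y>" "Y \<in> Obj \<C>" "u \<in> mor \<C> C' Y" "v \<in> mor \<C> Y C"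
    and c': "c = c' \<otimes>\<^bsub>Hom \<C> C' C\<^esub> Comp \<C> C' Y C v u"
    using \<pi>_eqD[OF obj(1,2) c] .
  have "Emap \<C> Y C A A' v a \<delta> = \<one>\<^bsub>Ext \<C> Y A'\<^esub>"
    using Y_proj[OF Y(1) obj(4)] emap_closed[of Y C A A' v a \<delta>] obj Y a \<delta> by simp
  then have "Emap \<C> C' C A A' (Comp \<C> C' Y C v u) a \<delta> = \<one>\<^bsub>Ext \<C> C' A'\<^esub>"
    using emap_comp[of C' Y C A A' A' u v a "Ident \<C> A'" \<delta>] obj Y a \<delta> by simp
  then have "Emap \<C> C' C A A' c a \<delta> = Emap \<C> C' C A A' c' a \<delta>"
    unfolding c' using emap_add_left[of C' C A A' c' "Comp \<C> C' Y C v u" a \<delta>] obj Y a c \<delta> by simp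
  moreover
  obtain Y u v where Y: "Y \<in> \<Y>" "Y \<in> Obj \<C>" "u \<in> mor \<C> A Y" "v \<in> mor \<C> Y A'"
    and a': "a = a' \<otimes>\<^bsub>Hom \<C> A A'\<^esub> Comp \<C> A Y A' v u"
    using \<pi>_eqD[OF obj(3,4) a] .
  have "Emap \<C> C' C A Y c' u \<delta> = \<one>\<^bsub>Ext \<C> C' Y\<^esub>"
    using Y_inj[OF Y(1) obj(1)] emap_closed[of C' C A Y c' u \<delta>] obj Y c \<delta> by simp
  then have "Emap \<C> C' C A A' c' (Comp \<C> A Y A' v u) \<delta> = \<one>\<^bsub>Ext \<C> C' A'\<^esub>"
    using emap_comp[of C' C' C A Y A' "Ident \<C> C'" c' u v \<delta>] obj Y c \<delta> by simp
  then have "Emap \<C> C' C A A' c' a \<delta> = Emap \<C> C' C A A' c' a' \<delta>"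
    unfolding a' using emap_add_right[of C' C A A' c' a' "Comp \<C> A Y A' v u" \<delta>] obj Y a c \<delta> by simp
  ultimately show ?thesis by simp
qed

lemma emap_\<pi>:
  assumes "C' \<in> Obj \<C>" "C \<in> Obj \<C>" "A \<in> Obj \<C>" "A' \<in> Obj \<C>"
    "c \<in> mor \<C> C' C" "a \<in> mor \<C> A A'" "\<delta> \<in> exts \<C> C A"
  shows "Emap Q C' C A A' (\<pi> C' C c) (\<pi> A A' a) \<delta> = Emap \<C> C' C A A' c a \<delta>"
  unfolding Q_simps by (rule emap_cong) (use assms repr_\<pi> in auto)

lemma preadditive_Q: "preadditive_category Q"
proof (rule preadditive_category.intro, goal_cases)
  case (1 A B)
  then show ?case
    using comm_group.abelian_FactGroup[OF hom_group ideal_subgroup[OF Y_ideal]] by (simp add: Q_simps)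
next
  case (2 A)
  then show ?case by (metis Obj_Q \<pi>_ident \<pi>_mor ident_mor)
next
  case (3 A B C f g)
  then show ?case by (auto simp: \<pi>_comp elim!: lift_mor)
next
  case (4 A B C D f g h)
  then show ?case by (auto simp: \<pi>_comp comp_assoc elim!: lift_mor)
next
  case (5 A B f)
  then show ?case by (auto simp: \<pi>_comp \<pi>_ident[symmetric] elim!: lift_mor)
next
  case (6 A B f)
  then show ?case by (auto simp: \<pi>_comp \<pi>_ident[symmetric] elim!: lift_mor)
next
  case (7 A B C f g g')
  then show ?case by (auto simp: \<pi>_comp \<pi>_sum comp_add_left elim!: lift_mor)
next
  case (8 A B C f f' g)
  then show ?case by (auto simp: \<pi>_comp \<pi>_sum comp_add_right elim!: lift_mor)
qed

lemma is_biproduct_\<pi>: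
  assumes "is_biproduct \<C> A A' P i i' p p'"
  shows "is_biproduct Q A A' P (\<pi> A P i) (\<pi> A' P i') (\<pi> P A p) (\<pi> P A' p')"
  using assms unfolding is_biproduct_def
  by (simp add: \<pi>_comp \<pi>_sum \<pi>_ident[symmetric] \<pi>_zero[symmetric])

lemma dsum_mor_\<pi>:
  assumes "is_biproduct \<C> A A' P i i' p p'" "is_biproduct \<C> B B' R j j' q q'"
    and "f \<in> mor \<C> A B" "f' \<in> mor \<C> A' B'"
  shows "\<pi> P R (dsum_mor \<C> A A' P p p' B B' R j j' f f') =
    dsum_mor Q A A' P (\<pi> P A p) (\<pi> P A' p') B B' R (\<pi> B R j) (\<pi> B' R j') (\<pi> A B f) (\<pi> A' B' f')"
  unfolding dsum_mor_def
  using assms(3,4) biproduct_typed[OF assms(1)] biproduct_typed[OF assms(2)] by (simp add: \<pi>_comp \<pi>_sum)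

lemma additive_Q: "additive_category Q"
proof (intro additive_category.intro additive_category_axioms.intro)
  show "preadditive_category Q" by (rule preadditive_Q)
  obtain Z where Z: "is_zero_object \<C> Z" using zero_object by blast
  have "is_zero_object Q Z"
    unfolding is_zero_object_def
  proof (intro conjI ballI)
    show "Z \<in> Obj Q" using Z unfolding is_zero_object_def by simp
    fix A assume "A \<in> Obj Q"
    then obtain f g where "mor \<C> A Z = {f}" "mor \<C> Z A = {g}"
      using Z unfolding is_zero_object_def by (metis Obj_Q singletonI subsetI subset_antisym singletonD)
    then show "\<exists>!f. f \<in> mor Q A Z" "\<exists>!f. f \<in> mor Q Z A" unfolding mor_Q by auto
  qed
  then show "\<exists>Z. is_zero_object Q Z" by blast
  fix A A' assume "A \<in> Obj Q" "A' \<in> Obj Q"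
  then obtain P i i' p p' where "is_biproduct \<C> A A' P i i' p p'" by (metis Obj_Q biproducts)
  from is_biproduct_\<pi>[OF this] show "\<exists>P i i' p p'. is_biproduct Q A A' P i i' p p'" by blast
qed

lemma ext_bifunctor_Q: "ext_bifunctor Q"
proof (intro ext_bifunctor.intro ext_bifunctor_axioms.intro, goal_cases)
  case 1
  show ?case by (rule additive_Q)
next
  case (2 C A)
  then show ?case using ext_group by simp
next
  case (3 C' C A A' c a)
  then obtain c0 a0 where 0: "c0 \<in> mor \<C> C' C" "c = \<pi> C' C c0" "a0 \<in> mor \<C> A A'" "a = \<pi> A A' a0"
    by (metis lift_mor)
  then have "Emap \<C> C' C A A' c0 a0 \<in> hom (Ext \<C> C A) (Ext \<C> C' A')" using 3 emap_hom by simp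
  then show ?case
    using 3 0 unfolding hom_def by (auto simp: emap_\<pi> ext_is_group group.is_monoid monoid.m_closed)
next
  case (4 C A \<delta>)
  then show ?case by (simp add: emap_\<pi> \<pi>_ident[symmetric])
next
  case (5 C'' C' C A A' A'' c' c a a' \<delta>)
  then show ?case by (auto simp: emap_\<pi> emap_comp \<pi>_comp elim!: lift_mor)
next
  case (6 C' C A A' c d a \<delta>)
  then show ?case by (auto simp: emap_\<pi> emap_add_left \<pi>_sum elim!: lift_mor)
next
  case (7 C' C A A' c a b \<delta>)
  then show ?case by (auto simp: emap_\<pi> emap_add_right \<pi>_sum elim!: lift_mor)
qed

interpretation Q: ext_bifunctor Q
  by (rule ext_bifunctor_Q)

lemma is_iso_\<pi>:
  assumes "A \<in> Obj \<C>" "B \<in> Obj \<C>" "is_iso \<C> A B f"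
  shows "is_iso Q A B (\<pi> A B f)"
proof -
  obtain g where "g \<in> mor \<C> B A" "Comp \<C> A B A g f = Ident \<C> A" "Comp \<C> B A B f g = Ident \<C> B"
    "f \<in> mor \<C> A B"
    using assms is_iso_mor by (metis is_iso_inverse)
  then show ?thesis using assms(1,2) unfolding is_iso_def
    by (intro conjI bexI[of _ "\<pi> B A g"]) (auto simp: \<pi>_comp \<pi>_ident[symmetric])
qed

lemma push_\<pi>:
  assumes "C \<in> Obj \<C>" "A \<in> Obj \<C>" "A' \<in> Obj \<C>" "a \<in> mor \<C> A A'" "\<delta> \<in> exts \<C> C A"
  shows "push Q C A A' (\<pi> A A' a) \<delta> = push \<C> C A A' a \<delta>"
  unfolding push_def using assms by (simp add: emap_\<pi> \<pi>_ident[symmetric])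

lemma pull_\<pi>:
  assumes "C' \<in> Obj \<C>" "C \<in> Obj \<C>" "A \<in> Obj \<C>" "c \<in> mor \<C> C' C" "\<delta> \<in> exts \<C> C A"
  shows "pull Q C' C A (\<pi> C' C c) \<delta> = pull \<C> C' C A c \<delta>"
  unfolding pull_def using assms by (simp add: emap_\<pi> \<pi>_ident[symmetric])

lemma ext_morphism_\<pi>:
  assumes "A \<in> Obj \<C>" "C \<in> Obj \<C>" "A' \<in> Obj \<C>" "C' \<in> Obj \<C>" "\<delta> \<in> exts \<C> C A" "\<delta>' \<in> exts \<C> C' A'"
    "a \<in> mor \<C> A A'" "c \<in> mor \<C> C C'"
  shows "ext_morphism Q C A \<delta> C' A' \<delta>' (\<pi> A A' a) (\<pi> C C' c) \<longleftrightarrow> ext_morphism \<C> C A \<delta> C' A' \<delta>' a c"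
  unfolding ext_morphism_def using assms by (simp add: push_\<pi> pull_\<pi>)

text \<open>Up to an isomorphism of the middle object, the triangles of the quotient are the images of the
  triangles of \<open>\<C>\<close>.  The next two lemmas make this available for proving and for using that
  a sequence is a triangle; the second one gives the isomorphism together with its inverse, so that both
  maps of the sequence are explicit composites.\<close>

lemma triangle_QI:
  assumes t: "triangle \<C> A B C x y \<delta>" and \<beta>: "is_iso Q B B' \<beta>" and B': "B' \<in> Obj \<C>"
    and X: "Comp Q A B B' \<beta> (\<pi> A B x) = X" and Y: "Y \<in> mor Q B' C" "Comp Q B B' C Y \<beta> = \<pi> B C y"
  shows "triangle Q A B' C X Y \<delta>"
proof -
  note T = triangle_typed[OF t]
  have "X \<in> mor Q A B'" using T B' \<beta> X by auto
  then have "((B, \<pi> A B x, \<pi> B C y), (B', X, Y)) \<in> seq_equiv Q A C"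
    unfolding seq_equiv_def sequences_def using T B' \<beta> X Y by auto
  moreover have "(B, x, y) \<in> Realz \<C> C A \<delta>" using t unfolding triangle_def by blast
  ultimately have "(B', X, Y) \<in> Realz Q C A \<delta>" unfolding Q_simps(7) seq_equiv_quot_cat by blast
  then show ?thesis unfolding triangle_def using T by simp
qed

lemma triangle_QE:
  assumes t: "triangle Q A B C X Y \<delta>"
  obtains B0 x y \<beta> \<beta>' where "triangle \<C> A B0 C x y \<delta>" "B \<in> Obj \<C>"
    "\<beta> \<in> mor Q B0 B" "\<beta>' \<in> mor Q B B0" "Comp Q B0 B B0 \<beta>' \<beta> = Ident Q B0" "Comp Q B B0 B \<beta> \<beta>' = Ident Q B"
    "X = Comp Q A B0 B \<beta> (\<pi> A B0 x)" "Y = Comp Q B B0 C (\<pi> B0 C y) \<beta>'"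
proof -
  have AC: "A \<in> Obj \<C>" "C \<in> Obj \<C>" "\<delta> \<in> exts \<C> C A" using t unfolding triangle_def by auto
  obtain B0 x y where R: "(B0, x, y) \<in> Realz \<C> C A \<delta>"
    and e: "((B0, \<pi> A B0 x, \<pi> B0 C y), (B, X, Y)) \<in> seq_equiv Q A C"
    using t unfolding triangle_def Q_simps(7) seq_equiv_quot_cat by blast
  have t0: "triangle \<C> A B0 C x y \<delta>" using R AC unfolding triangle_def by blast
  note T = triangle_typed[OF t0]
  obtain \<beta> where \<beta>: "is_iso Q B0 B \<beta>" "Comp Q A B0 B \<beta> (\<pi> A B0 x) = X"
      "Comp Q B0 B C Y \<beta> = \<pi> B0 C y" and B: "B \<in> Obj \<C>" "Y \<in> mor Q B C"
    using e unfolding seq_equiv_def sequences_def by auto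
  obtain \<beta>' where \<beta>': "\<beta>' \<in> mor Q B B0" "Comp Q B0 B B0 \<beta>' \<beta> = Ident Q B0" "Comp Q B B0 B \<beta> \<beta>' = Ident Q B"
    using \<beta>(1) by (rule Q.is_iso_inverse)
  have "\<beta> \<in> mor Q B0 B" using \<beta> by blast
  moreover have "Y = Comp Q B B0 C (\<pi> B0 C y) \<beta>'"
    using \<beta>(3)[symmetric] Q.comp_cancel_right[of B0 B C Y \<beta> \<beta>'] \<open>\<beta> \<in> mor Q B0 B\<close> B \<beta>' T by simp
  ultimately show ?thesis using that t0 B \<beta> \<beta>' by metis
qed

lemma triangle_\<pi>: "triangle \<C> A B C x y \<delta> \<Longrightarrow> triangle Q A B C (\<pi> A B x) (\<pi> B C y) \<delta>"
  by (rule triangle_QI[OF _ Q.is_iso_ident]) (use triangle_typed in auto)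

lemma realz_class_Q:
  assumes AC: "C \<in> Obj \<C>" "A \<in> Obj \<C>" "\<delta> \<in> exts \<C> C A"
  shows "Realz Q C A \<delta> \<in> sequences Q A C // seq_equiv Q A C"
proof -
  obtain B x y where t: "triangle \<C> A B C x y \<delta>" using triangle_exists AC by blast
  note T = triangle_typed[OF t]
  let ?s = "(B, \<pi> A B x, \<pi> B C y)"
  have s: "?s \<in> sequences Q A C" using T unfolding sequences_def by simp
  have eq: "equiv (sequences Q A C) (seq_equiv Q A C)" using Q.equiv_seq_equiv AC by simp
  have "seq_equiv Q A C `` {(B', \<pi> A B' x', \<pi> B' C y')} = seq_equiv Q A C `` {?s}"
    if R: "(B', x', y') \<in> Realz \<C> C A \<delta>" for B' x' y'
  proof -
    have "((B', x', y'), (B, x, y)) \<in> seq_equiv \<C> A C"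
      using quotient_eq_iff[OF equiv_seq_equiv realz_class realz_class] AC t R
      unfolding triangle_def by blast
    then obtain b where b: "is_iso \<C> B' B b" "Comp \<C> A B' B b x' = x" "Comp \<C> B' B C y b = y'"
      and B': "B' \<in> Obj \<C>" "x' \<in> mor \<C> A B'" "y' \<in> mor \<C> B' C"
      unfolding seq_equiv_def sequences_def by auto
    have "((B', \<pi> A B' x', \<pi> B' C y'), ?s) \<in> seq_equiv Q A C"
      unfolding seq_equiv_def sequences_def
      using T B' b is_iso_\<pi>[OF B'(1) T(2) b(1)] is_iso_mor[OF b(1)] by (auto simp: \<pi>_comp)
    then show ?thesis using equiv_class_eq[OF eq] by blast
  qed
  then have "Realz Q C A \<delta> = seq_equiv Q A C `` {?s}"
    using t unfolding triangle_def Q_simps(7) seq_equiv_quot_cat by blast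
  then show ?thesis using quotientI[OF s] by metis
qed

lemma \<pi>_absorb:
  assumes "W \<in> \<Y>" "A \<in> Obj \<C>" "B \<in> Obj \<C>" "f \<in> mor \<C> A B" "u \<in> mor \<C> A W" "v \<in> mor \<C> W B"
  shows "\<pi> A B (f \<otimes>\<^bsub>Hom \<C> A B\<^esub> Comp \<C> A W B v u) = \<pi> A B f"
proof -
  have "Comp \<C> A W B v u \<in> I A B" by (rule ideal_ofI[OF assms(1,5,6)])
  moreover have "f \<otimes>\<^bsub>Hom \<C> A B\<^esub> Comp \<C> A W B v u \<in> mor \<C> A B"
    using assms YD[OF assms(1)] by simp
  ultimately show ?thesis using \<pi>_eq_iff[OF assms(2,3) _ assms(4)] by blast
qed

lemma extend_to_Y:
  assumes "triangle \<C> A B C x y \<delta>" "Y \<in> \<Y>" "u \<in> mor \<C> A Y"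
  shows "\<exists>w \<in> mor \<C> B Y. Comp \<C> A B Y w x = u"
proof (rule extend_along_inflation[OF assms(1) YD[OF assms(2)] assms(3)])
  note T = triangle_typed[OF assms(1)]
  show "Emap \<C> C C A Y (Ident \<C> C) u \<delta> = \<one>\<^bsub>Ext \<C> C Y\<^esub>"
    using Y_inj[OF assms(2) T(3)] emap_closed[of C C A Y "Ident \<C> C" u \<delta>] T assms YD by simp
qed

lemma lift_from_Y:
  assumes "triangle \<C> A B C x y \<delta>" "Y \<in> \<Y>" "v \<in> mor \<C> Y C"
  shows "\<exists>w \<in> mor \<C> Y B. Comp \<C> Y B C y w = v"
proof (rule lift_along_deflation[OF assms(1) YD[OF assms(2)] assms(3)])
  note T = triangle_typed[OF assms(1)]
  show "Emap \<C> Y C A A v (Ident \<C> A) \<delta> = \<one>\<^bsub>Ext \<C> Y A\<^esub>"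
    using Y_proj[OF assms(2) T(1)] emap_closed[of Y C A A v "Ident \<C> A" \<delta>] T assms YD by simp
qed

lemma weakly_extriangulated_Q: "weakly_extriangulated Q"
proof (intro weakly_extriangulated.intro weakly_extriangulated_axioms.intro, goal_cases)
  case 1
  show ?case by (rule ext_bifunctor_Q)
next
  case (2 C A \<delta>)
  then show ?case using realz_class_Q by simp
next
  case (3 A B C X Y \<delta> A' B' C' X' Y' \<delta>' a c)
  from 3(1) obtain B0 x y \<beta> \<beta>\<^sub>i where t: "triangle \<C> A B0 C x y \<delta>" and B: "B \<in> Obj \<C>"
    and \<beta>: "\<beta> \<in> mor Q B0 B" "\<beta>\<^sub>i \<in> mor Q B B0" "Comp Q B0 B B0 \<beta>\<^sub>i \<beta> = Ident Q B0"
    and X: "X = Comp Q A B0 B \<beta> (\<pi> A B0 x)" and Y: "Y = Comp Q B B0 C (\<pi> B0 C y) \<beta>\<^sub>i"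
    by (rule triangle_QE)
  from 3(2) obtain B0' x' y' \<beta>' \<beta>\<^sub>i' where t': "triangle \<C> A' B0' C' x' y' \<delta>'" and B': "B' \<in> Obj \<C>"
    and \<beta>': "\<beta>' \<in> mor Q B0' B'" "\<beta>\<^sub>i' \<in> mor Q B' B0'" "Comp Q B0' B' B0' \<beta>\<^sub>i' \<beta>' = Ident Q B0'"
    and X': "X' = Comp Q A' B0' B' \<beta>' (\<pi> A' B0' x')" and Y': "Y' = Comp Q B' B0' C' (\<pi> B0' C' y') \<beta>\<^sub>i'"
    by (rule triangle_QE)
  note [simp] = triangle_typed[OF t] triangle_typed[OF t'] B B' \<beta> \<beta>'
  obtain a0 c0 where ac: "a0 \<in> mor \<C> A A'" "a = \<pi> A A' a0" "c0 \<in> mor \<C> C C'" "c = \<pi> C C' c0"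
    using 3(3) unfolding ext_morphism_def by (metis lift_mor)
  note [simp] = ac
  have "ext_morphism \<C> C A \<delta> C' A' \<delta>' a0 c0" using 3(3) by (simp add: ext_morphism_\<pi>)
  then obtain b0 where b0: "b0 \<in> mor \<C> B0 B0'" "Comp \<C> A B0 B0' b0 x = Comp \<C> A A' B0' x' a0"
      "Comp \<C> B0 B0' C' y' b0 = Comp \<C> B0 C C' c0 y"
    using realz_morphism[OF t t'] by blast
  note [simp] = b0(1)
  have e1: "Comp Q A B0 B0' (\<pi> B0 B0' b0) (\<pi> A B0 x) = Comp Q A A' B0' (\<pi> A' B0' x') a"
    using b0(2) by (simp add: \<pi>_comp)
  have e2: "Comp Q B0 B0' C' (\<pi> B0' C' y') (\<pi> B0 B0' b0) = Comp Q B0 C C' c (\<pi> B0 C y)"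
    using b0(3) by (simp add: \<pi>_comp)
  define b where "b = Comp Q B B0' B' \<beta>' (Comp Q B B0 B0' (\<pi> B0 B0' b0) \<beta>\<^sub>i)"
  have "Comp Q A B B' b X = Comp Q A A' B' X' a"
    using e1 unfolding b_def X X' by (simp add: Q.comp_assoc Q.comp_cancel_left)
  moreover have "Comp Q B B' C' Y' b = Comp Q B C C' c Y"
  proof -
    have "Comp Q B B' C' Y' b = Comp Q B B0 C' (Comp Q B0 B0' C' (\<pi> B0' C' y') (\<pi> B0 B0' b0)) \<beta>\<^sub>i"
      unfolding b_def Y' by (simp add: Q.comp_assoc Q.comp_cancel_left)
    also have "\<dots> = Comp Q B C C' c Y" unfolding e2 Y by (simp add: Q.comp_assoc)
    finally show ?thesis .
  qed
  moreover have "b \<in> mor Q B B'" unfolding b_def by simp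
  ultimately show ?case by blast
next
  case (4 A C P i i' p p')
  note T = Q.biproduct_typed[OF 4] and bp = 4[unfolded is_biproduct_def]
  obtain P0 i0 i0' p0 p0' where P0: "is_biproduct \<C> A C P0 i0 i0' p0 p0'"
    using biproducts T by (metis Obj_Q)
  define \<beta> where "\<beta> = dsum_mor Q A C P0 (\<pi> P0 A p0) (\<pi> P0 C p0') A C P i i' (Ident Q A) (Ident Q C)"
  define \<beta>\<^sub>i where "\<beta>\<^sub>i = dsum_mor Q A C P p p' A C P0 (\<pi> A P0 i0) (\<pi> C P0 i0') (Ident Q A) (Ident Q C)"
  note P0Q = is_biproduct_\<pi>[OF P0]
  note [simp] = T[simplified] biproduct_typed[OF P0] Q.dsum_mor_typed[OF P0Q 4] Q.dsum_mor_typed[OF 4 P0Q]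
  have "is_iso Q P0 P \<beta>"
  proof (rule Q.is_isoI[of P0 P \<beta> \<beta>\<^sub>i \<beta>\<^sub>i])
    show "Comp Q P0 P P0 \<beta>\<^sub>i \<beta> = Ident Q P0" unfolding \<beta>_def \<beta>\<^sub>i_def by (rule Q.dsum_mor_iso[OF P0Q 4]) auto
    show "Comp Q P P0 P \<beta> \<beta>\<^sub>i = Ident Q P" unfolding \<beta>_def \<beta>\<^sub>i_def by (rule Q.dsum_mor_iso[OF 4 P0Q]) auto
  qed (simp_all add: \<beta>_def \<beta>\<^sub>i_def)
  then have "triangle Q A P C i p' \<one>\<^bsub>Ext \<C> C A\<^esub>"
    by (rule triangle_QI[OF realz_zero[OF P0]])
      (use Q.dsum_mor_incl_proj[OF P0Q 4, of "Ident Q A" "Ident Q C"] in \<open>simp_all add: \<beta>_def\<close>)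
  then show ?case by simp
next
  case (5 A B C X Y \<delta> A' B' C' X' Y' \<delta>' a b)
  from 5(1) obtain B0 x y \<beta> \<beta>\<^sub>i where t: "triangle \<C> A B0 C x y \<delta>" and B: "B \<in> Obj \<C>"
    and \<beta>: "\<beta> \<in> mor Q B0 B" "\<beta>\<^sub>i \<in> mor Q B B0" "Comp Q B0 B B0 \<beta>\<^sub>i \<beta> = Ident Q B0"
      "Comp Q B B0 B \<beta> \<beta>\<^sub>i = Ident Q B"
    and X: "X = Comp Q A B0 B \<beta> (\<pi> A B0 x)" and Y: "Y = Comp Q B B0 C (\<pi> B0 C y) \<beta>\<^sub>i"
    by (rule triangle_QE)
  from 5(2) obtain B0' x' y' \<beta>' \<beta>\<^sub>i' where t': "triangle \<C> A' B0' C' x' y' \<delta>'" and B': "B' \<in> Obj \<C>"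
    and \<beta>': "\<beta>' \<in> mor Q B0' B'" "\<beta>\<^sub>i' \<in> mor Q B' B0'" "Comp Q B0' B' B0' \<beta>\<^sub>i' \<beta>' = Ident Q B0'"
    and X': "X' = Comp Q A' B0' B' \<beta>' (\<pi> A' B0' x')" and Y': "Y' = Comp Q B' B0' C' (\<pi> B0' C' y') \<beta>\<^sub>i'"
    by (rule triangle_QE)
  note [simp] = triangle_typed[OF t] triangle_typed[OF t'] B B' \<beta> \<beta>' 5(3,4)
  obtain a0 where a0: "a0 \<in> mor \<C> A A'" "a = \<pi> A A' a0" using 5(3) by (rule lift_mor)
  define b1 where "b1 = Comp Q B0 B' B0' \<beta>\<^sub>i' (Comp Q B0 B B' b \<beta>)"
  have [simp]: "b1 \<in> mor Q B0 B0'" unfolding b1_def by simp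
  obtain b0 where b0: "b0 \<in> mor \<C> B0 B0'" "b1 = \<pi> B0 B0' b0"
    by (rule lift_mor[of b1 B0 B0']) auto
  note [simp] = b0(1) a0(1)
  have "Comp Q A B0 B0' b1 (\<pi> A B0 x) = Comp Q A B' B0' \<beta>\<^sub>i' (Comp Q A B B' b X)"
    unfolding b1_def X by (simp add: Q.comp_assoc)
  also have "\<dots> = Comp Q A A' B0' (\<pi> A' B0' x') a"
    unfolding 5(5) X' by (simp add: Q.comp_assoc Q.comp_cancel_left)
  finally have "\<pi> A B0' (Comp \<C> A A' B0' x' a0) = \<pi> A B0' (Comp \<C> A B0 B0' b0 x)"
    unfolding b0 a0 by (simp add: \<pi>_comp)
  then obtain W u v where W: "W \<in> \<Y>" "W \<in> Obj \<C>" "u \<in> mor \<C> A W" "v \<in> mor \<C> W B0'"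
    and k: "Comp \<C> A A' B0' x' a0 = Comp \<C> A B0 B0' b0 x \<otimes>\<^bsub>Hom \<C> A B0'\<^esub> Comp \<C> A W B0' v u"
    by (rule \<pi>_eqD[rotated 4]) auto
  \<comment> \<open>The square commutes only up to a map through \<open>\<Y>\<close>.  By injectivity that map extends along
    \<open>x\<close>, so it can be absorbed into the middle map without changing its class.\<close>
  obtain w where w: "w \<in> mor \<C> B0 W" "Comp \<C> A B0 W w x = u" using extend_to_Y[OF t W(1,3)] by blast
  note [simp] = W(2-) w(1)
  define b2 where "b2 = b0 \<otimes>\<^bsub>Hom \<C> B0 B0'\<^esub> Comp \<C> B0 W B0' v w"
  have [simp]: "b2 \<in> mor \<C> B0 B0'" unfolding b2_def by simp
  have "Comp \<C> A B0 B0' b2 x = Comp \<C> A A' B0' x' a0"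
    using w(2) k unfolding b2_def by (simp add: comp_add_left comp_assoc)
  from ET3[OF t t' a0(1) _ this] obtain c0 where c0: "ext_morphism \<C> C A \<delta> C' A' \<delta>' a0 c0"
    "Comp \<C> B0 B0' C' y' b2 = Comp \<C> B0 C C' c0 y" by auto
  have [simp]: "c0 \<in> mor \<C> C C'" using c0 unfolding ext_morphism_def by blast
  have "\<pi> B0 B0' b2 = b1"
    unfolding b0(2) b2_def using W(1) by (intro \<pi>_absorb) auto
  then have e: "Comp Q B0 B0' C' (\<pi> B0' C' y') b1 = Comp Q B0 C C' (\<pi> C C' c0) (\<pi> B0 C y)"
    using c0(2) by (metis \<pi>_comp \<open>b2 \<in> mor \<C> B0 B0'\<close> \<open>c0 \<in> mor \<C> C C'\<close> triangle_typed[OF t] triangle_typed[OF t'])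
  have "Comp Q B B' C' Y' b = Comp Q B B0 C' (Comp Q B0 B0' C' (\<pi> B0' C' y') b1) \<beta>\<^sub>i"
    unfolding b1_def Y' by (simp add: Q.comp_assoc)
  also have "\<dots> = Comp Q B C C' (\<pi> C C' c0) Y" unfolding e Y by (simp add: Q.comp_assoc)
  finally show ?case
    using c0(1) unfolding a0(2) by (intro exI[of _ "\<pi> C C' c0"]) (simp add: ext_morphism_\<pi>)
next
  case (6 A B C X Y \<delta> A' B' C' X' Y' \<delta>' c b)
  from 6(1) obtain B0 x y \<beta> \<beta>\<^sub>i where t: "triangle \<C> A B0 C x y \<delta>" and B: "B \<in> Obj \<C>"
    and \<beta>: "\<beta> \<in> mor Q B0 B" "\<beta>\<^sub>i \<in> mor Q B B0" "Comp Q B0 B B0 \<beta>\<^sub>i \<beta> = Ident Q B0"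
    and X: "X = Comp Q A B0 B \<beta> (\<pi> A B0 x)" and Y: "Y = Comp Q B B0 C (\<pi> B0 C y) \<beta>\<^sub>i"
    by (rule triangle_QE)
  from 6(2) obtain B0' x' y' \<beta>' \<beta>\<^sub>i' where t': "triangle \<C> A' B0' C' x' y' \<delta>'" and B': "B' \<in> Obj \<C>"
    and \<beta>': "\<beta>' \<in> mor Q B0' B'" "\<beta>\<^sub>i' \<in> mor Q B' B0'" "Comp Q B0' B' B0' \<beta>\<^sub>i' \<beta>' = Ident Q B0'"
      "Comp Q B' B0' B' \<beta>' \<beta>\<^sub>i' = Ident Q B'"
    and X': "X' = Comp Q A' B0' B' \<beta>' (\<pi> A' B0' x')" and Y': "Y' = Comp Q B' B0' C' (\<pi> B0' C' y') \<beta>\<^sub>i'"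
    by (rule triangle_QE)
  note [simp] = triangle_typed[OF t] triangle_typed[OF t'] B B' \<beta> \<beta>' 6(3,4)
  obtain c0 where c0: "c0 \<in> mor \<C> C C'" "c = \<pi> C C' c0" using 6(3) by (rule lift_mor)
  define b1 where "b1 = Comp Q B0 B' B0' \<beta>\<^sub>i' (Comp Q B0 B B' b \<beta>)"
  have [simp]: "b1 \<in> mor Q B0 B0'" unfolding b1_def by simp
  obtain b0 where b0: "b0 \<in> mor \<C> B0 B0'" "b1 = \<pi> B0 B0' b0"
    by (rule lift_mor[of b1 B0 B0']) auto
  note [simp] = b0(1) c0(1)
  have "Comp Q B0 B0' C' (\<pi> B0' C' y') b1 = Comp Q B0 B C' (Comp Q B B' C' Y' b) \<beta>"
    unfolding b1_def Y' by (simp add: Q.comp_assoc)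
  also have "\<dots> = Comp Q B0 C C' c (\<pi> B0 C y)"
    unfolding 6(5)[symmetric] Y by (simp add: Q.comp_assoc)
  finally have "\<pi> B0 C' (Comp \<C> B0 C C' c0 y) = \<pi> B0 C' (Comp \<C> B0 B0' C' y' b0)"
    unfolding b0 c0 by (simp add: \<pi>_comp)
  then obtain W u v where W: "W \<in> \<Y>" "W \<in> Obj \<C>" "u \<in> mor \<C> B0 W" "v \<in> mor \<C> W C'"
    and k: "Comp \<C> B0 C C' c0 y = Comp \<C> B0 B0' C' y' b0 \<otimes>\<^bsub>Hom \<C> B0 C'\<^esub> Comp \<C> B0 W C' v u"
    by (rule \<pi>_eqD[rotated 4]) auto
  \<comment> \<open>Dually, the error lifts along \<open>y'\<close> because \<open>\<Y>\<close> consists of projectives.\<close>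
  obtain w where w: "w \<in> mor \<C> W B0'" "Comp \<C> W B0' C' y' w = v" using lift_from_Y[OF t' W(1,4)] by blast
  note [simp] = W(2-) w(1)
  define b2 where "b2 = b0 \<otimes>\<^bsub>Hom \<C> B0 B0'\<^esub> Comp \<C> B0 W B0' w u"
  have [simp]: "b2 \<in> mor \<C> B0 B0'" unfolding b2_def by simp
  have "Comp \<C> B0 B0' C' y' b2 = Comp \<C> B0 B0' C' y' b0 \<otimes>\<^bsub>Hom \<C> B0 C'\<^esub>
      Comp \<C> B0 W C' (Comp \<C> W B0' C' y' w) u"
    unfolding b2_def by (simp add: comp_add_right comp_assoc)
  then have "Comp \<C> B0 C C' c0 y = Comp \<C> B0 B0' C' y' b2" using w(2) k by simp
  from ET3_op[OF t t' c0(1) _ this] obtain a0 where a0: "ext_morphism \<C> C A \<delta> C' A' \<delta>' a0 c0"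
    "Comp \<C> A B0 B0' b2 x = Comp \<C> A A' B0' x' a0" by auto
  have [simp]: "a0 \<in> mor \<C> A A'" using a0 unfolding ext_morphism_def by blast
  have "\<pi> B0 B0' b2 = b1"
    unfolding b0(2) b2_def using W(1) by (intro \<pi>_absorb) auto
  then have e: "Comp Q A B0 B0' b1 (\<pi> A B0 x) = Comp Q A A' B0' (\<pi> A' B0' x') (\<pi> A A' a0)"
    using a0(2) by (metis \<pi>_comp \<open>b2 \<in> mor \<C> B0 B0'\<close> \<open>a0 \<in> mor \<C> A A'\<close> triangle_typed[OF t] triangle_typed[OF t'])
  have "Comp Q A B B' b X = Comp Q A B0' B' \<beta>' (Comp Q A B0 B0' b1 (\<pi> A B0 x))"
    unfolding b1_def X by (simp add: Q.comp_assoc Q.comp_cancel_left)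
  also have "\<dots> = Comp Q A A' B' X' (\<pi> A A' a0)" unfolding e X' by (simp add: Q.comp_assoc)
  finally show ?case
    using a0(1) unfolding c0(2) by (intro exI[of _ "\<pi> A A' a0"]) (simp add: ext_morphism_\<pi>)
qed

interpretation Q: weakly_extriangulated Q
  by (rule weakly_extriangulated_Q)

text \<open>The sum of the two triangles is formed in \<open>\<C>\<close> from their representatives and from biproducts of
  \<open>\<C>\<close>.  Its image is then moved along the comparison isomorphisms between these biproducts and the
  given ones, which exist in the quotient only.\<close>

lemma realz_dsum_Q:
  assumes T1: "triangle Q A B C X Y \<delta>" and T2: "triangle Q A' B' C' X' Y' \<delta>'"
    and P: "is_biproduct Q A A' P i i' p p'" and S: "is_biproduct Q B B' S j j' s s'"
    and R: "is_biproduct Q C C' R k k' r r'"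
    and \<theta>: "is_dsum_ext Q A A' P p p' C C' R k k' \<delta> \<delta>' \<theta>"
  shows "triangle Q P S R (dsum_mor Q A A' P p p' B B' S j j' X X')
    (dsum_mor Q B B' S s s' C C' R k k' Y Y') \<theta>"
proof -
  obtain B0 x y \<beta> \<beta>\<^sub>i where t: "triangle \<C> A B0 C x y \<delta>" and B: "B \<in> Obj \<C>"
    and \<beta>: "\<beta> \<in> mor Q B0 B" "\<beta>\<^sub>i \<in> mor Q B B0" "Comp Q B0 B B0 \<beta>\<^sub>i \<beta> = Ident Q B0"
      "Comp Q B B0 B \<beta> \<beta>\<^sub>i = Ident Q B"
    and X: "X = Comp Q A B0 B \<beta> (\<pi> A B0 x)" and Y: "Y = Comp Q B B0 C (\<pi> B0 C y) \<beta>\<^sub>i"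
    by (rule triangle_QE[OF T1])
  obtain B0' x' y' \<beta>' \<beta>\<^sub>i' where t': "triangle \<C> A' B0' C' x' y' \<delta>'" and B': "B' \<in> Obj \<C>"
    and \<beta>': "\<beta>' \<in> mor Q B0' B'" "\<beta>\<^sub>i' \<in> mor Q B' B0'" "Comp Q B0' B' B0' \<beta>\<^sub>i' \<beta>' = Ident Q B0'"
      "Comp Q B' B0' B' \<beta>' \<beta>\<^sub>i' = Ident Q B'"
    and X': "X' = Comp Q A' B0' B' \<beta>' (\<pi> A' B0' x')" and Y': "Y' = Comp Q B' B0' C' (\<pi> B0' C' y') \<beta>\<^sub>i'"
    by (rule triangle_QE[OF T2])
  note t_typed [simp] = triangle_typed[OF t] triangle_typed[OF t'] B B'
  note \<beta>_typed [simp] = \<beta>(1,2) \<beta>'(1,2)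
  obtain P0 i0 i0' p0 p0' where P0: "is_biproduct \<C> A A' P0 i0 i0' p0 p0'"
    using biproducts t_typed by blast
  obtain S0 j0 j0' s0 s0' where S0: "is_biproduct \<C> B0 B0' S0 j0 j0' s0 s0'"
    using biproducts t_typed by blast
  obtain R0 k0 k0' r0 r0' where R0: "is_biproduct \<C> C C' R0 k0 k0' r0 r0'"
    using biproducts t_typed by blast
  note PQ = is_biproduct_\<pi>[OF P0] and SQ = is_biproduct_\<pi>[OF S0] and RQ = is_biproduct_\<pi>[OF R0]
  note [simp] = biproduct_typed[OF P0] biproduct_typed[OF S0] biproduct_typed[OF R0]
    Q.biproduct_typed[OF P, simplified] Q.biproduct_typed[OF S, simplified] Q.biproduct_typed[OF R, simplified]
  define \<alpha> where "\<alpha> = dsum_mor Q A A' P0 (\<pi> P0 A p0) (\<pi> P0 A' p0') A A' P i i' (Ident Q A) (Ident Q A')"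
  define \<alpha>\<^sub>i where "\<alpha>\<^sub>i = dsum_mor Q A A' P p p' A A' P0 (\<pi> A P0 i0) (\<pi> A' P0 i0') (Ident Q A) (Ident Q A')"
  define \<rho> where "\<rho> = dsum_mor Q C C' R0 (\<pi> R0 C r0) (\<pi> R0 C' r0') C C' R k k' (Ident Q C) (Ident Q C')"
  define \<rho>\<^sub>i where "\<rho>\<^sub>i = dsum_mor Q C C' R r r' C C' R0 (\<pi> C R0 k0) (\<pi> C' R0 k0') (Ident Q C) (Ident Q C')"
  define \<kappa> where "\<kappa> = dsum_mor Q B0 B0' S0 (\<pi> S0 B0 s0) (\<pi> S0 B0' s0') B B' S j j' \<beta> \<beta>'"
  define \<kappa>\<^sub>i where "\<kappa>\<^sub>i = dsum_mor Q B B' S s s' B0 B0' S0 (\<pi> B0 S0 j0) (\<pi> B0' S0 j0') \<beta>\<^sub>i \<beta>\<^sub>i'"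
  have \<alpha>: "\<alpha> \<in> mor Q P0 P" "\<alpha>\<^sub>i \<in> mor Q P P0" "Comp Q P0 P P0 \<alpha>\<^sub>i \<alpha> = Ident Q P0"
      "Comp Q P P0 P \<alpha> \<alpha>\<^sub>i = Ident Q P"
    unfolding \<alpha>_def \<alpha>\<^sub>i_def
    by (simp_all add: Q.dsum_mor_typed[OF PQ P] Q.dsum_mor_typed[OF P PQ] Q.dsum_mor_iso[OF PQ P] Q.dsum_mor_iso[OF P PQ])
  have \<rho>: "\<rho> \<in> mor Q R0 R" "\<rho>\<^sub>i \<in> mor Q R R0" "Comp Q R0 R R0 \<rho>\<^sub>i \<rho> = Ident Q R0"
      "Comp Q R R0 R \<rho> \<rho>\<^sub>i = Ident Q R"
    unfolding \<rho>_def \<rho>\<^sub>i_def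
    by (simp_all add: Q.dsum_mor_typed[OF RQ R] Q.dsum_mor_typed[OF R RQ] Q.dsum_mor_iso[OF RQ R] Q.dsum_mor_iso[OF R RQ])
  have \<kappa>: "\<kappa> \<in> mor Q S0 S" "\<kappa>\<^sub>i \<in> mor Q S S0" "Comp Q S0 S S0 \<kappa>\<^sub>i \<kappa> = Ident Q S0"
      "Comp Q S S0 S \<kappa> \<kappa>\<^sub>i = Ident Q S"
    unfolding \<kappa>_def \<kappa>\<^sub>i_def using \<beta> \<beta>'
    by (simp_all add: Q.dsum_mor_typed[OF SQ S] Q.dsum_mor_typed[OF S SQ] Q.dsum_mor_iso[OF SQ S] Q.dsum_mor_iso[OF S SQ])
  note [simp] = \<alpha>(1,2) \<rho>(1,2) \<kappa>(1,2)
  note d = \<theta>[unfolded is_dsum_ext_def]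
  have [simp]: "\<theta> \<in> exts \<C> R P" using d by simp
  define \<theta>0 where "\<theta>0 = Emap Q R0 R P P0 \<rho> \<alpha>\<^sub>i \<theta>"
  have [simp]: "\<theta>0 \<in> exts \<C> R0 P0"
    unfolding \<theta>0_def using Q.emap_closed[of R0 R P P0 \<rho> \<alpha>\<^sub>i \<theta>] by simp
  have comp: "Emap \<C> D R0 P0 E a b \<theta>0 =
      Emap Q D R P E (Comp Q D R0 R \<rho> (\<pi> D R0 a)) (Comp Q P P0 E (\<pi> P0 E b) \<alpha>\<^sub>i) \<theta>"
    if "D \<in> Obj \<C>" "E \<in> Obj \<C>" "a \<in> mor \<C> D R0" "b \<in> mor \<C> P0 E" for D E a b
  proof -
    have "Emap \<C> D R0 P0 E a b \<theta>0 = Emap Q D R0 P0 E (\<pi> D R0 a) (\<pi> P0 E b) \<theta>0"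
      by (rule emap_\<pi>[symmetric]) (use that in simp_all)
    also have "\<dots> = Emap Q D R P E (Comp Q D R0 R \<rho> (\<pi> D R0 a)) (Comp Q P P0 E (\<pi> P0 E b) \<alpha>\<^sub>i) \<theta>"
      unfolding \<theta>0_def by (rule Q.emap_comp[symmetric]) (use that in simp_all)
    finally show ?thesis .
  qed
  have "is_dsum_ext \<C> A A' P0 p0 p0' C C' R0 k0 k0' \<delta> \<delta>' \<theta>0"
  proof -
    have "Comp Q C R0 R \<rho> (\<pi> C R0 k0) = k" "Comp Q C' R0 R \<rho> (\<pi> C' R0 k0') = k'"
      unfolding \<rho>_def by (simp_all add: Q.dsum_mor_incl_proj[OF RQ R])
    moreover have "Comp Q P P0 A (\<pi> P0 A p0) \<alpha>\<^sub>i = p" "Comp Q P P0 A' (\<pi> P0 A' p0') \<alpha>\<^sub>i = p'"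
      unfolding \<alpha>\<^sub>i_def by (simp_all add: Q.dsum_mor_incl_proj[OF P PQ])
    ultimately show ?thesis using d unfolding is_dsum_ext_def by (simp add: comp)
  qed
  from triangle_\<pi>[OF realz_dsum[OF t t' P0 S0 R0 this]]
  have "triangle Q P0 S0 R0
      (dsum_mor Q A A' P0 (\<pi> P0 A p0) (\<pi> P0 A' p0') B0 B0' S0 (\<pi> B0 S0 j0) (\<pi> B0' S0 j0') (\<pi> A B0 x) (\<pi> A' B0' x'))
      (dsum_mor Q B0 B0' S0 (\<pi> S0 B0 s0) (\<pi> S0 B0' s0') C C' R0 (\<pi> C R0 k0) (\<pi> C' R0 k0') (\<pi> B0 C y) (\<pi> B0' C' y'))
      \<theta>0" (is "triangle _ _ _ _ ?x ?y _")
    by (simp add: dsum_mor_\<pi>[OF P0 S0] dsum_mor_\<pi>[OF S0 R0])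
  from Q.triangle_transport[OF this, of P \<alpha> \<alpha>\<^sub>i R \<rho>\<^sub>i \<rho>]
  have "triangle Q P S0 R (Comp Q P P0 S0 ?x \<alpha>\<^sub>i) (Comp Q S0 R0 R \<rho> ?y) (Emap Q R R0 P0 P \<rho>\<^sub>i \<alpha> \<theta>0)"
    using \<alpha> \<rho> by simp
  moreover have "Emap Q R R0 P0 P \<rho>\<^sub>i \<alpha> \<theta>0 = \<theta>"
    unfolding \<theta>0_def using Q.emap_comp[of R R0 R P P0 P \<rho>\<^sub>i \<rho> \<alpha>\<^sub>i \<alpha> \<theta>] \<alpha> \<rho> by simp
  moreover have "Comp Q P P0 S0 ?x \<alpha>\<^sub>i =
      dsum_mor Q A A' P p p' B0 B0' S0 (\<pi> B0 S0 j0) (\<pi> B0' S0 j0') (\<pi> A B0 x) (\<pi> A' B0' x')"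
    unfolding \<alpha>\<^sub>i_def by (simp add: Q.dsum_mor_comp[OF P PQ SQ])
  moreover have "Comp Q S0 R0 R \<rho> ?y =
      dsum_mor Q B0 B0' S0 (\<pi> S0 B0 s0) (\<pi> S0 B0' s0') C C' R k k' (\<pi> B0 C y) (\<pi> B0' C' y')"
    unfolding \<rho>_def by (simp add: Q.dsum_mor_comp[OF SQ RQ R])
  ultimately have T: "triangle Q P S0 R
      (dsum_mor Q A A' P p p' B0 B0' S0 (\<pi> B0 S0 j0) (\<pi> B0' S0 j0') (\<pi> A B0 x) (\<pi> A' B0' x'))
      (dsum_mor Q B0 B0' S0 (\<pi> S0 B0 s0) (\<pi> S0 B0' s0') C C' R k k' (\<pi> B0 C y) (\<pi> B0' C' y')) \<theta>"
    by simp
  show ?thesis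
  proof (rule Q.triangle_middle_iso[OF T, of S \<kappa>])
    show "is_iso Q S0 S \<kappa>" using \<kappa> unfolding is_iso_def by blast
    show "Comp Q P S0 S \<kappa> (dsum_mor Q A A' P p p' B0 B0' S0 (\<pi> B0 S0 j0) (\<pi> B0' S0 j0') (\<pi> A B0 x) (\<pi> A' B0' x')) =
        dsum_mor Q A A' P p p' B B' S j j' X X'"
      unfolding \<kappa>_def X X' by (simp add: Q.dsum_mor_comp[OF P SQ S])
    show "dsum_mor Q B B' S s s' C C' R k k' Y Y' \<in> mor Q S R"
      by (rule Q.dsum_mor_typed[OF S R]) (simp_all add: Y Y')
    have "Comp Q B0 B C Y \<beta> = \<pi> B0 C y" "Comp Q B0' B' C' Y' \<beta>' = \<pi> B0' C' y'"
      unfolding Y Y' using \<beta> \<beta>' by (simp_all add: Q.comp_cancel_right)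
    moreover have "Y \<in> mor Q B C" "Y' \<in> mor Q B' C'" unfolding Y Y' by simp_all
    ultimately show "Comp Q S0 S R (dsum_mor Q B B' S s s' C C' R k k' Y Y') \<kappa> =
        dsum_mor Q B0 B0' S0 (\<pi> S0 B0 s0) (\<pi> S0 B0' s0') C C' R k k' (\<pi> B0 C y) (\<pi> B0' C' y')"
      unfolding \<kappa>_def by (simp add: Q.dsum_mor_comp[OF SQ S R])
  qed simp
qed

text \<open>The two given triangles share \<open>B\<close>, but their representatives share it only up to an
  isomorphism \<open>\<beta>\<close> in the quotient.  Transporting the second triangle along \<open>\<beta>\<close> gives
  representatives that can be composed before passing to the quotient.\<close>

lemma ET4_Q:
  assumes T1: "triangle Q A B D f f' \<delta>" and T2: "triangle Q B C F g g' \<delta>'"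
  shows "\<exists>E h' d e \<delta>''. E \<in> Obj Q \<and> h' \<in> mor Q C E \<and> d \<in> mor Q D E \<and> e \<in> mor Q E F \<and>
            Comp Q B C E h' g = Comp Q B D E d f' \<and>
            Comp Q C E F e h' = g' \<and>
            triangle Q A C E (Comp Q A B C g f) h' \<delta>'' \<and>
            triangle Q D E F d e (push Q F B D f' \<delta>') \<and>
            pull Q D E A d \<delta>'' = \<delta> \<and>
            push Q E A B f \<delta>'' = pull Q E F B e \<delta>'"
proof -
  obtain B0 f0 f0' \<beta> \<beta>\<^sub>i where t: "triangle \<C> A B0 D f0 f0' \<delta>" and B: "B \<in> Obj \<C>"
    and \<beta>: "\<beta> \<in> mor Q B0 B" "\<beta>\<^sub>i \<in> mor Q B B0" "Comp Q B0 B B0 \<beta>\<^sub>i \<beta> = Ident Q B0"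
      "Comp Q B B0 B \<beta> \<beta>\<^sub>i = Ident Q B"
    and f: "f = Comp Q A B0 B \<beta> (\<pi> A B0 f0)" and f': "f' = Comp Q B B0 D (\<pi> B0 D f0') \<beta>\<^sub>i"
    by (rule triangle_QE[OF T1])
  note [simp] = triangle_typed[OF t] B \<beta>(1,2) Q.triangle_typed[OF T2, simplified]
  define \<delta>1 where "\<delta>1 = push Q F B B0 \<beta>\<^sub>i \<delta>'"
  have "triangle Q B0 C F (Comp Q B0 B C g \<beta>) g' \<delta>1"
    using Q.triangle_transport[OF T2, of B0 \<beta>\<^sub>i \<beta> F "Ident Q F" "Ident Q F"] \<beta>
    by (simp add: \<delta>1_def push_def)
  then obtain C0 g0 g0' \<gamma> \<gamma>\<^sub>i where t': "triangle \<C> B0 C0 F g0 g0' \<delta>1"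
    and \<gamma>: "\<gamma> \<in> mor Q C0 C" "\<gamma>\<^sub>i \<in> mor Q C C0" "Comp Q C0 C C0 \<gamma>\<^sub>i \<gamma> = Ident Q C0"
      "Comp Q C C0 C \<gamma> \<gamma>\<^sub>i = Ident Q C"
    and g: "Comp Q B0 B C g \<beta> = Comp Q B0 C0 C \<gamma> (\<pi> B0 C0 g0)" and g': "g' = Comp Q C C0 F (\<pi> C0 F g0') \<gamma>\<^sub>i"
    by (rule triangle_QE)
  note [simp] = triangle_typed[OF t'] \<gamma>(1,2)
  obtain E h0 d0 e0 \<delta>'' where [simp]: "E \<in> Obj \<C>" "h0 \<in> mor \<C> C0 E" "d0 \<in> mor \<C> D E" "e0 \<in> mor \<C> E F"
    and E: "Comp \<C> B0 C0 E h0 g0 = Comp \<C> B0 D E d0 f0'" "Comp \<C> C0 E F e0 h0 = g0'"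
      "triangle \<C> A C0 E (Comp \<C> A B0 C0 g0 f0) h0 \<delta>''"
      "triangle \<C> D E F d0 e0 (push \<C> F B0 D f0' \<delta>1)"
      "pull \<C> D E A d0 \<delta>'' = \<delta>" "push \<C> E A B0 f0 \<delta>'' = pull \<C> E F B0 e0 \<delta>1"
    using ET4[OF t t'] by blast
  have [simp]: "\<delta>'' \<in> exts \<C> E A" using triangle_typed[OF E(3)] by blast
  define h' where "h' = Comp Q C C0 E (\<pi> C0 E h0) \<gamma>\<^sub>i"
  define d where "d = \<pi> D E d0"
  define e where "e = \<pi> E F e0"
  have [simp]: "h' \<in> mor Q C E" "d \<in> mor Q D E" "e \<in> mor Q E F" by (simp_all add: h'_def d_def e_def)
  have "Comp Q B C E h' g = Comp Q B D E d f'"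
  proof -
    have "Comp Q B C E h' g = Comp Q B C E h' (Comp Q B B0 C (Comp Q B0 B C g \<beta>) \<beta>\<^sub>i)"
      using \<beta> by (simp add: Q.comp_cancel_right)
    also have "\<dots> = Comp Q B B0 E (Comp Q B0 C0 E (\<pi> C0 E h0) (\<pi> B0 C0 g0)) \<beta>\<^sub>i"
      unfolding g h'_def using \<gamma> by (simp add: Q.comp_assoc Q.comp_cancel_left)
    also have "Comp Q B0 C0 E (\<pi> C0 E h0) (\<pi> B0 C0 g0) = Comp Q B0 D E d (\<pi> B0 D f0')"
      using E(1) by (simp add: \<pi>_comp d_def)
    also have "Comp Q B B0 E \<dots> \<beta>\<^sub>i = Comp Q B D E d f'" unfolding f' by (simp add: Q.comp_assoc)
    finally show ?thesis .
  qed
  moreover have "Comp Q C E F e h' = g'"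
    unfolding g' h'_def e_def E(2)[symmetric] by (simp add: Q.comp_assoc[symmetric] \<pi>_comp)
  moreover have "triangle Q A C E (Comp Q A B C g f) h' \<delta>''"
  proof (rule triangle_QI[OF E(3), of C \<gamma>])
    show "is_iso Q C0 C \<gamma>" using \<gamma> unfolding is_iso_def by blast
    have "Comp Q A B C g f = Comp Q A B0 C (Comp Q B0 B C g \<beta>) (\<pi> A B0 f0)"
      unfolding f by (simp add: Q.comp_assoc)
    then show "Comp Q A C0 C \<gamma> (\<pi> A C0 (Comp \<C> A B0 C0 g0 f0)) = Comp Q A B C g f"
      unfolding g by (simp add: Q.comp_assoc \<pi>_comp)
    show "Comp Q C0 C E h' \<gamma> = \<pi> C0 E h0"
      unfolding h'_def using \<gamma> by (simp add: Q.comp_cancel_right)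
  qed simp_all
  moreover have "triangle Q D E F d e (push Q F B D f' \<delta>')"
  proof -
    have "push Q F B D f' \<delta>' = push Q F B0 D (\<pi> B0 D f0') \<delta>1"
      unfolding \<delta>1_def f' push_def
      using Q.emap_comp[of F F F B B0 D "Ident Q F" "Ident Q F" \<beta>\<^sub>i "\<pi> B0 D f0'" \<delta>'] by simp
    then show ?thesis using triangle_\<pi>[OF E(4)] by (simp add: push_\<pi> d_def e_def)
  qed
  moreover have "pull Q D E A d \<delta>'' = \<delta>"
    using E(5) by (simp add: d_def pull_\<pi>)
  moreover have "push Q E A B f \<delta>'' = pull Q E F B e \<delta>'"
  proof -
    have "push Q E A B f \<delta>'' = push Q E B0 B \<beta> (push Q E A B0 (\<pi> A B0 f0) \<delta>'')"
      unfolding f push_def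
      using Q.emap_comp[of E E E A B0 B "Ident Q E" "Ident Q E" "\<pi> A B0 f0" \<beta> \<delta>''] by simp
    also have "\<dots> = push Q E B0 B \<beta> (pull Q E F B0 e \<delta>1)"
      using E(6) by (simp add: push_\<pi> pull_\<pi> e_def)
    also have "\<dots> = pull Q E F B e \<delta>'"
      unfolding \<delta>1_def push_def pull_def using \<beta>(4)
      by (simp add: Q.emap_comp[symmetric] Q.comp_assoc)
    finally show ?thesis .
  qed
  ultimately show ?thesis by (intro exI[of _ E] exI[of _ h'] exI[of _ d] exI[of _ e] exI[of _ \<delta>'']) simp
qed

text \<open>Dually, the second triangle is pulled back along \<open>\<beta>\<close>.\<close>

lemma ET4_op_Q:
  assumes T1: "triangle Q D B A f' f \<delta>" and T2: "triangle Q F C B g' g \<delta>'"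
  shows "\<exists>E h' d e \<delta>''. E \<in> Obj Q \<and> h' \<in> mor Q E C \<and> d \<in> mor Q E D \<and> e \<in> mor Q F E \<and>
            Comp Q E C B g h' = Comp Q E D B f' d \<and>
            Comp Q F E C h' e = g' \<and>
            triangle Q E C A h' (Comp Q C B A f g) \<delta>'' \<and>
            triangle Q F E D e d (pull Q D B F f' \<delta>') \<and>
            push Q A E D d \<delta>'' = \<delta> \<and>
            pull Q B A E f \<delta>'' = push Q B F E e \<delta>'"
proof -
  obtain B0 f0' f0 \<beta> \<beta>\<^sub>i where t: "triangle \<C> D B0 A f0' f0 \<delta>" and B: "B \<in> Obj \<C>"
    and \<beta>: "\<beta> \<in> mor Q B0 B" "\<beta>\<^sub>i \<in> mor Q B B0" "Comp Q B0 B B0 \<beta>\<^sub>i \<beta> = Ident Q B0"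
      "Comp Q B B0 B \<beta> \<beta>\<^sub>i = Ident Q B"
    and f': "f' = Comp Q D B0 B \<beta> (\<pi> D B0 f0')" and f: "f = Comp Q B B0 A (\<pi> B0 A f0) \<beta>\<^sub>i"
    by (rule triangle_QE[OF T1])
  note [simp] = triangle_typed[OF t] B \<beta>(1,2) Q.triangle_typed[OF T2, simplified]
  define \<delta>1 where "\<delta>1 = pull Q B0 B F \<beta> \<delta>'"
  have "triangle Q F C B0 g' (Comp Q C B B0 \<beta>\<^sub>i g) \<delta>1"
    using Q.triangle_transport[OF T2, of F "Ident Q F" "Ident Q F" B0 \<beta> \<beta>\<^sub>i] \<beta>
    by (simp add: \<delta>1_def pull_def)
  then obtain C0 g0' g0 \<gamma> \<gamma>\<^sub>i where t': "triangle \<C> F C0 B0 g0' g0 \<delta>1"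
    and \<gamma>: "\<gamma> \<in> mor Q C0 C" "\<gamma>\<^sub>i \<in> mor Q C C0" "Comp Q C0 C C0 \<gamma>\<^sub>i \<gamma> = Ident Q C0"
      "Comp Q C C0 C \<gamma> \<gamma>\<^sub>i = Ident Q C"
    and g': "g' = Comp Q F C0 C \<gamma> (\<pi> F C0 g0')" and g: "Comp Q C B B0 \<beta>\<^sub>i g = Comp Q C C0 B0 (\<pi> C0 B0 g0) \<gamma>\<^sub>i"
    by (rule triangle_QE)
  note [simp] = triangle_typed[OF t'] \<gamma>(1,2)
  obtain E h0 d0 e0 \<delta>'' where [simp]: "E \<in> Obj \<C>" "h0 \<in> mor \<C> E C0" "d0 \<in> mor \<C> E D" "e0 \<in> mor \<C> F E"
    and E: "Comp \<C> E C0 B0 g0 h0 = Comp \<C> E D B0 f0' d0" "Comp \<C> F E C0 h0 e0 = g0'"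
      "triangle \<C> E C0 A h0 (Comp \<C> C0 B0 A f0 g0) \<delta>''"
      "triangle \<C> F E D e0 d0 (pull \<C> D B0 F f0' \<delta>1)"
      "push \<C> A E D d0 \<delta>'' = \<delta>" "pull \<C> B0 A E f0 \<delta>'' = push \<C> B0 F E e0 \<delta>1"
    using ET4_op[OF t t'] by blast
  have [simp]: "\<delta>'' \<in> exts \<C> A E" using triangle_typed[OF E(3)] by blast
  define h' where "h' = Comp Q E C0 C \<gamma> (\<pi> E C0 h0)"
  define d where "d = \<pi> E D d0"
  define e where "e = \<pi> F E e0"
  have [simp]: "h' \<in> mor Q E C" "d \<in> mor Q E D" "e \<in> mor Q F E" by (simp_all add: h'_def d_def e_def)
  have "Comp Q E C B g h' = Comp Q E D B f' d"
  proof -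
    have "Comp Q E C B g h' = Comp Q E B0 B \<beta> (Comp Q E C B0 (Comp Q C B B0 \<beta>\<^sub>i g) h')"
      using \<beta> by (simp add: Q.comp_assoc Q.comp_cancel_left)
    also have "\<dots> = Comp Q E B0 B \<beta> (Comp Q E C0 B0 (\<pi> C0 B0 g0) (\<pi> E C0 h0))"
      unfolding g h'_def using \<gamma> by (simp add: Q.comp_assoc Q.comp_cancel_left)
    also have "Comp Q E C0 B0 (\<pi> C0 B0 g0) (\<pi> E C0 h0) = Comp Q E D B0 (\<pi> D B0 f0') d"
      using E(1) by (simp add: \<pi>_comp d_def)
    also have "Comp Q E B0 B \<beta> \<dots> = Comp Q E D B f' d" unfolding f' by (simp add: Q.comp_assoc)
    finally show ?thesis .
  qed
  moreover have "Comp Q F E C h' e = g'"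
    unfolding g' h'_def e_def E(2)[symmetric] by (simp add: Q.comp_assoc \<pi>_comp)
  moreover have "triangle Q E C A h' (Comp Q C B A f g) \<delta>''"
  proof (rule triangle_QI[OF E(3), of C \<gamma>])
    show "is_iso Q C0 C \<gamma>" using \<gamma> unfolding is_iso_def by blast
    show "Comp Q E C0 C \<gamma> (\<pi> E C0 h0) = h'" unfolding h'_def ..
    have "Comp Q C B A f g = Comp Q C B0 A (\<pi> B0 A f0) (Comp Q C B B0 \<beta>\<^sub>i g)"
      unfolding f by (simp add: Q.comp_assoc)
    then show "Comp Q C0 C A (Comp Q C B A f g) \<gamma> = \<pi> C0 A (Comp \<C> C0 B0 A f0 g0)"
      unfolding g using \<gamma> by (simp add: Q.comp_assoc \<pi>_comp)
    show "Comp Q C B A f g \<in> mor Q C A" by (simp add: f)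
  qed simp_all
  moreover have "triangle Q F E D e d (pull Q D B F f' \<delta>')"
  proof -
    have "pull Q D B F f' \<delta>' = pull Q D B0 F (\<pi> D B0 f0') \<delta>1"
      unfolding \<delta>1_def f' pull_def
      using Q.emap_comp[of D B0 B F F F "\<pi> D B0 f0'" \<beta> "Ident Q F" "Ident Q F" \<delta>'] by simp
    then show ?thesis using triangle_\<pi>[OF E(4)] by (simp add: pull_\<pi> d_def e_def)
  qed
  moreover have "push Q A E D d \<delta>'' = \<delta>"
    using E(5) by (simp add: d_def push_\<pi>)
  moreover have "pull Q B A E f \<delta>'' = push Q B F E e \<delta>'"
  proof -
    have "pull Q B A E f \<delta>'' = pull Q B B0 E \<beta>\<^sub>i (pull Q B0 A E (\<pi> B0 A f0) \<delta>'')"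
      unfolding f pull_def
      using Q.emap_comp[of B B0 A E E E \<beta>\<^sub>i "\<pi> B0 A f0" "Ident Q E" "Ident Q E" \<delta>''] by simp
    also have "\<dots> = pull Q B B0 E \<beta>\<^sub>i (push Q B0 F E e \<delta>1)"
      using E(6) by (simp add: push_\<pi> pull_\<pi> e_def)
    also have "\<dots> = push Q B F E e \<delta>'"
      unfolding \<delta>1_def push_def pull_def using \<beta>(4)
      by (simp add: Q.emap_comp[symmetric] Q.comp_assoc)
    finally show ?thesis .
  qed
  ultimately show ?thesis by (intro exI[of _ E] exI[of _ h'] exI[of _ d] exI[of _ e] exI[of _ \<delta>'']) simp
qed

theorem extriangulated_quotient: "extriangulated_category Q"
proof (rule extriangulated_category.intro)
  show "additive_category Q" by (rule additive_Q)
  show "extriangulated_category_axioms Q"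
    by (rule extriangulated_category_axioms.intro)
      (fact Q.ext_group Q.emap_hom Q.emap_ident Q.emap_comp Q.emap_add_left Q.emap_add_right
        Q.realz_class Q.realz_morphism Q.realz_zero realz_dsum_Q Q.ET3 Q.ET3_op ET4_Q ET4_op_Q)+
qed

end


section \<open>Vanishing of extension groups\<close>

context preadditive_category
begin

lemma ideal_iso:
  assumes "is_ideal \<C> I" "A \<in> Obj \<C>" "B \<in> Obj \<C>" "isomorphic \<C> A B" "Ident \<C> B \<in> I B B"
  shows "Ident \<C> A \<in> I A A"
proof -
  obtain f g where "f \<in> mor \<C> A B" "g \<in> mor \<C> B A" "Comp \<C> A B A g f = Ident \<C> A"
    using assms(4) is_iso_mor unfolding isomorphic_def by (metis is_iso_inverse)
  then show ?thesis using ideal_factor[OF assms(1,2,2,3,5), of f g] by simp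
qed

end

context ext_bifunctor
begin

text \<open>The vanishing of \<open>\<E>(W, Z)\<close> says that the identity of \<open>W\<close> acts as zero on it.  The maps
  that act as zero form an ideal, so the facts about ideals apply.\<close>

lemma is_ideal_left_annihilator:
  assumes [simp]: "Z \<in> Obj \<C>"
  shows "is_ideal \<C> (\<lambda>A B. {f \<in> mor \<C> A B. \<forall>\<delta> \<in> exts \<C> B Z. Emap \<C> A B Z Z f (Ident \<C> Z) \<delta> = \<one>\<^bsub>Ext \<C> A Z\<^esub>})"
proof -
  have c: "Emap \<C> A C Z Z (Comp \<C> A B C g f) (Ident \<C> Z) \<delta> =
      Emap \<C> A B Z Z f (Ident \<C> Z) (Emap \<C> B C Z Z g (Ident \<C> Z) \<delta>)"
    if "A \<in> Obj \<C>" "B \<in> Obj \<C>" "C \<in> Obj \<C>" "f \<in> mor \<C> A B" "g \<in> mor \<C> B C" "\<delta> \<in> exts \<C> C Z" for A B C f g \<delta>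
    using that emap_comp[of A B C Z Z Z f g "Ident \<C> Z" "Ident \<C> Z" \<delta>] by simp
  show ?thesis
    unfolding is_ideal_def by (auto simp: emap_add_left c)
qed

lemma is_ideal_right_annihilator:
  assumes [simp]: "Z \<in> Obj \<C>"
  shows "is_ideal \<C> (\<lambda>A B. {f \<in> mor \<C> A B. \<forall>\<delta> \<in> exts \<C> Z A. Emap \<C> Z Z A B (Ident \<C> Z) f \<delta> = \<one>\<^bsub>Ext \<C> Z B\<^esub>})"
proof -
  have c: "Emap \<C> Z Z A C (Ident \<C> Z) (Comp \<C> A B C g f) \<delta> =
      Emap \<C> Z Z B C (Ident \<C> Z) g (Emap \<C> Z Z A B (Ident \<C> Z) f \<delta>)"
    if "A \<in> Obj \<C>" "B \<in> Obj \<C>" "C \<in> Obj \<C>" "f \<in> mor \<C> A B" "g \<in> mor \<C> B C" "\<delta> \<in> exts \<C> Z A" for A B C f g \<delta>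
    using that emap_comp[of Z Z Z A B C "Ident \<C> Z" "Ident \<C> Z" f g \<delta>] by simp
  show ?thesis
    unfolding is_ideal_def by (auto simp: emap_add_right c)
qed

lemma ext_vanishes_iff_left:
  assumes "W \<in> Obj \<C>" "Z \<in> Obj \<C>"
  shows "exts \<C> W Z = {\<one>\<^bsub>Ext \<C> W Z\<^esub>} \<longleftrightarrow>
    Ident \<C> W \<in> {f \<in> mor \<C> W W. \<forall>\<delta> \<in> exts \<C> W Z. Emap \<C> W W Z Z f (Ident \<C> Z) \<delta> = \<one>\<^bsub>Ext \<C> W Z\<^esub>}"
  using assms zero_ext[OF assms] by auto

lemma ext_vanishes_iff_right:
  assumes "W \<in> Obj \<C>" "Z \<in> Obj \<C>"
  shows "exts \<C> Z W = {\<one>\<^bsub>Ext \<C> Z W\<^esub>} \<longleftrightarrow>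
    Ident \<C> W \<in> {f \<in> mor \<C> W W. \<forall>\<delta> \<in> exts \<C> Z W. Emap \<C> Z Z W W (Ident \<C> Z) f \<delta> = \<one>\<^bsub>Ext \<C> Z W\<^esub>}"
  using assms zero_ext[OF assms(2,1)] by auto

lemma ext_vanishes_add_of:
  assumes "\<A> \<subseteq> Obj \<C>" "W \<in> add_of \<C> \<A>" and Z: "Z \<in> Obj \<C>"
  shows "(\<And>A. A \<in> \<A> \<Longrightarrow> exts \<C> A Z = {\<one>\<^bsub>Ext \<C> A Z\<^esub>}) \<Longrightarrow> exts \<C> W Z = {\<one>\<^bsub>Ext \<C> W Z\<^esub>}"
    and "(\<And>A. A \<in> \<A> \<Longrightarrow> exts \<C> Z A = {\<one>\<^bsub>Ext \<C> Z A\<^esub>}) \<Longrightarrow> exts \<C> Z W = {\<one>\<^bsub>Ext \<C> Z W\<^esub>}"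
proof -
  have W: "W \<in> Obj \<C>" using assms add_of_subset_Obj by blast
  show "exts \<C> W Z = {\<one>\<^bsub>Ext \<C> W Z\<^esub>}" if "\<And>A. A \<in> \<A> \<Longrightarrow> exts \<C> A Z = {\<one>\<^bsub>Ext \<C> A Z\<^esub>}"
    using ideal_add_of(2)[OF is_ideal_left_annihilator[OF Z] _ assms(2)] that assms(1) W Z
    by (simp add: ext_vanishes_iff_left subset_iff)
  show "exts \<C> Z W = {\<one>\<^bsub>Ext \<C> Z W\<^esub>}" if "\<And>A. A \<in> \<A> \<Longrightarrow> exts \<C> Z A = {\<one>\<^bsub>Ext \<C> Z A\<^esub>}"
    using ideal_add_of(2)[OF is_ideal_right_annihilator[OF Z] _ assms(2)] that assms(1) W Z
    by (simp add: ext_vanishes_iff_right subset_iff)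
qed

lemma ext_vanishes_iso:
  assumes "A \<in> Obj \<C>" "B \<in> Obj \<C>" "isomorphic \<C> A B" and Z: "Z \<in> Obj \<C>"
  shows "exts \<C> B Z = {\<one>\<^bsub>Ext \<C> B Z\<^esub>} \<Longrightarrow> exts \<C> A Z = {\<one>\<^bsub>Ext \<C> A Z\<^esub>}"
    and "exts \<C> Z B = {\<one>\<^bsub>Ext \<C> Z B\<^esub>} \<Longrightarrow> exts \<C> Z A = {\<one>\<^bsub>Ext \<C> Z A\<^esub>}"
  using ideal_iso[OF is_ideal_left_annihilator[OF Z] assms(1-3)]
    ideal_iso[OF is_ideal_right_annihilator[OF Z] assms(1-3)] assms
  by (simp_all add: ext_vanishes_iff_left ext_vanishes_iff_right)

lemma ext_vanishes_zero_object:
  assumes "is_zero_object \<C> Z0" "Z \<in> Obj \<C>"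
  shows "exts \<C> Z0 Z = {\<one>\<^bsub>Ext \<C> Z0 Z\<^esub>}"
proof -
  have Z0: "Z0 \<in> Obj \<C>" using assms unfolding is_zero_object_def by blast
  have "\<delta> = \<one>\<^bsub>Ext \<C> Z0 Z\<^esub>" if \<delta>: "\<delta> \<in> exts \<C> Z0 Z" for \<delta>
  proof -
    have "\<delta> = Emap \<C> Z0 Z0 Z Z (Ident \<C> Z0) (Ident \<C> Z) \<delta>"
      using emap_ident[OF Z0 assms(2) \<delta>] by (rule sym)
    also have "\<dots> = \<one>\<^bsub>Ext \<C> Z0 Z\<^esub>"
      unfolding zero_object_Ident[OF assms(1)]
      by (rule emap_zero_left[OF Z0 Z0 assms(2) assms(2) ident_mor[OF assms(2)] \<delta>])
    finally show ?thesis .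
  qed
  then show ?thesis using zero_ext[OF Z0 assms(2)] by blast
qed

end

context weakly_extriangulated
begin

lemma projective_ext_vanishes:
  assumes P: "P \<in> projectives \<C>" and A: "A \<in> Obj \<C>"
  shows "exts \<C> P A = {\<one>\<^bsub>Ext \<C> P A\<^esub>}"
proof -
  have P': "P \<in> Obj \<C>" using P unfolding projectives_def by blast
  have "\<delta> = \<one>\<^bsub>Ext \<C> P A\<^esub>" if \<delta>: "\<delta> \<in> exts \<C> P A" for \<delta>
  proof -
    obtain B x y where t: "triangle \<C> A B P x y \<delta>" using triangle_exists P' A \<delta> by blast
    note [simp] = triangle_typed[OF t]
    obtain g where [simp]: "g \<in> mor \<C> P B" and g: "Comp \<C> P B P y g = Ident \<C> P"
      using P t P' ident_mor unfolding projectives_def by blast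
    have "\<delta> = Emap \<C> P P A A (Comp \<C> P B P y g) (Comp \<C> A A A (Ident \<C> A) (Ident \<C> A)) \<delta>"
      by (simp add: g)
    also have "\<dots> = Emap \<C> P B A A g (Ident \<C> A) (Emap \<C> B P A A y (Ident \<C> A) \<delta>)"
      by (rule emap_comp) auto
    also have "\<dots> = \<one>\<^bsub>Ext \<C> P A\<^esub>" by (simp add: pull_along_deflation[OF t])
    finally show ?thesis .
  qed
  then show ?thesis using zero_ext[OF P' A] by blast
qed

lemma injective_ext_vanishes:
  assumes I: "I \<in> injectives \<C>" and C: "C \<in> Obj \<C>"
  shows "exts \<C> C I = {\<one>\<^bsub>Ext \<C> C I\<^esub>}"
proof -
  have I': "I \<in> Obj \<C>" using I unfolding injectives_def by blast
  have "\<delta> = \<one>\<^bsub>Ext \<C> C I\<^esub>" if \<delta>: "\<delta> \<in> exts \<C> C I" for \<delta>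
  proof -
    obtain B x y where t: "triangle \<C> I B C x y \<delta>" using triangle_exists I' C \<delta> by blast
    note [simp] = triangle_typed[OF t]
    obtain g where [simp]: "g \<in> mor \<C> B I" and g: "Comp \<C> I B I g x = Ident \<C> I"
      using I t I' ident_mor unfolding injectives_def by blast
    have "\<delta> = Emap \<C> C C I I (Comp \<C> C C C (Ident \<C> C) (Ident \<C> C)) (Comp \<C> I B I g x) \<delta>"
      by (simp add: g)
    also have "\<dots> = Emap \<C> C C B I (Ident \<C> C) g (Emap \<C> C C I B (Ident \<C> C) x \<delta>)"
      by (rule emap_comp) auto
    also have "\<dots> = \<one>\<^bsub>Ext \<C> C I\<^esub>" by (simp add: push_along_inflation[OF t])
    finally show ?thesis .
  qed
  then show ?thesis using zero_ext[OF C I'] by blast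
qed

end

context extriangulated_category
begin

text \<open>Exactness of \<open>\<E>(C, Z) \<rightarrow> \<E>(B, Z) \<rightarrow> \<E>(A, Z)\<close> in the case where the outer groups vanish.
  Let \<open>\<delta> \<in> \<E>(B, Z)\<close> be realized by \<open>Z \<rightarrow> G \<rightarrow> B\<close>, and compose the deflations \<open>G \<rightarrow> B \<rightarrow> C\<close>.
  The kernel \<open>E\<close> of the composite is an extension of \<open>A\<close> by \<open>Z\<close>, hence split, so \<open>e : Z \<rightarrow> E\<close> has
  a retraction \<open>r\<close>.  As \<open>e \<cdot> \<delta>\<close> is pulled back from \<open>C\<close>, so is \<open>\<delta> = r \<cdot> (e \<cdot> \<delta>)\<close>.\<close>

lemma ext_vanishes_middle:
  assumes t: "triangle \<C> A B C x y \<epsilon>" and Z: "Z \<in> Obj \<C>"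
    and A0: "exts \<C> A Z = {\<one>\<^bsub>Ext \<C> A Z\<^esub>}" and C0: "exts \<C> C Z = {\<one>\<^bsub>Ext \<C> C Z\<^esub>}"
  shows "exts \<C> B Z = {\<one>\<^bsub>Ext \<C> B Z\<^esub>}"
proof -
  note [simp] = triangle_typed[OF t] Z
  have "\<delta> = \<one>\<^bsub>Ext \<C> B Z\<^esub>" if \<delta> [simp]: "\<delta> \<in> exts \<C> B Z" for \<delta>
  proof -
    obtain G w z where G: "triangle \<C> Z G B w z \<delta>" using triangle_exists[of B Z \<delta>] by auto
    obtain E h' d e \<delta>'' where E: "e \<in> mor \<C> Z E" "triangle \<C> E G C h' (Comp \<C> G B C y z) \<delta>''"
      "triangle \<C> Z E A e d (pull \<C> A B Z x \<delta>)" "pull \<C> B C E y \<delta>'' = push \<C> B Z E e \<delta>"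
      using ET4_op[OF t G] by blast
    note [simp] = triangle_typed[OF E(2)] triangle_typed[OF E(3)]
    have "Emap \<C> A A Z Z (Ident \<C> A) (Ident \<C> Z) (pull \<C> A B Z x \<delta>) = \<one>\<^bsub>Ext \<C> A Z\<^esub>"
      using A0 triangle_typed(6)[OF E(3)] by simp
    then obtain r where [simp]: "r \<in> mor \<C> E Z" and r: "Comp \<C> Z E Z r e = Ident \<C> Z"
      using extend_along_inflation[OF E(3) Z, of "Ident \<C> Z"] by auto
    have "\<delta> = push \<C> B E Z r (push \<C> B Z E e \<delta>)"
      unfolding push_def by (simp add: emap_comp[symmetric] r)
    also have "\<dots> = push \<C> B E Z r (pull \<C> B C E y \<delta>'')" unfolding E(4) ..
    also have "\<dots> = pull \<C> B C Z y (push \<C> C E Z r \<delta>'')"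
      unfolding push_def pull_def by (simp add: emap_comp[symmetric])
    also have "push \<C> C E Z r \<delta>'' = \<one>\<^bsub>Ext \<C> C Z\<^esub>"
      using C0 emap_closed[of C C E Z "Ident \<C> C" r \<delta>''] unfolding push_def by simp
    finally show ?thesis unfolding pull_def by simp
  qed
  then show ?thesis using zero_ext[OF triangle_typed(2)[OF t] Z] by blast
qed

lemma extension_closed_left_orthogonal:
  assumes Z: "\<Z> \<subseteq> Obj \<C>" and N: "\<N> = {N \<in> Obj \<C>. \<forall>Z \<in> \<Z>. exts \<C> N Z = {\<one>\<^bsub>Ext \<C> N Z\<^esub>}}"
  shows "\<N> \<subseteq> Obj \<C>" "is_zero_object \<C> Z0 \<Longrightarrow> Z0 \<in> \<N>"
    "triangle \<C> A B C x y \<delta> \<Longrightarrow> A \<in> \<N> \<Longrightarrow> C \<in> \<N> \<Longrightarrow> B \<in> \<N>"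
proof -
  show "\<N> \<subseteq> Obj \<C>" unfolding N by blast
  show "Z0 \<in> \<N>" if "is_zero_object \<C> Z0"
    unfolding N using that Z ext_vanishes_zero_object[OF that] unfolding is_zero_object_def by blast
  show "B \<in> \<N>" if t: "triangle \<C> A B C x y \<delta>" and "A \<in> \<N>" "C \<in> \<N>"
    using that(2,3) Z triangle_typed(2)[OF t] ext_vanishes_middle[OF t] unfolding N by blast
qed

lemma cosyzygy_Obj:
  assumes "enough_injectives \<C>" "X \<in> Obj \<C>"
  shows "(cosyzygy \<C> ^^ k) X \<in> Obj \<C>"
proof (induction k)
  case (Suc k)
  let ?P = "\<lambda>S. \<exists>I x y \<delta>. I \<in> injectives \<C> \<and> triangle \<C> ((cosyzygy \<C> ^^ k) X) I S x y \<delta>"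
  have "\<exists>S. ?P S" using assms(1) Suc unfolding enough_injectives_def by blast
  then have "?P (cosyzygy \<C> ((cosyzygy \<C> ^^ k) X))" unfolding cosyzygy_def by (rule someI_ex)
  then show ?case using triangle_typed(3) by auto
qed (simp add: assms)

end


section \<open>Ideals along a quotient\<close>

context proj_inj_quotient
begin

interpretation Q: weakly_extriangulated Q
  by (rule weakly_extriangulated_Q)

lemma isomorphic_quot_cat: "isomorphic (quot_cat \<C> \<Y>) = isomorphic Q"
  by (simp add: fun_eq_iff isomorphic_def is_iso_def Q_simps) (simp add: quot_cat_def)

lemma ess_image_Q: "ess_image \<C> \<Y> \<A> = {N \<in> Obj \<C>. \<exists>Y \<in> \<A>. isomorphic Q N Y}"
  by (simp add: ess_image_def isomorphic_quot_cat) (simp add: quot_cat_def)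

lemma subset_ess_image: "\<A> \<subseteq> Obj \<C> \<Longrightarrow> \<A> \<subseteq> ess_image \<C> \<Y> \<A>"
  unfolding ess_image_Q isomorphic_def using Q.is_iso_ident by auto

text \<open>Extension groups do not change in the quotient, so vanishing passes to the essential image.\<close>

lemma ext_vanishes_ess_image:
  assumes "\<A> \<subseteq> Obj \<C>" "W \<in> ess_image \<C> \<Y> \<A>" "Z \<in> Obj \<C>"
  shows "(\<And>A. A \<in> \<A> \<Longrightarrow> exts \<C> A Z = {\<one>\<^bsub>Ext \<C> A Z\<^esub>}) \<Longrightarrow> exts \<C> W Z = {\<one>\<^bsub>Ext \<C> W Z\<^esub>}"
    and "(\<And>A. A \<in> \<A> \<Longrightarrow> exts \<C> Z A = {\<one>\<^bsub>Ext \<C> Z A\<^esub>}) \<Longrightarrow> exts \<C> Z W = {\<one>\<^bsub>Ext \<C> Z W\<^esub>}"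
proof -
  obtain A where A: "W \<in> Obj Q" "A \<in> \<A>" "A \<in> Obj Q" "isomorphic Q W A"
    using assms unfolding ess_image_Q by auto
  show "exts \<C> W Z = {\<one>\<^bsub>Ext \<C> W Z\<^esub>}" if "\<And>A. A \<in> \<A> \<Longrightarrow> exts \<C> A Z = {\<one>\<^bsub>Ext \<C> A Z\<^esub>}"
    using Q.ext_vanishes_iso(1)[OF A(1,3,4)] that[OF A(2)] assms(3) by simp
  show "exts \<C> Z W = {\<one>\<^bsub>Ext \<C> Z W\<^esub>}" if "\<And>A. A \<in> \<A> \<Longrightarrow> exts \<C> Z A = {\<one>\<^bsub>Ext \<C> Z A\<^esub>}"
    using Q.ext_vanishes_iso(2)[OF A(1,3,4)] that[OF A(2)] assms(3) by simp
qed

lemma is_ideal_preimage: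
  assumes "is_ideal Q K"
  shows "is_ideal \<C> (\<lambda>A B. {f \<in> mor \<C> A B. \<pi> A B f \<in> K A B})"
  using assms unfolding is_ideal_def
  by (simp add: \<pi>_zero \<pi>_sum[symmetric] \<pi>_comp[symmetric])

lemma is_ideal_image:
  assumes "is_ideal \<C> K"
  shows "is_ideal Q (\<lambda>A B. \<pi> A B ` K A B)"
proof -
  have K: "K A B \<subseteq> mor \<C> A B" if "A \<in> Obj \<C>" "B \<in> Obj \<C>" for A B
    using assms that unfolding is_ideal_def by blast
  show ?thesis
    unfolding is_ideal_def
  proof (intro conjI ballI)
    fix A B assume AB: "A \<in> Obj Q" "B \<in> Obj Q"
    show "\<pi> A B ` K A B \<subseteq> mor Q A B" using K[of A B] AB by auto
    show "\<one>\<^bsub>Hom Q A B\<^esub> \<in> \<pi> A B ` K A B"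
      using assms AB \<pi>_zero[of A B] unfolding is_ideal_def by (metis Obj_Q imageI)
    fix f g assume "f \<in> \<pi> A B ` K A B" "g \<in> \<pi> A B ` K A B"
    then obtain f0 g0 where fg: "f0 \<in> K A B" "f = \<pi> A B f0" "g0 \<in> K A B" "g = \<pi> A B g0" by blast
    have "f0 \<otimes>\<^bsub>Hom \<C> A B\<^esub> g0 \<in> K A B"
      using fg assms AB unfolding is_ideal_def by simp
    moreover have "f0 \<in> mor \<C> A B" "g0 \<in> mor \<C> A B" using fg K[of A B] AB by auto
    ultimately show "f \<otimes>\<^bsub>Hom Q A B\<^esub> g \<in> \<pi> A B ` K A B"
      using AB fg by (simp add: \<pi>_sum)
  next
    fix A B C f g assume ABC: "A \<in> Obj Q" "B \<in> Obj Q" "C \<in> Obj Q"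
    show "Comp Q A B C g f \<in> \<pi> A C ` K A C" if fg: "f \<in> \<pi> A B ` K A B" "g \<in> mor Q B C"
    proof -
      obtain f0 g0 where 0: "f0 \<in> K A B" "f = \<pi> A B f0" "g0 \<in> mor \<C> B C" "g = \<pi> B C g0"
        using fg by (auto elim!: lift_mor)
      moreover have "f0 \<in> mor \<C> A B" using 0 ABC K[of A B] by auto
      moreover have "Comp \<C> A B C g0 f0 \<in> K A C" using 0 ABC assms unfolding is_ideal_def by simp
      ultimately show ?thesis using ABC by (simp add: \<pi>_comp)
    qed
    show "Comp Q A B C g f \<in> \<pi> A C ` K A C" if fg: "f \<in> mor Q A B" "g \<in> \<pi> B C ` K B C"
    proof -
      obtain f0 g0 where 0: "f0 \<in> mor \<C> A B" "f = \<pi> A B f0" "g0 \<in> K B C" "g = \<pi> B C g0"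
        using fg by (auto elim!: lift_mor)
      moreover have "g0 \<in> mor \<C> B C" using 0 ABC K[of B C] by auto
      moreover have "Comp \<C> A B C g0 f0 \<in> K A C" using 0 ABC assms unfolding is_ideal_def by simp
      ultimately show ?thesis using ABC by (simp add: \<pi>_comp)
    qed
  qed
qed

text \<open>Both inclusions hold because \<open>[add \<A>]\<close> is the smallest ideal that contains the identities of
  the objects in \<open>\<A>\<close>: compare the left-hand ideal with the preimage of the right-hand one, and the
  right-hand ideal with the image of the left-hand one.\<close>

lemma ideal_of_add_of_quotient:
  assumes X: "\<X> \<subseteq> Obj \<C>" and AB: "A \<in> Obj \<C>" "B \<in> Obj \<C>" and f: "f \<in> mor \<C> A B"
  shows "f \<in> ideal_of \<C> (add_of \<C> (\<X> \<union> \<Y>)) A B \<longleftrightarrow>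
    \<pi> A B f \<in> ideal_of Q (add_of Q (ess_image \<C> \<Y> \<X>)) A B"
proof
  let ?K = "ideal_of \<C> (add_of \<C> (\<X> \<union> \<Y>))" and ?L = "ideal_of Q (add_of Q (ess_image \<C> \<Y> \<X>))"
  have K: "is_ideal \<C> ?K" and L: "is_ideal Q ?L" using is_ideal_add_of Q.is_ideal_add_of by auto
  have ess: "ess_image \<C> \<Y> \<X> \<subseteq> Obj Q" unfolding ess_image_Q by auto
  have XY: "\<X> \<union> \<Y> \<subseteq> Obj \<C>" using X Y_sub by blast
  {
    assume "f \<in> ?K A B"
    moreover have "?K A B \<subseteq> {f \<in> mor \<C> A B. \<pi> A B f \<in> ?L A B}"
    proof (rule ideal_of_add_of_least[OF is_ideal_preimage[OF L] _ AB])
      fix W assume W: "W \<in> \<X> \<union> \<Y>"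
      then have W': "W \<in> Obj \<C>" using XY by blast
      have "\<pi> W W (Ident \<C> W) \<in> ?L W W"
      proof (cases "W \<in> \<Y>")
        case True
        then have "Ident \<C> W \<in> I W W" using W' Ident_in_ideal_of by blast
        then have "\<exists>k \<in> I W W. Ident \<C> W = \<one>\<^bsub>Hom \<C> W W\<^esub> \<otimes>\<^bsub>Hom \<C> W W\<^esub> k"
          using W' by (intro bexI[of _ "Ident \<C> W"]) simp_all
        then have "\<pi> W W (Ident \<C> W) = \<pi> W W \<one>\<^bsub>Hom \<C> W W\<^esub>"
          using \<pi>_eq_iff[OF W' W' ident_mor[OF W'] zero_mor[OF W' W']] by blast
        then have "\<pi> W W (Ident \<C> W) = \<one>\<^bsub>Hom Q W W\<^esub>" using \<pi>_zero[OF W' W'] by simp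
        then show ?thesis using L W' unfolding is_ideal_def by simp
      next
        case False
        then have "W \<in> add_of Q (ess_image \<C> \<Y> \<X>)"
          using W subset_ess_image[OF X] Q.subset_add_of[OF ess] by blast
        then show ?thesis using Q.Ident_in_ideal_of W' by (simp add: \<pi>_ident)
      qed
      then show "Ident \<C> W \<in> {f \<in> mor \<C> W W. \<pi> W W f \<in> ?L W W}" using W' by simp
    qed
    ultimately show "\<pi> A B f \<in> ?L A B" by blast
  }
  {
    assume "\<pi> A B f \<in> ?L A B"
    moreover have "?L A B \<subseteq> \<pi> A B ` ?K A B"
    proof (rule Q.ideal_of_add_of_least[OF is_ideal_image[OF K]])
      fix W assume "W \<in> ess_image \<C> \<Y> \<X>"
      then obtain X where X': "W \<in> Obj Q" "X \<in> \<X>" "isomorphic Q W X" unfolding ess_image_Q by auto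
      then have "X \<in> Obj \<C>" using X by blast
      moreover have "X \<in> add_of \<C> (\<X> \<union> \<Y>)" using X' subset_add_of[OF XY] by blast
      ultimately have "Ident Q X \<in> \<pi> X X ` ?K X X"
        using Ident_in_ideal_of by (simp add: \<pi>_ident[symmetric])
      then show "Ident Q W \<in> \<pi> W W ` ?K W W"
        using Q.ideal_iso[OF is_ideal_image[OF K] X'(1) _ X'(3)] \<open>X \<in> Obj \<C>\<close> by simp
    qed (use AB in simp_all)
    ultimately obtain g where g: "g \<in> ?K A B" "\<pi> A B f = \<pi> A B g" by blast
    then have "g \<in> mor \<C> A B" using K AB unfolding is_ideal_def by blast
    then obtain k where k: "k \<in> I A B" "f = g \<otimes>\<^bsub>Hom \<C> A B\<^esub> k"
      using g \<pi>_eq_iff[OF AB f] by blast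
    have "\<Y> \<subseteq> add_of \<C> (\<X> \<union> \<Y>)" using subset_add_of[OF XY] by blast
    then have "k \<in> ?K A B" using k unfolding ideal_of_def by blast
    then show "f \<in> ?K A B" unfolding k(2) using g K AB unfolding is_ideal_def by blast
  }
qed

end


section \<open>Comparison of the two quotients\<close>

text \<open>The class \<open>\<N>\<close> stands for \<open>\<X>\<^sup>\<bottom>\<close>.  The equality of the two orthogonals of \<open>\<X>\<close> provides both
  properties that the comparison uses: as a left orthogonal class, \<open>\<N>\<close> is given by the vanishing of
  \<open>\<E>(-, Z)\<close> for \<open>Z\<close> among the iterated cosyzygies \<open>\<Z>\<close> of objects of \<open>\<X>\<close>, and from the first extension
  groups on either side the objects of \<open>\<X>\<close> are projective and injective in \<open>\<N>\<close>.\<close>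

locale iterated_quotient = extriangulated_category \<C>
  for \<C> :: "('o, 'm, 'e) extcat" +
  fixes J \<X> \<N> \<Z> :: "'o set"
  assumes J_sub: "J \<subseteq> Obj \<C>" and J_free: "free_of \<C> J = J"
    and J_proj: "\<lbrakk>Y \<in> J; A \<in> Obj \<C>\<rbrakk> \<Longrightarrow> exts \<C> Y A = {\<one>\<^bsub>Ext \<C> Y A\<^esub>}"
    and J_inj: "\<lbrakk>Y \<in> J; C \<in> Obj \<C>\<rbrakk> \<Longrightarrow> exts \<C> C Y = {\<one>\<^bsub>Ext \<C> C Y\<^esub>}"
    and Z_sub: "\<Z> \<subseteq> Obj \<C>"
    and N_eq: "\<N> = {N \<in> Obj \<C>. \<forall>Z \<in> \<Z>. exts \<C> N Z = {\<one>\<^bsub>Ext \<C> N Z\<^esub>}}"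
    and X_sub: "\<X> \<subseteq> \<N>"
    and X_proj: "\<lbrakk>X \<in> \<X>; A \<in> \<N>\<rbrakk> \<Longrightarrow> exts \<C> X A = {\<one>\<^bsub>Ext \<C> X A\<^esub>}"
    and X_inj: "\<lbrakk>X \<in> \<X>; C \<in> \<N>\<rbrakk> \<Longrightarrow> exts \<C> C X = {\<one>\<^bsub>Ext \<C> C X\<^esub>}"
begin

abbreviation \<C>\<^sub>J :: "('o, 'm set, 'e) extcat" where
  "\<C>\<^sub>J \<equiv> quot_extcat \<C> J"

abbreviation \<X>\<^sub>J :: "'o set" where
  "\<X>\<^sub>J \<equiv> ess_image \<C> J \<X>"

lemma N_sub: "\<N> \<subseteq> Obj \<C>" and ND: "A \<in> \<N> \<Longrightarrow> A \<in> Obj \<C>"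
  using N_eq by auto

lemma X_sub_Obj: "\<X> \<subseteq> Obj \<C>" and XJ_sub_Obj: "\<X> \<union> J \<subseteq> Obj \<C>"
  using X_sub N_sub J_sub by auto

lemma J_sub_N: "J \<subseteq> \<N>"
  using J_sub J_proj Z_sub unfolding N_eq by blast

lemma extension_closed_N: "extension_closed \<C> \<N>"
proof (intro extension_closed.intro extension_closed_axioms.intro)
  show "extriangulated_category \<C>" ..
  note N = extension_closed_left_orthogonal[OF Z_sub N_eq]
  show "\<N> \<subseteq> Obj \<C>" by (rule N(1))
  show "\<exists>Z \<in> \<N>. is_zero_object \<C> Z" using zero_object N(2) by blast
  show "B \<in> \<N>" if "triangle \<C> A B C x y \<delta>" "A \<in> \<N>" "C \<in> \<N>" for A B C x y \<delta>
    using N(3) that by blast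
qed

lemma add_of_sub_N: "add_of \<C> (\<X> \<union> J) \<subseteq> \<N>"
proof
  fix W assume W: "W \<in> add_of \<C> (\<X> \<union> J)"
  then have "W \<in> Obj \<C>" using add_of_subset_Obj by blast
  moreover have "exts \<C> W Z = {\<one>\<^bsub>Ext \<C> W Z\<^esub>}" if Z: "Z \<in> \<Z>" for Z
  proof (rule ext_vanishes_add_of(1)[OF XJ_sub_Obj W])
    show "Z \<in> Obj \<C>" using Z Z_sub by blast
    show "exts \<C> A Z = {\<one>\<^bsub>Ext \<C> A Z\<^esub>}" if "A \<in> \<X> \<union> J" for A
      using that Z X_sub J_sub_N unfolding N_eq by blast
  qed
  ultimately show "W \<in> \<N>" unfolding N_eq by blast
qed

lemma quotient_N: "proj_inj_quotient (full_subcat \<C> \<N>) (add_of \<C> (\<X> \<union> J))"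
proof (intro proj_inj_quotient.intro proj_inj_quotient_axioms.intro)
  interpret N: extension_closed \<C> \<N> by (rule extension_closed_N)
  show "extriangulated_category (full_subcat \<C> \<N>)" by (rule N.extriangulated_full_subcat)
  show "add_of \<C> (\<X> \<union> J) \<subseteq> Obj (full_subcat \<C> \<N>)" using add_of_sub_N by simp
  show "is_ideal (full_subcat \<C> \<N>) (ideal_of (full_subcat \<C> \<N>) (add_of \<C> (\<X> \<union> J)))"
    using is_ideal_full_subcat[OF is_ideal_add_of N_sub] by simp
  fix Y A assume Y: "Y \<in> add_of \<C> (\<X> \<union> J)" and A: "A \<in> Obj (full_subcat \<C> \<N>)"
  have "exts \<C> W A = {\<one>\<^bsub>Ext \<C> W A\<^esub>}" "exts \<C> A W = {\<one>\<^bsub>Ext \<C> A W\<^esub>}" if "W \<in> \<X> \<union> J" for W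
    using that A X_proj X_inj J_proj J_inj ND by auto
  then have "exts \<C> Y A = {\<one>\<^bsub>Ext \<C> Y A\<^esub>}" "exts \<C> A Y = {\<one>\<^bsub>Ext \<C> A Y\<^esub>}"
    using ext_vanishes_add_of[OF XJ_sub_Obj Y] A ND by auto
  then show "exts (full_subcat \<C> \<N>) Y A = {\<one>\<^bsub>Ext (full_subcat \<C> \<N>) Y A\<^esub>}"
    "exts (full_subcat \<C> \<N>) A Y = {\<one>\<^bsub>Ext (full_subcat \<C> \<N>) A Y\<^esub>}" by simp_all
qed

lemma quotient_J: "proj_inj_quotient \<C> J"
proof (intro proj_inj_quotient.intro proj_inj_quotient_axioms.intro)
  show "extriangulated_category \<C>" ..
  show "is_ideal \<C> (ideal_of \<C> J)" using is_ideal_free_of[of J] unfolding J_free .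
qed (fact J_sub J_proj J_inj)+

interpretation J: proj_inj_quotient \<C> J
  by (rule quotient_J)

interpretation CJ: extriangulated_category \<C>\<^sub>J
  by (rule J.extriangulated_quotient)

text \<open>\<open>\<N>\<close> is defined by the vanishing of extension groups, which are the same in \<open>\<C>\<^sub>J\<close>.  So it is
  closed under the isomorphisms of \<open>\<C>\<^sub>J\<close>.\<close>

lemma ess_image_N: "ess_image \<C> J \<N> = \<N>"
proof
  show "\<N> \<subseteq> ess_image \<C> J \<N>" by (rule J.subset_ess_image[OF N_sub])
  show "ess_image \<C> J \<N> \<subseteq> \<N>"
  proof
    fix W assume W: "W \<in> ess_image \<C> J \<N>"
    then have "W \<in> Obj \<C>" unfolding J.ess_image_Q by blast
    moreover have "exts \<C> W Z = {\<one>\<^bsub>Ext \<C> W Z\<^esub>}" if "Z \<in> \<Z>" for Z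
      by (rule J.ext_vanishes_ess_image(1)[OF N_sub W]) (use that Z_sub N_eq in auto)
    ultimately show "W \<in> \<N>" unfolding N_eq by blast
  qed
qed

lemma extension_closed_NJ: "extension_closed \<C>\<^sub>J \<N>"
proof (intro extension_closed.intro extension_closed_axioms.intro)
  show "extriangulated_category \<C>\<^sub>J" ..
  note N = extension_closed_left_orthogonal[OF Z_sub N_eq]
  show "\<N> \<subseteq> Obj \<C>\<^sub>J" using N_sub by simp
  obtain Z where Z: "is_zero_object \<C>\<^sub>J Z" using CJ.zero_object by blast
  then have "Z \<in> Obj \<C>" unfolding is_zero_object_def by simp
  moreover have "exts \<C> Z Z' = {\<one>\<^bsub>Ext \<C> Z Z'\<^esub>}" if "Z' \<in> \<Z>" for Z'
    using CJ.ext_vanishes_zero_object[OF Z, of Z'] that Z_sub by auto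
  ultimately have "Z \<in> \<N>" unfolding N_eq by blast
  with Z show "\<exists>Z \<in> \<N>. is_zero_object \<C>\<^sub>J Z" by blast
  fix A B C x y \<delta> assume t: "triangle \<C>\<^sub>J A B C x y \<delta>" and AC: "A \<in> \<N>" "C \<in> \<N>"
  obtain B0 x0 y0 \<beta> \<beta>' where t0: "triangle \<C> A B0 C x0 y0 \<delta>" and B: "B \<in> Obj \<C>"
    and \<beta>: "\<beta> \<in> mor \<C>\<^sub>J B0 B" "\<beta>' \<in> mor \<C>\<^sub>J B B0" "Comp \<C>\<^sub>J B0 B B0 \<beta>' \<beta> = Ident \<C>\<^sub>J B0"
      "Comp \<C>\<^sub>J B B0 B \<beta> \<beta>' = Ident \<C>\<^sub>J B"
    by (rule J.triangle_QE[OF t])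
  have "B0 \<in> \<N>" using N(3) t0 AC by blast
  moreover have "isomorphic \<C>\<^sub>J B B0" using \<beta> unfolding isomorphic_def is_iso_def by blast
  ultimately have "B \<in> ess_image \<C> J \<N>" using B unfolding J.ess_image_Q by blast
  then show "B \<in> \<N>" by (simp add: ess_image_N)
qed

lemma XJ_sub: "\<X>\<^sub>J \<subseteq> \<N>"
proof -
  have "\<X>\<^sub>J \<subseteq> ess_image \<C> J \<N>" using X_sub unfolding J.ess_image_Q by blast
  then show ?thesis by (simp add: ess_image_N)
qed

lemma quotient_NJ: "proj_inj_quotient (full_subcat \<C>\<^sub>J \<N>) (add_of \<C>\<^sub>J \<X>\<^sub>J)"
proof (intro proj_inj_quotient.intro proj_inj_quotient_axioms.intro)
  interpret N: extension_closed \<C>\<^sub>J \<N> by (rule extension_closed_NJ)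
  show "extriangulated_category (full_subcat \<C>\<^sub>J \<N>)" by (rule N.extriangulated_full_subcat)
  have XJ: "\<X>\<^sub>J \<subseteq> Obj \<C>\<^sub>J" using XJ_sub N_sub by simp
  have "W \<in> \<N>" if W: "W \<in> add_of \<C>\<^sub>J \<X>\<^sub>J" for W
  proof -
    have "W \<in> Obj \<C>" using W CJ.add_of_subset_Obj by auto
    moreover have "exts \<C> W Z = {\<one>\<^bsub>Ext \<C> W Z\<^esub>}" if Z: "Z \<in> \<Z>" for Z
      using CJ.ext_vanishes_add_of(1)[OF XJ W, of Z] Z Z_sub XJ_sub N_eq by auto
    ultimately show ?thesis unfolding N_eq by blast
  qed
  then show "add_of \<C>\<^sub>J \<X>\<^sub>J \<subseteq> Obj (full_subcat \<C>\<^sub>J \<N>)" by auto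
  show "is_ideal (full_subcat \<C>\<^sub>J \<N>) (ideal_of (full_subcat \<C>\<^sub>J \<N>) (add_of \<C>\<^sub>J \<X>\<^sub>J))"
    using is_ideal_full_subcat[OF CJ.is_ideal_add_of N.sub] by simp
  fix Y A assume Y: "Y \<in> add_of \<C>\<^sub>J \<X>\<^sub>J" and A: "A \<in> Obj (full_subcat \<C>\<^sub>J \<N>)"
  then have A': "A \<in> \<N>" "A \<in> Obj \<C>" using ND by auto
  have "exts \<C> W A = {\<one>\<^bsub>Ext \<C> W A\<^esub>}" "exts \<C> A W = {\<one>\<^bsub>Ext \<C> A W\<^esub>}" if W: "W \<in> \<X>\<^sub>J" for W
    using J.ext_vanishes_ess_image[OF X_sub_Obj W A'(2)] X_proj X_inj A'(1) by auto
  then have "exts \<C> Y A = {\<one>\<^bsub>Ext \<C> Y A\<^esub>}" "exts \<C> A Y = {\<one>\<^bsub>Ext \<C> A Y\<^esub>}"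
    using CJ.ext_vanishes_add_of[OF XJ Y, of A] A' by auto
  then show "exts (full_subcat \<C>\<^sub>J \<N>) Y A = {\<one>\<^bsub>Ext (full_subcat \<C>\<^sub>J \<N>) Y A\<^esub>}"
    "exts (full_subcat \<C>\<^sub>J \<N>) A Y = {\<one>\<^bsub>Ext (full_subcat \<C>\<^sub>J \<N>) A Y\<^esub>}" by simp_all
qed

interpretation S: proj_inj_quotient "full_subcat \<C> \<N>" "add_of \<C> (\<X> \<union> J)"
  by (rule quotient_N)

interpretation T: proj_inj_quotient "full_subcat \<C>\<^sub>J \<N>" "add_of \<C>\<^sub>J \<X>\<^sub>J"
  by (rule quotient_NJ)

interpretation SQ: extriangulated_category S.Q
  by (rule S.extriangulated_quotient)

interpretation TQ: extriangulated_category T.Q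
  by (rule T.extriangulated_quotient)

text \<open>Morphisms of the iterated quotient are classes of classes.  All computations with them go through
  their representatives in \<open>\<C>\<close>, by means of the composite \<open>\<Phi>\<close> of the two projections.\<close>

definition \<Phi> :: "'o \<Rightarrow> 'o \<Rightarrow> 'm \<Rightarrow> 'm set set" where
  "\<Phi> A B f = T.\<pi> A B (J.\<pi> A B f)"

lemma \<Phi>_mor: "f \<in> mor \<C> A B \<Longrightarrow> \<Phi> A B f \<in> mor T.Q A B"
  unfolding \<Phi>_def by (rule T.\<pi>_mor) simp

lemma \<Phi>_lift:
  assumes "g \<in> mor T.Q A B"
  obtains f where "f \<in> mor \<C> A B" "g = \<Phi> A B f"
proof -
  obtain h where "h \<in> mor (full_subcat \<C>\<^sub>J \<N>) A B" "g = T.\<pi> A B h" using assms by (rule T.lift_mor)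
  then obtain f where "f \<in> mor \<C> A B" "h = J.\<pi> A B f" using J.lift_mor[of h A B] by auto
  with \<open>g = T.\<pi> A B h\<close> that show ?thesis unfolding \<Phi>_def by blast
qed

lemma \<Phi>_comp:
  assumes "A \<in> \<N>" "B \<in> \<N>" "C \<in> \<N>" "f \<in> mor \<C> A B" "g \<in> mor \<C> B C"
  shows "Comp T.Q A B C (\<Phi> B C g) (\<Phi> A B f) = \<Phi> A C (Comp \<C> A B C g f)"
  unfolding \<Phi>_def using assms T.\<pi>_comp[of A B C "J.\<pi> A B f" "J.\<pi> B C g"] by (simp add: J.\<pi>_comp ND)

lemma \<Phi>_ident: "\<Phi> A A (Ident \<C> A) = Ident T.Q A"
  unfolding \<Phi>_def J.\<pi>_ident using T.\<pi>_ident by simp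

lemma \<Phi>_sum:
  assumes "A \<in> \<N>" "B \<in> \<N>" "f \<in> mor \<C> A B" "g \<in> mor \<C> A B"
  shows "\<Phi> A B f \<otimes>\<^bsub>Hom T.Q A B\<^esub> \<Phi> A B g = \<Phi> A B (f \<otimes>\<^bsub>Hom \<C> A B\<^esub> g)"
  unfolding \<Phi>_def using assms T.\<pi>_sum[of A B "J.\<pi> A B f" "J.\<pi> A B g"] by (simp add: J.\<pi>_sum ND)

lemma \<Phi>_emap:
  assumes "C' \<in> \<N>" "C \<in> \<N>" "A \<in> \<N>" "A' \<in> \<N>" "c \<in> mor \<C> C' C" "a \<in> mor \<C> A A'" "\<delta> \<in> exts \<C> C A"
  shows "Emap T.Q C' C A A' (\<Phi> C' C c) (\<Phi> A A' a) \<delta> = Emap \<C> C' C A A' c a \<delta>"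
  unfolding \<Phi>_def using assms T.emap_\<pi>[of C' C A A' "J.\<pi> C' C c" "J.\<pi> A A' a" \<delta>]
  by (simp add: J.emap_\<pi> ND)

text \<open>The third isomorphism theorem.  The error through \<open>J\<close> that arises when a morphism of \<open>\<C>\<^sub>J\<close> is lifted
  to \<open>\<C>\<close> is harmless, because \<open>[J]\<close> is contained in \<open>[add(\<X> \<union> J)]\<close>.\<close>

lemma \<Phi>_eq_iff:
  assumes AB: "A \<in> \<N>" "B \<in> \<N>" and f: "f \<in> mor \<C> A B" and g: "g \<in> mor \<C> A B"
  shows "\<Phi> A B f = \<Phi> A B g \<longleftrightarrow> S.\<pi> A B f = S.\<pi> A B g"
proof -
  note [simp] = ND[OF AB(1)] ND[OF AB(2)] f g
  interpret H: comm_group "Hom \<C> A B" by (simp add: hom_group)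
  let ?K = "ideal_of \<C> (add_of \<C> (\<X> \<union> J)) A B" and ?L = "ideal_of \<C>\<^sub>J (add_of \<C>\<^sub>J \<X>\<^sub>J) A B"
  note ideals = J.ideal_of_add_of_quotient[OF X_sub_Obj ND[OF AB(1)] ND[OF AB(2)]]
  have K: "subgroup ?K (Hom \<C> A B)" using ideal_subgroup[OF is_ideal_add_of] by simp
  have J: "ideal_of \<C> J A B \<subseteq> ?K"
    using subset_add_of[OF XJ_sub_Obj] unfolding ideal_of_def by blast
  have S: "S.\<pi> A B f = S.\<pi> A B g \<longleftrightarrow> (\<exists>k \<in> ?K. f = g \<otimes>\<^bsub>Hom \<C> A B\<^esub> k)"
    using S.\<pi>_eq_iff[of A B f g] AB by simp
  have T: "\<Phi> A B f = \<Phi> A B g \<longleftrightarrow> (\<exists>k \<in> ?L. J.\<pi> A B f = J.\<pi> A B g \<otimes>\<^bsub>Hom \<C>\<^sub>J A B\<^esub> k)"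
    unfolding \<Phi>_def using T.\<pi>_eq_iff[of A B "J.\<pi> A B f" "J.\<pi> A B g"] AB by simp
  show ?thesis
  proof
    assume "S.\<pi> A B f = S.\<pi> A B g"
    then obtain k where k: "k \<in> ?K" "f = g \<otimes>\<^bsub>Hom \<C> A B\<^esub> k" using S by blast
    then have k': "k \<in> mor \<C> A B" using subgroup.subset[OF K] by blast
    then have "J.\<pi> A B k \<in> ?L" using ideals k(1) by blast
    moreover have "J.\<pi> A B f = J.\<pi> A B g \<otimes>\<^bsub>Hom \<C>\<^sub>J A B\<^esub> J.\<pi> A B k"
      unfolding k(2) using k' by (simp add: J.\<pi>_sum)
    ultimately show "\<Phi> A B f = \<Phi> A B g" using T by blast
  next
    assume "\<Phi> A B f = \<Phi> A B g"
    then obtain l where l: "l \<in> ?L" "J.\<pi> A B f = J.\<pi> A B g \<otimes>\<^bsub>Hom \<C>\<^sub>J A B\<^esub> l" using T by blast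
    have "l \<in> mor \<C>\<^sub>J A B" 
      using subgroup.subset[OF CJ.ideal_subgroup[OF CJ.is_ideal_add_of, of A B]] l(1) by auto
    then obtain k where k: "k \<in> mor \<C> A B" "l = J.\<pi> A B k" by (rule J.lift_mor)
    then have "k \<in> ?K" using ideals l(1) by blast
    moreover have "J.\<pi> A B f = J.\<pi> A B (g \<otimes>\<^bsub>Hom \<C> A B\<^esub> k)" using l(2) k by (simp add: J.\<pi>_sum)
    then obtain m where m: "m \<in> ideal_of \<C> J A B" "f = (g \<otimes>\<^bsub>Hom \<C> A B\<^esub> k) \<otimes>\<^bsub>Hom \<C> A B\<^esub> m"
      using J.\<pi>_eq_iff[of A B f "g \<otimes>\<^bsub>Hom \<C> A B\<^esub> k"] k(1) by auto
    ultimately have "k \<otimes>\<^bsub>Hom \<C> A B\<^esub> m \<in> ?K" using J subgroup.m_closed[OF K] by blast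
    moreover have "m \<in> mor \<C> A B" using J m subgroup.subset[OF K] by blast
    then have "f = g \<otimes>\<^bsub>Hom \<C> A B\<^esub> (k \<otimes>\<^bsub>Hom \<C> A B\<^esub> m)" using m k by (simp add: H.m_assoc)
    ultimately show "S.\<pi> A B f = S.\<pi> A B g" using S by blast
  qed
qed

definition G :: "'o \<Rightarrow> 'o \<Rightarrow> 'm set \<Rightarrow> 'm set set" where
  "G A B f = \<Phi> A B (repr f)"

definition G' :: "'o \<Rightarrow> 'o \<Rightarrow> 'm set set \<Rightarrow> 'm set" where
  "G' A B g = S.\<pi> A B (SOME f. f \<in> mor \<C> A B \<and> \<Phi> A B f = g)"

lemma lift_S:
  assumes "f \<in> mor S.Q A B"
  obtains f0 where "f0 \<in> mor \<C> A B" "f = S.\<pi> A B f0"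
  using S.lift_mor[OF assms] by auto

lemma G_\<pi>:
  assumes "A \<in> \<N>" "B \<in> \<N>" "f \<in> mor \<C> A B"
  shows "G A B (S.\<pi> A B f) = \<Phi> A B f"
  unfolding G_def using assms S.repr_\<pi>[of A B f] \<Phi>_eq_iff[of A B "repr (S.\<pi> A B f)" f] by simp

lemma G'_\<Phi>:
  assumes "A \<in> \<N>" "B \<in> \<N>" "f \<in> mor \<C> A B"
  shows "G' A B (\<Phi> A B f) = S.\<pi> A B f"
proof -
  define h where "h = (SOME h. h \<in> mor \<C> A B \<and> \<Phi> A B h = \<Phi> A B f)"
  have "h \<in> mor \<C> A B \<and> \<Phi> A B h = \<Phi> A B f" unfolding h_def by (rule someI) (use assms in simp)
  then show ?thesis unfolding G'_def h_def[symmetric] using \<Phi>_eq_iff[of A B h f] assms by simp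
qed

lemma S_\<pi>_mor: "f \<in> mor \<C> A B \<Longrightarrow> S.\<pi> A B f \<in> mor S.Q A B"
  by (rule S.\<pi>_mor) simp

lemma S_\<pi>_comp:
  assumes "A \<in> \<N>" "B \<in> \<N>" "C \<in> \<N>" "f \<in> mor \<C> A B" "g \<in> mor \<C> B C"
  shows "Comp S.Q A B C (S.\<pi> B C g) (S.\<pi> A B f) = S.\<pi> A C (Comp \<C> A B C g f)"
  using S.\<pi>_comp[of A B C f g] assms by simp

lemma S_\<pi>_ident: "S.\<pi> A A (Ident \<C> A) = Ident S.Q A"
  using S.\<pi>_ident[of A] by simp

lemma G_functor: "is_functor S.Q T.Q (\<lambda>A. A) G"
  unfolding is_functor_def
proof (intro conjI ballI)
  fix A assume "A \<in> Obj S.Q"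
  then have A: "A \<in> \<N>" by simp
  show "A \<in> Obj T.Q" using A by simp
  show "G A A (Ident S.Q A) = Ident T.Q A"
    using G_\<pi>[OF A A, of "Ident \<C> A"] A ND by (simp add: S_\<pi>_ident \<Phi>_ident)
  fix B assume "B \<in> Obj S.Q"
  then have B: "B \<in> \<N>" by simp
  fix f assume f: "f \<in> mor S.Q A B"
  show "G A B f \<in> mor T.Q A B" by (rule lift_S[OF f]) (simp add: G_\<pi> A B \<Phi>_mor)
  fix C g assume "C \<in> Obj S.Q" and g: "g \<in> mor S.Q B C"
  then have C: "C \<in> \<N>" by simp
  obtain f0 g0 where "f0 \<in> mor \<C> A B" "f = S.\<pi> A B f0" "g0 \<in> mor \<C> B C" "g = S.\<pi> B C g0"
    using f g lift_S by metis
  then show "G A C (Comp S.Q A B C g f) = Comp T.Q A B C (G B C g) (G A B f)"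
    using A B C ND by (simp add: S_\<pi>_comp G_\<pi> \<Phi>_comp)
qed

lemma G'_functor: "is_functor T.Q S.Q (\<lambda>A. A) G'"
  unfolding is_functor_def
proof (intro conjI ballI)
  fix A assume "A \<in> Obj T.Q"
  then have A: "A \<in> \<N>" by simp
  show "A \<in> Obj S.Q" using A by simp
  show "G' A A (Ident T.Q A) = Ident S.Q A"
    using G'_\<Phi>[OF A A, of "Ident \<C> A"] A ND by (simp add: S_\<pi>_ident \<Phi>_ident)
  fix B assume "B \<in> Obj T.Q"
  then have B: "B \<in> \<N>" by simp
  fix f assume f: "f \<in> mor T.Q A B"
  show "G' A B f \<in> mor S.Q A B" by (rule \<Phi>_lift[OF f]) (simp add: G'_\<Phi> A B S_\<pi>_mor)
  fix C g assume "C \<in> Obj T.Q" and g: "g \<in> mor T.Q B C"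
  then have C: "C \<in> \<N>" by simp
  obtain f0 g0 where "f0 \<in> mor \<C> A B" "f = \<Phi> A B f0" "g0 \<in> mor \<C> B C" "g = \<Phi> B C g0"
    using f g \<Phi>_lift by metis
  then show "G' A C (Comp T.Q A B C g f) = Comp S.Q A B C (G' B C g) (G' A B f)"
    using A B C ND by (simp add: S_\<pi>_comp G'_\<Phi> \<Phi>_comp)
qed

lemma G_category_equivalence: "is_category_equivalence S.Q T.Q (\<lambda>A. A) G"
  unfolding is_category_equivalence_def
proof (intro conjI exI)
  show "is_functor S.Q T.Q (\<lambda>A. A) G" by (rule G_functor)
  show "is_functor T.Q S.Q (\<lambda>A. A) G'" by (rule G'_functor)
  have "G' A B (G A B f) = f" if "A \<in> Obj S.Q" "B \<in> Obj S.Q" "f \<in> mor S.Q A B" for A B f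
    by (rule lift_S[OF that(3)]) (use that in \<open>simp add: G_\<pi> G'_\<Phi>\<close>)
  then show "is_natural_iso S.Q S.Q (\<lambda>A. A) (\<lambda>A B f. f) (\<lambda>A. A) (\<lambda>A B f. G' A B (G A B f)) (Ident S.Q)"
    unfolding is_natural_iso_def using SQ.is_iso_ident by simp
  have "G A B (G' A B f) = f" if "A \<in> Obj T.Q" "B \<in> Obj T.Q" "f \<in> mor T.Q A B" for A B f
    by (rule \<Phi>_lift[OF that(3)]) (use that in \<open>simp add: G_\<pi> G'_\<Phi>\<close>)
  then show "is_natural_iso T.Q T.Q (\<lambda>M. M) (\<lambda>M N g. G M N (G' M N g)) (\<lambda>M. M) (\<lambda>M N g. g) (Ident T.Q)"
    unfolding is_natural_iso_def using TQ.is_iso_ident by simp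
qed

lemma G_triangle:
  assumes t: "triangle S.Q A B C X Y \<delta>"
  shows "triangle T.Q A B C (G A B X) (G B C Y) \<delta>"
proof -
  obtain B0 x y \<beta> \<beta>' where t0: "triangle (full_subcat \<C> \<N>) A B0 C x y \<delta>" and "B \<in> Obj (full_subcat \<C> \<N>)"
    and \<beta>: "\<beta> \<in> mor S.Q B0 B" "\<beta>' \<in> mor S.Q B B0" "Comp S.Q B0 B B0 \<beta>' \<beta> = Ident S.Q B0"
      "Comp S.Q B B0 B \<beta> \<beta>' = Ident S.Q B"
    and X: "X = Comp S.Q A B0 B \<beta> (S.\<pi> A B0 x)" and Y: "Y = Comp S.Q B B0 C (S.\<pi> B0 C y) \<beta>'"
    by (rule S.triangle_QE[OF t])
  have t1: "triangle \<C> A B0 C x y \<delta>" and N: "A \<in> \<N>" "B0 \<in> \<N>" "C \<in> \<N>" "B \<in> \<N>"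
    using t0 \<open>B \<in> Obj (full_subcat \<C> \<N>)\<close> unfolding triangle_full_subcat[OF N_sub] by auto
  note [simp] = triangle_typed[OF t1] N ND[OF N(4)]
  have F: "G A' C' (Comp S.Q A' B' C' g f) = Comp T.Q A' B' C' (G B' C' g) (G A' B' f)"
    "G A' B' f \<in> mor T.Q A' B'" "G A' A' (Ident S.Q A') = Ident T.Q A'"
    if "A' \<in> \<N>" "B' \<in> \<N>" "C' \<in> \<N>" "f \<in> mor S.Q A' B'" "g \<in> mor S.Q B' C'" for A' B' C' f g
    using G_functor that unfolding is_functor_def by simp_all
  have \<pi>: "S.\<pi> A B0 x \<in> mor S.Q A B0" "S.\<pi> B0 C y \<in> mor S.Q B0 C" by (simp_all add: S_\<pi>_mor)
  have X': "G A B X = Comp T.Q A B0 B (G B0 B \<beta>) (\<Phi> A B0 x)"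
    unfolding X by (subst F(1)) (use \<beta> \<pi> in \<open>simp_all add: G_\<pi>\<close>)
  have Y': "G B C Y = Comp T.Q B B0 C (\<Phi> B0 C y) (G B B0 \<beta>')"
    unfolding Y by (subst F(1)) (use \<beta> \<pi> in \<open>simp_all add: G_\<pi>\<close>)
  have i: "G B0 B \<beta> \<in> mor T.Q B0 B" "G B B0 \<beta>' \<in> mor T.Q B B0"
    "Comp T.Q B0 B B0 (G B B0 \<beta>') (G B0 B \<beta>) = Ident T.Q B0"
    "Comp T.Q B B0 B (G B0 B \<beta>) (G B B0 \<beta>') = Ident T.Q B"
    using F[of B0 B B0 \<beta> \<beta>'] F[of B B0 B \<beta>' \<beta>] \<beta> by simp_all
  have "triangle (full_subcat \<C>\<^sub>J \<N>) A B0 C (J.\<pi> A B0 x) (J.\<pi> B0 C y) \<delta>"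
    using J.triangle_\<pi>[OF t1] N_sub by (simp add: triangle_full_subcat)
  then show ?thesis
  proof (rule T.triangle_QI)
    show "is_iso T.Q B0 B (G B0 B \<beta>)" using i unfolding is_iso_def by blast
    show "Comp T.Q A B0 B (G B0 B \<beta>) (T.\<pi> A B0 (J.\<pi> A B0 x)) = G A B X"
      unfolding X' \<Phi>_def ..
    show "G B C Y \<in> mor T.Q B C" unfolding Y' using i by (simp add: \<Phi>_mor)
    show "Comp T.Q B0 B C (G B C Y) (G B0 B \<beta>) = T.\<pi> B0 C (J.\<pi> B0 C y)"
      unfolding Y' \<Phi>_def[symmetric] by (rule TQ.comp_cancel_right) (use i in \<open>simp_all add: \<Phi>_mor\<close>)
  qed simp
qed

theorem G_equivalence: "is_extriangulated_equivalence S.Q T.Q (\<lambda>A. A) G (\<lambda>C A \<delta>. \<delta>)"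
  unfolding is_extriangulated_equivalence_def is_exact_functor_def is_additive_functor_def
proof (intro conjI ballI allI impI)
  show "extriangulated_category S.Q" "extriangulated_category T.Q" ..
  show "is_functor S.Q T.Q (\<lambda>A. A) G" by (rule G_functor)
  show "is_category_equivalence S.Q T.Q (\<lambda>A. A) G" by (rule G_category_equivalence)
  show "triangle T.Q A B C (G A B x) (G B C y) \<delta>" if "triangle S.Q A B C x y \<delta>" for A B C x y \<delta>
    using that by (rule G_triangle)
  show "G A B \<in> hom (Hom S.Q A B) (Hom T.Q A B)" if AB: "A \<in> Obj S.Q" "B \<in> Obj S.Q" for A B
  proof (rule homI)
    show "G A B f \<in> mor T.Q A B" if "f \<in> mor S.Q A B" for f
      using G_functor AB that unfolding is_functor_def by simp
    fix f g assume fg: "f \<in> mor S.Q A B" "g \<in> mor S.Q A B"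
    obtain f0 g0 where 0: "f0 \<in> mor \<C> A B" "f = S.\<pi> A B f0" "g0 \<in> mor \<C> A B" "g = S.\<pi> A B g0"
      using fg lift_S by metis
    have "f \<otimes>\<^bsub>Hom S.Q A B\<^esub> g = S.\<pi> A B (f0 \<otimes>\<^bsub>Hom \<C> A B\<^esub> g0)"
      using S.\<pi>_sum[of A B f0 g0] AB 0 by simp
    then show "G A B (f \<otimes>\<^bsub>Hom S.Q A B\<^esub> g) = G A B f \<otimes>\<^bsub>Hom T.Q A B\<^esub> G A B g"
      using AB 0 ND by (simp add: G_\<pi> \<Phi>_sum)
  qed
  show "(\<lambda>\<delta>. \<delta>) \<in> hom (Ext S.Q C A) (Ext T.Q C A)" "(\<lambda>\<delta>. \<delta>) \<in> iso (Ext S.Q C A) (Ext T.Q C A)" for C A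
    by (simp_all add: hom_def iso_def bij_betw_def inj_on_def)
  fix C' C A A' c a \<delta>
  assume obj: "C' \<in> Obj S.Q" "C \<in> Obj S.Q" "A \<in> Obj S.Q" "A' \<in> Obj S.Q"
    and ca: "c \<in> mor S.Q C' C" "a \<in> mor S.Q A A'" and \<delta>: "\<delta> \<in> exts S.Q C A"
  obtain c0 a0 where 0: "c0 \<in> mor \<C> C' C" "c = S.\<pi> C' C c0" "a0 \<in> mor \<C> A A'" "a = S.\<pi> A A' a0"
    using ca lift_S by metis
  have "Emap S.Q C' C A A' c a \<delta> = Emap \<C> C' C A A' c0 a0 \<delta>"
    using S.emap_\<pi>[of C' C A A' c0 a0 \<delta>] 0 obj \<delta> by simp
  then show "Emap S.Q C' C A A' c a \<delta> = Emap T.Q C' C A A' (G C' C c) (G A A' a) \<delta>"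
    using 0 obj \<delta> by (simp add: G_\<pi> \<Phi>_emap)
qed

end

theorem theorem2p9:
  fixes \<C> :: "('o, 'm, 'e) extcat" and J \<X> :: "'o set" and n :: nat
  assumes "extriangulated_category \<C>"
    and "enough_projectives \<C>"
    and "enough_injectives \<C>"
    and "J \<subseteq> Obj \<C>"
    and "free_of \<C> J = J"
    and "J \<subseteq> projectives \<C> \<inter> injectives \<C>"
    and "n \<ge> 1"
    and "\<X> \<subseteq> Obj \<C>"
    and "free_of \<C> \<X> = \<X>"
    and "rigid \<C> (n + 2) \<X>"
    and "right_perp \<C> (n + 1) \<X> = left_perp \<C> (n + 1) \<X>"
  shows "\<exists>Go Gm \<phi>. is_extriangulated_equivalence
    (quot_extcat (full_subcat \<C> (right_perp \<C> (n + 1) \<X>)) (add_of \<C> (\<X> \<union> J)))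
    (quot_extcat (full_subcat (quot_extcat \<C> J) (ess_image \<C> J (right_perp \<C> (n + 1) \<X>)))
                 (add_of (quot_extcat \<C> J) (ess_image \<C> J \<X>)))
    Go Gm \<phi>"
proof -
  interpret extriangulated_category \<C> by (rule assms(1))
  define \<N> where "\<N> = right_perp \<C> (n + 1) \<X>"
  define \<Z> where "\<Z> = {(cosyzygy \<C> ^^ (i - 1)) X | X i. X \<in> \<X> \<and> 1 \<le> i \<and> i \<le> n + 1}"
  have N: "\<N> = left_perp \<C> (n + 1) \<X>" unfolding \<N>_def by (rule assms(11))
  have van: "higher_ext_vanishes \<C> i A B \<longleftrightarrow>
      exts \<C> A ((cosyzygy \<C> ^^ (i - 1)) B) = {\<one>\<^bsub>Ext \<C> A ((cosyzygy \<C> ^^ (i - 1)) B)\<^esub>}" for i A B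
    by (simp add: higher_ext_vanishes_def higher_ext_def)
  interpret iterated_quotient \<C> J \<X> \<N> \<Z>
  proof (intro iterated_quotient.intro iterated_quotient_axioms.intro)
    show "extriangulated_category \<C>" ..
    show "J \<subseteq> Obj \<C>" "free_of \<C> J = J" by (fact assms)+
    show "exts \<C> Y A = {\<one>\<^bsub>Ext \<C> Y A\<^esub>}" if "Y \<in> J" "A \<in> Obj \<C>" for Y A
      using projective_ext_vanishes that assms(6) by blast
    show "exts \<C> C Y = {\<one>\<^bsub>Ext \<C> C Y\<^esub>}" if "Y \<in> J" "C \<in> Obj \<C>" for Y C
      using injective_ext_vanishes that assms(6) by blast
    show "\<Z> \<subseteq> Obj \<C>" unfolding \<Z>_def using cosyzygy_Obj[OF assms(3)] assms(8) by blast
    show "\<N> = {N \<in> Obj \<C>. \<forall>Z \<in> \<Z>. exts \<C> N Z = {\<one>\<^bsub>Ext \<C> N Z\<^esub>}}"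
      unfolding N left_perp_def \<Z>_def van by blast
    have "higher_ext_vanishes \<C> i X X'" if "X \<in> \<X>" "X' \<in> \<X>" "1 \<le> i" "i \<le> n + 1" for i X X'
      using assms(10) that unfolding rigid_def by auto
    then show "\<X> \<subseteq> \<N>" unfolding \<N>_def right_perp_def using assms(8) by blast
    show "exts \<C> X A = {\<one>\<^bsub>Ext \<C> X A\<^esub>}" if X: "X \<in> \<X>" and A: "A \<in> \<N>" for X A
    proof -
      have "higher_ext_vanishes \<C> 1 X A" using X A unfolding \<N>_def right_perp_def by simp
      then show ?thesis by (simp add: van)
    qed
    show "exts \<C> A X = {\<one>\<^bsub>Ext \<C> A X\<^esub>}" if X: "X \<in> \<X>" and A: "A \<in> \<N>" for X A
    proof -
      have "higher_ext_vanishes \<C> 1 A X" using X A unfolding N left_perp_def by simp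
      then show ?thesis by (simp add: van)
    qed
  qed
  show ?thesis
    using G_equivalence unfolding ess_image_N \<N>_def[symmetric] by blast
qed

end
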